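(* Let $\alpha$ be a non-negative cone angle on $\mathbb{R}^d$, let $P\subseteq\mathbb{R}^d$ be a simplicial $d$-polytope, and let $\widehat\gamma(P)=\widehat\gamma(\alpha,P)$ and $\widehat\gamma(-P)=\widehat\gamma(\alpha,-P)$. Then: (1) (Dehn–Sommerville) $\widehat\gamma_i(P)+\widehat\gamma_{d-i}(-P)=h_i(P)$ for $i=0,\dots,d$; (2) (Non-negativity) $\widehat\gamma_i(P)\ge 0$ for $i=0,\dots,d$; (3) (Non-decreasing in the first half) $0=\widehat\gamma_0(P)\le\widehat\gamma_1(P)\le\dots\le\widehat\gamma_m(P)$, where $m=\lceil d/2\rceil$; (4) (Flawless) $\widehat\gamma_i(P)\le\widehat\gamma_{d-i}(P)$ for $0\le i\le\lfloor d/2\rfloor$.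
   Context: Let $\mathcal{C}^d$ be the set of all convex polyhedral cones in $\mathbb{R}^d$ with apex at the origin. A map $\alpha:\mathcal{C}^d\to\mathbb{R}$ is a valuation if $\alpha(C\cup C')=\alpha(C)+\alpha(C')-\alpha(C\cap C')$ for all $C,C'\in\mathcal{C}^d$ with $C\cup C'\in\mathcal{C}^d$; it is simple if $\alpha(C)=0$ whenever $\dim C<d$, and normalized if $\alpha(\mathbb{R}^d)=1$. A cone angle is a simple normalized valuation; it is non-negative if $\alpha(C)\ge0$ for all $C\in\mathcal{C}^d$. For a $d$-polytope $P\subseteq\mathbb{R}^d$ and a nonempty face $F$ of $P$, the tangent cone is $T_FP=\{x\in\mathbb{R}^d: q+\varepsilon x\in P\text{ for some }\varepsilon>0\}$ for any $q$ in the relative interior of $F$ (this does not depend on $q$). The interior angle vector is $\widehat\alpha_i(P)=\sum_{F\text{ an }i\text{-face of }P}\alpha(T_FP)$ for $0\le i\le d-1$, with $\widehat\alpha_{-1}(P)=0$. For a simplicial $d$-polytope $P$, the vector $\widehat\gamma(\alpha,P)=(\widehat\gamma_0(P),\dots,\widehat\gamma_d(P))$ is defined by the polynomial identity $\sum_{k=0}^d\widehat\gamma_k(P)t^{d-k}=\sum_{i=0}^d\widehat\alpha_{i-1}(P)(t-1)^{d-i}$. Here $-P=\{-x:x\in P\}$. The $h$-vector of $P$ is defined by $\sum_{i=0}^d f_{i-1}(P)(t-1)^{d-i}=\sum_{k=0}^d h_k(P)t^{d-k}$, where $f_i(P)$ is the number of $i$-dimensional faces of $P$ and $f_{-1}(P)=1$.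 *)

theory Defs
  imports "HOL-Analysis.Analysis" "HOL-Computational_Algebra.Polynomial"
begin

definition polyhedral_cone :: "'a::euclidean_space set \<Rightarrow> bool"
  where "polyhedral_cone C \<longleftrightarrow> convex_cone C \<and> polyhedron C"

text \<open>A real function on the set of polyhedral cones is represented by a function on all sets;
  only its values on polyhedral cones are ever constrained.\<close>

definition cone_valuation :: "('a::euclidean_space set \<Rightarrow> real) \<Rightarrow> bool"
  where "cone_valuation \<alpha> \<longleftrightarrow>
    (\<forall>C C'. polyhedral_cone C \<and> polyhedral_cone C' \<and> polyhedral_cone (C \<union> C') \<longrightarrow>
      \<alpha> (C \<union> C') = \<alpha> C + \<alpha> C' - \<alpha> (C \<inter> C'))"

definition simple_on_cones :: "('a::euclidean_space set \<Rightarrow> real) \<Rightarrow> bool"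
  where "simple_on_cones \<alpha> \<longleftrightarrow> (\<forall>C. polyhedral_cone C \<and> dim C < DIM('a) \<longrightarrow> \<alpha> C = 0)"

definition cone_angle :: "('a::euclidean_space set \<Rightarrow> real) \<Rightarrow> bool"
  where "cone_angle \<alpha> \<longleftrightarrow> cone_valuation \<alpha> \<and> simple_on_cones \<alpha> \<and> \<alpha> UNIV = 1"

definition nonneg_on_cones :: "('a::euclidean_space set \<Rightarrow> real) \<Rightarrow> bool"
  where "nonneg_on_cones \<alpha> \<longleftrightarrow> (\<forall>C. polyhedral_cone C \<longrightarrow> 0 \<le> \<alpha> C)"

definition full_polytope :: "'a::euclidean_space set \<Rightarrow> bool"
  where "full_polytope P \<longleftrightarrow> polytope P \<and> aff_dim P = int DIM('a)"

definition simplicial_polytope :: "'a::euclidean_space set \<Rightarrow> bool"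
  where "simplicial_polytope P \<longleftrightarrow>
    full_polytope P \<and> (\<forall>F. F face_of P \<and> F \<noteq> P \<longrightarrow> (\<exists>n. n simplex F))"

definition faces_of_dim :: "int \<Rightarrow> 'a::euclidean_space set \<Rightarrow> 'a set set"
  where "faces_of_dim i P = {F. F face_of P \<and> aff_dim F = i}"

definition tangent_cone :: "'a::euclidean_space set \<Rightarrow> 'a set \<Rightarrow> 'a set"
  where "tangent_cone F P =
    {x. \<exists>q\<in>rel_interior F. \<exists>\<epsilon>>0. q + \<epsilon> *\<^sub>R x \<in> P}"

text \<open>The tangent cone may be computed at any point of the relative interior of the face.\<close>

lemma tangent_cone_eq:
  assumes "convex P" "F face_of P" "q \<in> rel_interior F"
  shows "tangent_cone F P = {x. \<exists>\<epsilon>>0. q + \<epsilon> *\<^sub>R x \<in> P}"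
proof -
  have "\<exists>\<epsilon>>0. q + \<epsilon> *\<^sub>R x \<in> P"
    if p: "p \<in> rel_interior F" and e: "\<epsilon> > 0" "p + \<epsilon> *\<^sub>R x \<in> P" for p x \<epsilon>
  proof -
    have conv: "convex F" and sub: "F \<subseteq> P"
      using assms(2) by (auto simp: face_of_def)
    have "p \<in> F"
      using p rel_interior_subset by blast
    then obtain e where e1: "e > 1" and r: "(1 - e) *\<^sub>R p + e *\<^sub>R q \<in> F"
      using convex_rel_interior_iff[OF conv, of q] assms(3) by blast
    have "(1 - 1 / e) *\<^sub>R (p + \<epsilon> *\<^sub>R x) + (1 / e) *\<^sub>R ((1 - e) *\<^sub>R p + e *\<^sub>R q) \<in> P"
      by (rule convexD[OF assms(1) e(2) subsetD[OF sub r]]) (use e1 in auto)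
    moreover have "(1 - 1 / e) *\<^sub>R (p + \<epsilon> *\<^sub>R x) + (1 / e) *\<^sub>R ((1 - e) *\<^sub>R p + e *\<^sub>R q)
        = q + ((1 - 1 / e) * \<epsilon>) *\<^sub>R x"
    proof -
      have "(1 / e) *\<^sub>R ((1 - e) *\<^sub>R p + e *\<^sub>R q) = (1 / e - 1) *\<^sub>R p + q"
        using e1 by (simp add: scaleR_add_right diff_divide_distrib)
      then show ?thesis
        by (simp add: algebra_simps)
    qed
    ultimately have "q + ((1 - 1 / e) * \<epsilon>) *\<^sub>R x \<in> P"
      by simp
    moreover have "(1 - 1 / e) * \<epsilon> > 0"
      using e1 e(1) by simp
    ultimately show ?thesis
      by blast
  qed
  then show ?thesis
    using assms(3) by (auto simp: tangent_cone_def)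
qed

text \<open>Both vectors are indexed by integers, starting at \<open>-1\<close>.\<close>

definition interior_angle :: "('a::euclidean_space set \<Rightarrow> real) \<Rightarrow> 'a set \<Rightarrow> int \<Rightarrow> real"
  where "interior_angle \<alpha> P i =
    (if i = -1 then 0 else \<Sum>F\<in>faces_of_dim i P. \<alpha> (tangent_cone F P))"

definition f_number :: "'a::euclidean_space set \<Rightarrow> int \<Rightarrow> real"
  where "f_number P i = (if i = -1 then 1 else real (card (faces_of_dim i P)))"

text \<open>\<open>h_transform d a k\<close> is the coefficient of \<open>t ^ (d - k)\<close> in the polynomial
  \<open>\<Sum>i=0..d. a (i - 1) * (t - 1) ^ (d - i)\<close>, where \<open>[:-1, 1:]\<close> is \<open>t - 1\<close>.\<close>

definition h_transform :: "nat \<Rightarrow> (int \<Rightarrow> real) \<Rightarrow> nat \<Rightarrow> real"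
  where "h_transform d a k =
    coeff (\<Sum>i=0..d. smult (a (int i - 1)) ([:-1, 1:] ^ (d - i))) (d - k)"

lemma h_transform_unique:
  "(\<Sum>k=0..d. monom (g k) (d - k)) = (\<Sum>i=0..d. smult (a (int i - 1)) ([:-1, 1:] ^ (d - i)))
    \<longleftrightarrow> (\<forall>k\<le>d. g k = h_transform d a k)"
  (is "?L = ?R \<longleftrightarrow> _")
proof -
  have L: "coeff ?L (d - k) = g k" if "k \<le> d" for k
  proof -
    have "coeff ?L (d - k) = (\<Sum>j=0..d. if j = k then g j else 0)"
      unfolding coeff_sum coeff_monom using that by (intro sum.cong) auto
    then show ?thesis
      using that by simp
  qed
  have "degree (monom (g k) (d - k)) \<le> d" for k
    by (rule order.trans[OF degree_monom_le]) simp
  then have dL: "degree ?L \<le> d"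
    by (intro degree_sum_le) auto
  have dR: "degree ?R \<le> d"
  proof (intro degree_sum_le)
    fix i
    have "degree (smult (a (int i - 1)) ([:-1, 1:] ^ (d - i))) \<le> degree ([:-1, 1::real:] ^ (d - i))"
      by (rule degree_smult_le)
    also have "\<dots> \<le> d"
      by (simp add: degree_linear_power)
    finally show "degree (smult (a (int i - 1)) ([:-1, 1:] ^ (d - i))) \<le> d" .
  qed auto
  show ?thesis
  proof
    assume "?L = ?R"
    then show "\<forall>k\<le>d. g k = h_transform d a k"
      using L by (metis h_transform_def)
  next
    assume *: "\<forall>k\<le>d. g k = h_transform d a k"
    show "?L = ?R"
    proof (rule poly_eqI)
      fix n
      show "coeff ?L n = coeff ?R n"
      proof (cases "n \<le> d")
        case True
        then have "d - (d - n) = n" by simp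
        then show ?thesis
          using L[of "d - n"] * by (simp add: h_transform_def)
      next
        case False
        then show ?thesis
          using dL dR by (simp add: coeff_eq_0)
      qed
    qed
  qed
qed

definition gamma_vec :: "('a::euclidean_space set \<Rightarrow> real) \<Rightarrow> 'a set \<Rightarrow> nat \<Rightarrow> real"
  where "gamma_vec \<alpha> P k = h_transform DIM('a) (interior_angle \<alpha> P) k"

definition h_vec :: "'a::euclidean_space set \<Rightarrow> nat \<Rightarrow> real"
  where "h_vec P k = h_transform DIM('a) (f_number P) k"

end

theory Submission
  imports Defs "HOL-Library.Poly_Mapping" "HOL-Library.Z2"
    "HOL-Computational_Algebra.Fraction_Field"
begin

text \<open>
  Facet normals and the hyperplanes spanned by the cones over ridges cut space into chambers, and
  by simplicity \<open>\<alpha>\<close> is a non-negative combination of point evaluations at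
  generic points \<open>w\<close>, one per chamber. For fixed \<open>w\<close> the facets
  \<open>A\<close>, ordered by \<open>nrm A \<bullet> w\<close>, form a line shelling with
  restriction sets \<open>restr w A\<close>; the faces whose tangent cone contains
  \<open>w\<close> are the intervals over the facets of negative height, so the
  \<open>k\<close>-th entry of the gamma vector counts the facets of negative height with
  \<open>d - k\<close> restriction vertices. This gives (1), non-negativity, and reduces (3) and
  (4) to one inequality between the numbers of restriction sets of sizes \<open>r\<close> and
  \<open>s\<close>, \<open>s \<le> r\<close>, \<open>d \<le> r + s\<close>, in an initial
  segment of a shelling of a simplicial sphere. As it contains the generalized lower bound
  theorem, it needs a Lefschetz property; this is obtained from the anisotropy theorem of
  Papadakis and Petrotou over a field of rational functions of characteristic 2, following the
  degree formula of Karu and Xiao.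
\<close>

section \<open>Derivations of a field of rational functions of characteristic 2\<close>

text \<open>The facets below a height form a ball, and a ball has no Poincare duality, so a
  Lefschetz theorem for the sphere alone does not bound its restriction sets. Anisotropy does,
  because it speaks of single elements: a nonzero class of degree at most d/2 has a nonzero square
  after multiplication by the generic forms that bring it to degree d. It therefore passes to the
  subspace of classes supported on the ball. Characteristic 2 serves three purposes: signs disappear
  from determinants, squaring is additive, and squares are constants for every derivation, so that
  the degree of a square can be differentiated term by term. Partial derivatives require independent
  variables, which is why all coefficients of the linear forms are variables of the field. No face
  ring is constructed: polynomials are functions, classes are compared through the degree
  functional, and this functional is a finite sum of evaluations at points attached to the
  facets.\<close>

definition derivation :: "('k::comm_ring_1 \<Rightarrow> 'k) \<Rightarrow> bool"
  where "derivation D \<longleftrightarrow> (\<forall>x y. D (x + y) = D x + D y) \<and> (\<forall>x y. D (x * y) = D x * y + x * D y)"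

lemma derivation_add: "derivation D \<Longrightarrow> D (x + y) = D x + D y"
  and derivation_mult: "derivation D \<Longrightarrow> D (x * y) = D x * y + x * D y"
  by (simp_all add: derivation_def)

lemma derivation_0 [simp]: "derivation D \<Longrightarrow> D 0 = 0"
  using derivation_add[of D 0 0] by simp

lemma derivation_1 [simp]: "derivation D \<Longrightarrow> D 1 = 0"
  using derivation_mult[of D 1 1] by simp

lemma derivation_sum: "derivation D \<Longrightarrow> D (sum f A) = (\<Sum>x\<in>A. D (f x))"
  by (induction A rule: infinite_finite_induct) (simp_all add: derivation_add)

text \<open>The quotient rule. \<open>D\<close> uses a chosen representative; independence of the
  choice follows by applying \<delta> to the cross-multiplied equation of two
  representatives.\<close>

lemma derivation_extends_to_fract:
  fixes \<delta> :: "'r::idom \<Rightarrow> 'r"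
  assumes \<delta>: "derivation \<delta>"
  shows "\<exists>D. derivation D \<and> (\<forall>r. D (Fract r 1) = Fract (\<delta> r) 1)"
proof -
  define D where "D q = (let p = SOME p. snd p \<noteq> 0 \<and> q = Fract (fst p) (snd p) in
     Fract (\<delta> (fst p) * snd p - fst p * \<delta> (snd p)) (snd p * snd p))" for q
  have D: "D (Fract a b) = Fract (\<delta> a * b - a * \<delta> b) (b * b)" if b: "b \<noteq> 0" for a b
  proof -
    define p where "p = (SOME p. snd p \<noteq> 0 \<and> Fract a b = Fract (fst p) (snd p))"
    have "snd p \<noteq> 0 \<and> Fract a b = Fract (fst p) (snd p)"
      unfolding p_def by (rule someI[of _ "(a, b)"]) (use b in simp)
    then have p: "snd p \<noteq> 0" "a * snd p = fst p * b"
      using b by (auto simp: eq_fract)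
    have dp: "\<delta> a * snd p + a * \<delta> (snd p) = \<delta> (fst p) * b + fst p * \<delta> b"
      using arg_cong[OF p(2), of \<delta>] by (simp add: derivation_mult[OF \<delta>])
    have "(\<delta> (fst p) * snd p - fst p * \<delta> (snd p)) * (b * b)
        = (\<delta> (fst p) * b) * (snd p * b) - (fst p * b) * \<delta> (snd p) * b"
      by (simp add: algebra_simps)
    also have "\<dots> = (\<delta> a * snd p + a * \<delta> (snd p) - fst p * \<delta> b) * (snd p * b) - (a * snd p) * \<delta> (snd p) * b"
      using dp p(2) by (simp add: algebra_simps)
    also have "\<dots> = \<delta> a * b * (snd p * snd p) - (fst p * b) * \<delta> b * snd p"
      by (simp add: algebra_simps)
    also have "\<dots> = (\<delta> a * b - a * \<delta> b) * (snd p * snd p)"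
      unfolding p(2)[symmetric] by (simp add: algebra_simps)
    finally have "Fract (\<delta> (fst p) * snd p - fst p * \<delta> (snd p)) (snd p * snd p)
        = Fract (\<delta> a * b - a * \<delta> b) (b * b)"
      using b p(1) by (simp add: eq_fract)
    then show ?thesis
      by (simp add: D_def p_def[symmetric] Let_def)
  qed
  have "derivation D"
    unfolding derivation_def
  proof (intro conjI allI)
    fix x y :: "'r fract"
    obtain a b c d where x: "x = Fract a b" "b \<noteq> 0" and y: "y = Fract c d" "d \<noteq> 0"
      by (cases x, cases y) blast
    show "D (x + y) = D x + D y"
      using x(2) y(2) unfolding x(1) y(1)
      by (simp add: D eq_fract derivation_mult[OF \<delta>] derivation_add[OF \<delta>] algebra_simps)
    show "D (x * y) = D x * y + x * D y"
      using x(2) y(2) unfolding x(1) y(1)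
      by (simp add: D eq_fract derivation_mult[OF \<delta>] algebra_simps)
  qed
  then show ?thesis
    using \<delta> by (intro exI[of _ D]) (simp add: D)
qed

section \<open>Polynomials over the two-element field and their partial derivatives\<close>

type_synonym gf2_polys = "(nat \<Rightarrow>\<^sub>0 nat) \<Rightarrow>\<^sub>0 bit"

text \<open>Subtraction of exponents is truncated. This does no harm: when \<open>i\<close> has
  exponent zero in \<open>m\<close>, the coefficient is zero.\<close>

definition pderiv_monom :: "nat \<Rightarrow> (nat \<Rightarrow>\<^sub>0 nat) \<Rightarrow> 'c::comm_ring_1 \<Rightarrow> (nat \<Rightarrow>\<^sub>0 nat) \<Rightarrow>\<^sub>0 'c"
  where "pderiv_monom i m c = Poly_Mapping.single (m - Poly_Mapping.single i 1) (of_nat (Poly_Mapping.lookup m i) * c)"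

definition partial_deriv :: "nat \<Rightarrow> ((nat \<Rightarrow>\<^sub>0 nat) \<Rightarrow>\<^sub>0 'c) \<Rightarrow> (nat \<Rightarrow>\<^sub>0 nat) \<Rightarrow>\<^sub>0 'c::comm_ring_1"
  where "partial_deriv i p = (\<Sum>m\<in>Poly_Mapping.keys p. pderiv_monom i m (Poly_Mapping.lookup p m))"

lemma partial_deriv_single: "partial_deriv i (Poly_Mapping.single m c) = pderiv_monom i m c"
  by (cases "c = 0") (simp_all add: partial_deriv_def pderiv_monom_def)

lemma partial_deriv_add: "partial_deriv i (p + q) = partial_deriv i p + partial_deriv i q"
  unfolding partial_deriv_def
  by (rule setsum_keys_plus_distrib)
    (simp_all add: pderiv_monom_def single_add[symmetric] algebra_simps)

lemma poly_mapping_single_induct: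
  assumes "\<And>m c. P (Poly_Mapping.single m c)" "\<And>p q. P p \<Longrightarrow> P q \<Longrightarrow> P (p + q)"
  shows "P (p :: 'm \<Rightarrow>\<^sub>0 'c::comm_monoid_add)"
proof -
  have "P (\<Sum>m\<in>A. Poly_Mapping.single m (Poly_Mapping.lookup p m))" if "finite A" for A
    using that by induction (use assms(1)[of undefined 0] in \<open>auto intro: assms\<close>)
  then have "P (\<Sum>m\<in>Poly_Mapping.keys p. Poly_Mapping.single m (Poly_Mapping.lookup p m))"
    by simp
  also have "(\<Sum>m\<in>Poly_Mapping.keys p. Poly_Mapping.single m (Poly_Mapping.lookup p m)) = p"
    by (rule poly_mapping_eqI)
      (simp add: lookup_sum lookup_single when_def in_keys_iff sum.delta)
  finally show ?thesis .
qed

text \<open>Both sides of the product rule are additive in each factor, so it suffices to check two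
  single terms.\<close>

lemma derivation_partial_deriv:
  "derivation (partial_deriv i :: ((nat \<Rightarrow>\<^sub>0 nat) \<Rightarrow>\<^sub>0 'c::comm_ring_1) \<Rightarrow> _)"
  unfolding derivation_def
proof (intro conjI allI)
  have one: "Poly_Mapping.single (m - Poly_Mapping.single i 1) (of_nat (Poly_Mapping.lookup m i) * c)
      * Poly_Mapping.single n e
     = Poly_Mapping.single (m + n - Poly_Mapping.single i 1) (of_nat (Poly_Mapping.lookup m i) * (c * e))"
    for m n :: "nat \<Rightarrow>\<^sub>0 nat" and c e :: 'c
  proof (cases "Poly_Mapping.lookup m i = 0")
    case False
    then have "m - Poly_Mapping.single i 1 + n = m + n - Poly_Mapping.single i 1"
      by (intro poly_mapping_eqI) (auto simp: lookup_add lookup_minus lookup_single when_def)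
    then show ?thesis
      by (simp add: mult_single mult.assoc)
  qed simp
  have single: "partial_deriv i (Poly_Mapping.single m (c::'c) * Poly_Mapping.single n e)
      = partial_deriv i (Poly_Mapping.single m c) * Poly_Mapping.single n e
        + Poly_Mapping.single m c * partial_deriv i (Poly_Mapping.single n e)" for m n c e
    unfolding partial_deriv_single pderiv_monom_def one[of m c n e]
      mult.commute[of "Poly_Mapping.single m c"] one[of n e m c]
    by (simp add: mult_single partial_deriv_single pderiv_monom_def lookup_add single_add[symmetric]
        distrib_right add.commute[of n m] mult.commute[of e c])
  fix p q :: "(nat \<Rightarrow>\<^sub>0 nat) \<Rightarrow>\<^sub>0 'c"
  show "partial_deriv i (p + q) = partial_deriv i p + partial_deriv i q"
    by (rule partial_deriv_add)
  have "partial_deriv i (Poly_Mapping.single m (c::'c) * q)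
      = partial_deriv i (Poly_Mapping.single m c) * q + Poly_Mapping.single m c * partial_deriv i q" for m c
  proof (induction q rule: poly_mapping_single_induct)
    case (2 p q)
    then show ?case
      by (simp add: distrib_left partial_deriv_add)
  qed (rule single)
  then show "partial_deriv i (p * q) = partial_deriv i p * q + p * partial_deriv i q"
    by (induction p rule: poly_mapping_single_induct) (simp_all add: distrib_right partial_deriv_add)
qed

text \<open>These properties are the interface to the field: the independence of the variables
  \<open>X j\<close> is expressed by derivations dual to them.\<close>

lemma ex_char2_field_with_derivations:
  "\<exists>(X :: nat \<Rightarrow> gf2_polys fract) D. (1 :: gf2_polys fract) + 1 = 0 \<and>
    (\<forall>i. derivation (D i)) \<and> (\<forall>i j. D i (X j) = (if i = j then 1 else 0))"
proof -
  have "\<forall>i. \<exists>D. derivation D \<and> (\<forall>r :: gf2_polys. D (Fract r 1) = Fract (partial_deriv i r) 1)"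
    using derivation_extends_to_fract derivation_partial_deriv by blast
  then obtain D where D: "\<And>i. derivation (D i)"
    "\<And>i (r :: gf2_polys). D i (Fract r 1) = Fract (partial_deriv i r) 1"
    by metis
  define X :: "nat \<Rightarrow> gf2_polys fract"
    where "X j = Fract (Poly_Mapping.single (Poly_Mapping.single j 1) 1) 1" for j
  have "partial_deriv i (Poly_Mapping.single (Poly_Mapping.single j 1) 1)
      = (if i = j then 1 else 0 :: gf2_polys)" for i j
    by (simp add: partial_deriv_single pderiv_monom_def lookup_single)
  then have "D i (X j) = (if i = j then 1 else 0)" for i j
    by (simp add: X_def D(2) One_fract_def Zero_fract_def del: One_nat_def)
  moreover have "(1 :: gf2_polys fract) + 1 = 0"
  proof -
    have "(1 :: gf2_polys) + 1 = 0"
      by (simp only: single_one[symmetric] single_add[symmetric]) simp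
    then show ?thesis
      by (simp add: One_fract_def Zero_fract_def)
  qed
  ultimately show ?thesis
    using D(1) by blast
qed

section \<open>Determinants in characteristic 2\<close>

lemma char2_add_self: "(1::'k::comm_ring_1) + 1 = 0 \<Longrightarrow> (x::'k) + x = 0"
  by (metis distrib_left mult_1_right mult_zero_right)

lemma char2_uminus: "(1::'k::comm_ring_1) + 1 = 0 \<Longrightarrow> - x = (x::'k)"
  by (metis char2_add_self add_eq_0_iff2)

lemma char2_eq: "(1::'k::comm_ring_1) + 1 = 0 \<Longrightarrow> x + y = 0 \<Longrightarrow> x = (y::'k)"
  by (metis char2_uminus eq_neg_iff_add_eq_0)

lemma char2_sum_square:
  assumes "(1::'k::comm_ring_1) + 1 = 0"
  shows "(\<Sum>x\<in>A. f x)^2 = (\<Sum>x\<in>A. (f x :: 'k)^2)"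
proof (induction A rule: infinite_finite_induct)
  case (insert x A)
  have "2 * f x * (\<Sum>x\<in>A. f x) = 0"
    using char2_add_self[OF assms, of "f x * (\<Sum>x\<in>A. f x)"] by (simp only: mult.assoc mult_2 distrib_right)
  then show ?case
    using insert by (simp add: power2_sum)
qed auto

text \<open>Each unordered pair contributes the same value twice.\<close>

lemma char2_symmetric_sum:
  assumes two: "(1::'k::comm_ring_1) + 1 = 0" and "finite A"
    and sym: "\<And>i j. i \<in> A \<Longrightarrow> j \<in> A \<Longrightarrow> i \<noteq> j \<Longrightarrow> f i j = (f j i :: 'k)"
  shows "(\<Sum>i\<in>A. \<Sum>j\<in>A - {i}. f i j) = 0"
  using assms(2,3)
proof (induction A)
  case (insert x A)
  have "(\<Sum>i\<in>insert x A. \<Sum>j\<in>insert x A - {i}. f i j)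
      = (\<Sum>j\<in>A. f x j) + (\<Sum>i\<in>A. \<Sum>j\<in>insert x (A - {i}). f i j)"
  proof -
    have "(\<Sum>i\<in>A. \<Sum>j\<in>insert x A - {i}. f i j) = (\<Sum>i\<in>A. \<Sum>j\<in>insert x (A - {i}). f i j)"
      using insert.hyps by (intro sum.cong refl) auto
    then show ?thesis
      using insert.hyps by simp
  qed
  also have "(\<Sum>i\<in>A. \<Sum>j\<in>insert x (A - {i}). f i j) = (\<Sum>i\<in>A. f i x + (\<Sum>j\<in>A - {i}. f i j))"
    using insert.hyps by (intro sum.cong) auto
  also have "\<dots> = (\<Sum>i\<in>A. f i x)"
    using insert by (simp add: sum.distrib)
  also have "(\<Sum>i\<in>A. f i x) = (\<Sum>j\<in>A. f x j)"
    using insert.prems insert.hyps by (intro sum.cong) (metis insertI1 insertI2)+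
  finally show ?case
    using char2_add_self[OF two] by simp
qed simp

lemma Diff_singleton_swap: "A - {i} - {j} = A - {j} - {i}"
  by auto

text \<open>Laplace expansion along the last column \<open>k\<close>. Without signs this is a permanent, which in
  characteristic 2 is the determinant of the rows \<open>S\<close> for any order of \<open>S\<close>; it is meant for
  \<open>card S = k\<close>.\<close>

fun vol :: "('v \<Rightarrow> nat \<Rightarrow> 'k::comm_ring_1) \<Rightarrow> nat \<Rightarrow> 'v set \<Rightarrow> 'k" where
  "vol a 0 S = 1"
| "vol a (Suc k) S = (\<Sum>i\<in>S. a i k * vol a k (S - {i}))"

text \<open>For k + 1 rows this is the expansion of a determinant in which column \<open>l\<close>
  occurs twice. For \<open>l = k\<close> the double expansion is symmetric in the two removed rows;
  otherwise exchanging the two sums leads to the induction hypothesis.\<close>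

lemma vol_cramer:
  assumes two: "(1::'k::comm_ring_1) + 1 = 0" and "finite C" "l < k"
  shows "(\<Sum>i\<in>C. a i l * vol a k (C - {i})) = (0::'k)"
  using assms(2,3)
proof (induction k arbitrary: C)
  case (Suc k)
  have eq: "(\<Sum>i\<in>C. a i l * vol a (Suc k) (C - {i}))
      = (\<Sum>i\<in>C. \<Sum>j\<in>C - {i}. a i l * a j k * vol a k (C - {i} - {j}))"
    by (simp add: sum_distrib_left mult.assoc)
  show ?case
  proof (cases "l = k")
    case True
    show ?thesis
      unfolding eq by (rule char2_symmetric_sum[OF two Suc.prems(1)])
        (use True Diff_singleton_swap in \<open>metis (no_types, lifting) mult.commute\<close>)
  next
    case False
    have "(\<Sum>i\<in>C. \<Sum>j\<in>C - {i}. a i l * a j k * vol a k (C - {i} - {j}))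
        = (\<Sum>(i, j)\<in>Sigma C (\<lambda>i. C - {i}). a i l * a j k * vol a k (C - {i} - {j}))"
      using Suc.prems by (subst sum.Sigma) auto
    also have "\<dots> = (\<Sum>(j, i)\<in>Sigma C (\<lambda>j. C - {j}). a i l * a j k * vol a k (C - {i} - {j}))"
      by (rule sum.reindex_bij_witness[of _ "\<lambda>(i, j). (j, i)" "\<lambda>(i, j). (j, i)"]) auto
    also have "\<dots> = (\<Sum>j\<in>C. \<Sum>i\<in>C - {j}. a i l * a j k * vol a k (C - {i} - {j}))"
      using Suc.prems by (subst sum.Sigma) auto
    also have "\<dots> = (\<Sum>j\<in>C. a j k * (\<Sum>i\<in>C - {j}. a i l * vol a k (C - {j} - {i})))"
      by (simp add: sum_distrib_left mult.left_commute mult.assoc Diff_singleton_swap)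
    also have "\<dots> = 0"
      using Suc False by (simp add: less_Suc_eq)
    finally show ?thesis
      unfolding eq .
  qed
qed simp

text \<open>The \<open>c l\<close> are the cofactors of a linear form that vanishes on the points of \<open>H\<close>.\<close>

lemma vol_cofactors:
  assumes two: "(1::'k::comm_ring_1) + 1 = 0" and "finite H" "card H + 1 = m"
  shows "\<exists>c. \<forall>u. (\<Sum>l<m. c l * a u l) = (if u \<in> H then 0 else vol a m (insert u H) :: 'k)"
  using assms(2,3)
proof (induction m arbitrary: H)
  case (Suc m)
  then have cardH: "card H = m" by simp
  have "\<exists>c. \<forall>u. (\<Sum>l<m. c l * a u l) = (if u \<in> H - {j} then 0 else vol a m (insert u (H - {j})))"
    if "j \<in> H" for j
    using Suc.prems card_Suc_Diff1[OF Suc.prems(1) that] by (intro Suc.IH) simp_all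
  then have "\<exists>c. \<forall>j\<in>H. \<forall>u. (\<Sum>l<m. c j l * a u l)
      = (if u \<in> H - {j} then 0 else vol a m (insert u (H - {j})))"
    by (intro bchoice) blast
  then obtain c where c: "\<And>j u. j \<in> H \<Longrightarrow> (\<Sum>l<m. c j l * a u l)
      = (if u \<in> H - {j} then 0 else vol a m (insert u (H - {j})))"
    by blast
  \<comment> \<open>Expansion along column m: its own cofactor is the minor of \<open>H\<close>, and
    the other cofactors combine those belonging to the sets \<open>H - {j}\<close>.\<close>
  define c' where "c' l = (if l = m then vol a m H else \<Sum>j\<in>H. a j m * c j l)" for l
  have "(\<Sum>l<Suc m. c' l * a u l) = (if u \<in> H then 0 else vol a (Suc m) (insert u H))" for u
  proof -
    have "(\<Sum>l<m. c' l * a u l) = (\<Sum>l<m. \<Sum>j\<in>H. a j m * (c j l * a u l))"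
      by (simp add: c'_def sum_distrib_right mult.assoc)
    also have "\<dots> = (\<Sum>j\<in>H. a j m * (\<Sum>l<m. c j l * a u l))"
      by (subst sum.swap) (simp add: sum_distrib_left)
    also have "\<dots> = (\<Sum>j\<in>H. a j m * (if u \<in> H - {j} then 0 else vol a m (insert u (H - {j}))))"
      by (simp add: c)
    finally have *: "(\<Sum>l<Suc m. c' l * a u l) = a u m * vol a m H
        + (\<Sum>j\<in>H. a j m * (if u \<in> H - {j} then 0 else vol a m (insert u (H - {j}))))"
      by (simp add: c'_def)
    show ?thesis
    proof (cases "u \<in> H")
      case True
      have "(\<Sum>j\<in>H. a j m * (if u \<in> H - {j} then 0 else vol a m (insert u (H - {j}))))
          = (\<Sum>j\<in>H. if j = u then a u m * vol a m H else 0)"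
        using True by (intro sum.cong) (auto simp: insert_absorb)
      then show ?thesis
        using * True Suc.prems char2_add_self[OF two, of "a u m * vol a m H"] by simp
    next
      case False
      have "vol a (Suc m) (insert u H) = a u m * vol a m H + (\<Sum>j\<in>H. a j m * vol a m (insert u (H - {j})))"
      proof -
        have "insert u H - {j} = insert u (H - {j})" if "j \<in> H" for j
          using False that by auto
        then show ?thesis
          using False Suc.prems by simp
      qed
      with * False show ?thesis by simp
    qed
  qed
  then show ?case by blast
qed simp

text \<open>Multilinearity in the rows: apart from the unchanged minor, only terms with a single row
  \<open>j\<close> replaced by row \<open>p\<close> survive. Terms with two replaced rows come in
  equal pairs and cancel.\<close>

lemma vol_eliminate_aux:
  fixes a :: "'v \<Rightarrow> nat \<Rightarrow> 'k::comm_ring_1"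
  assumes two: "(1::'k) + 1 = 0" and "finite S" "p \<notin> S" "card S = m"
  shows "vol (\<lambda>i k. a i k + \<rho> i * a p k) m S
     = vol a m S + (\<Sum>j\<in>S. \<rho> j * vol a m (insert p (S - {j})))"
  using assms(2-)
proof (induction m arbitrary: S)
  case (Suc m)
  define T where "T i j = vol a m (insert p (S - {i} - {j}))" for i j
  have T_sym: "T i j = T j i" for i j
    by (simp add: T_def Diff_singleton_swap)
  have IH: "vol (\<lambda>i k. a i k + \<rho> i * a p k) m (S - {i})
      = vol a m (S - {i}) + (\<Sum>j\<in>S - {i}. \<rho> j * T i j)" if "i \<in> S" for i
    unfolding T_def using Suc.prems that by (intro Suc.IH) auto
  have split: "vol a (Suc m) (insert p (S - {j}))
      = a p m * vol a m (S - {j}) + (\<Sum>i\<in>S - {j}. a i m * T j i)" if "j \<in> S" for j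
  proof -
    have "insert p (S - {j}) - {i} = insert p (S - {j} - {i})" if "i \<in> S - {j}" for i
      using Suc.prems that by auto
    moreover have "insert p (S - {j}) - {p} = S - {j}"
      using Suc.prems by auto
    ultimately show ?thesis
      using Suc.prems by (simp add: T_def)
  qed
  have swap: "(\<Sum>i\<in>S. \<Sum>j\<in>S - {i}. f i j) = (\<Sum>j\<in>S. \<Sum>i\<in>S - {j}. f i j :: 'k)" for f
  proof -
    have "(\<Sum>i\<in>S. \<Sum>j\<in>S - {i}. f i j) = (\<Sum>(i, j)\<in>Sigma S (\<lambda>i. S - {i}). f i j)"
      using Suc.prems by (subst sum.Sigma) auto
    also have "\<dots> = (\<Sum>(j, i)\<in>Sigma S (\<lambda>j. S - {j}). f i j)"
      by (rule sum.reindex_bij_witness[of _ "\<lambda>(i, j). (j, i)" "\<lambda>(i, j). (j, i)"]) auto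
    also have "\<dots> = (\<Sum>j\<in>S. \<Sum>i\<in>S - {j}. f i j)"
      using Suc.prems by (subst sum.Sigma) auto
    finally show ?thesis .
  qed
  have zero: "(\<Sum>i\<in>S. \<Sum>j\<in>S - {i}. \<rho> i * \<rho> j * T i j) = 0"
    by (rule char2_symmetric_sum[OF two Suc.prems(1)]) (simp add: T_sym mult_ac)
  have "vol (\<lambda>i k. a i k + \<rho> i * a p k) (Suc m) S
      = (\<Sum>i\<in>S. (a i m + \<rho> i * a p m) * (vol a m (S - {i}) + (\<Sum>j\<in>S - {i}. \<rho> j * T i j)))"
    using IH by simp
  also have "\<dots> = (\<Sum>i\<in>S. a i m * vol a m (S - {i})) + (\<Sum>i\<in>S. \<rho> i * (a p m * vol a m (S - {i})))
      + (\<Sum>i\<in>S. \<Sum>j\<in>S - {i}. a i m * (\<rho> j * T i j)) + a p m * (\<Sum>i\<in>S. \<Sum>j\<in>S - {i}. \<rho> i * \<rho> j * T i j)"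
    by (simp add: sum.distrib[symmetric] sum_distrib_left algebra_simps)
  also have "(\<Sum>i\<in>S. \<Sum>j\<in>S - {i}. a i m * (\<rho> j * T i j)) = (\<Sum>j\<in>S. \<rho> j * (\<Sum>i\<in>S - {j}. a i m * T j i))"
    by (subst swap) (simp add: sum_distrib_left mult_ac T_sym)
  finally have "vol (\<lambda>i k. a i k + \<rho> i * a p k) (Suc m) S
      = (\<Sum>i\<in>S. a i m * vol a m (S - {i})) + (\<Sum>j\<in>S. \<rho> j * vol a (Suc m) (insert p (S - {j})))"
    using split zero by (simp add: sum.distrib distrib_left add.assoc)
  then show ?case by simp
qed simp

text \<open>Gaussian elimination with pivot \<open>a p m\<close>. In characteristic 2 the multiple
  of row \<open>p\<close> is added rather than subtracted to clear column m.\<close>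

lemma vol_eliminate:
  fixes a :: "'v \<Rightarrow> nat \<Rightarrow> 'k::field"
  assumes two: "(1::'k) + 1 = 0" and S: "finite S" "p \<notin> S" "card S = m" and p: "a p m \<noteq> 0"
  shows "vol a (Suc m) (insert p S) = a p m * vol (\<lambda>i k. a i k + a i m / a p m * a p k) m S"
proof -
  have "insert p S - {j} = insert p (S - {j})" if "j \<in> S" for j
    using S that by auto
  then show ?thesis
    unfolding vol_eliminate_aux[OF two S, of _ "\<lambda>i. a i m / a p m"]
    using S p by (simp add: distrib_left sum_distrib_left)
qed

section \<open>Iterated derivatives of monomials in the maximal minors\<close>

lemma derivation_inverse_0:
  "derivation D \<Longrightarrow> D x = 0 \<Longrightarrow> D (inverse x :: 'k::field) = 0"
  using derivation_mult[of D x "inverse x"] by (cases "x = 0") auto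

lemma derivation_divide_0:
  "derivation D \<Longrightarrow> D x = 0 \<Longrightarrow> D y = 0 \<Longrightarrow> D (x / y :: 'k::field) = 0"
  by (simp add: divide_inverse derivation_mult derivation_inverse_0)

lemma derivation_mult_const: "derivation D \<Longrightarrow> D c = 0 \<Longrightarrow> D (c * x) = c * D x"
  by (simp add: derivation_mult)

lemma derivation_square_0:
  "(1::'k::field) + 1 = 0 \<Longrightarrow> derivation D \<Longrightarrow> D ((x::'k)\<^sup>2) = 0"
  using char2_add_self[of "D x * x"] by (simp only: power2_eq_square derivation_mult mult.commute[of x "D x"])

lemma derivation_vol_0:
  assumes "derivation D" "\<And>i l. i \<in> S \<Longrightarrow> l < k \<Longrightarrow> D (a i l) = 0"
  shows "D (vol a k S) = 0"
  using assms(2)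
proof (induction k arbitrary: S)
  case (Suc k)
  have "D (vol a k (S - {i})) = 0" for i
    by (rule Suc.IH) (use Suc.prems in auto)
  with Suc.prems show ?case
    by (simp add: derivation_sum[OF assms(1)] derivation_mult[OF assms(1)])
qed (simp add: assms(1))

text \<open>\<open>D i k\<close> plays the role of the partial derivative with respect to the entry
  \<open>a i k\<close>, so that these entries behave as independent variables.\<close>

definition dual_derivations :: "('v \<Rightarrow> nat \<Rightarrow> 'k \<Rightarrow> 'k) \<Rightarrow> ('v \<Rightarrow> nat \<Rightarrow> 'k::field) \<Rightarrow> 'v set \<Rightarrow> nat \<Rightarrow> bool"
  where "dual_derivations D a C d \<longleftrightarrow>
    (\<forall>i\<in>C. \<forall>k<d. derivation (D i k) \<and> (\<forall>j\<in>C. \<forall>l<d. D i k (a j l) = (if i = j \<and> k = l then 1 else 0)))"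

lemma dual_derivationsD:
  assumes "dual_derivations D a C d" "i \<in> C" "k < d"
  shows "derivation (D i k)"
    and "j \<in> C \<Longrightarrow> l < d \<Longrightarrow> D i k (a j l) = (if i = j \<and> k = l then 1 else 0)"
  using assms by (auto simp: dual_derivations_def)

lemma dual_derivations_mono:
  "dual_derivations D a C d \<Longrightarrow> C' \<subseteq> C \<Longrightarrow> d' \<le> d \<Longrightarrow> dual_derivations D a C' d'"
  unfolding dual_derivations_def by (meson less_le_trans subsetD)

lemma derivation_vol_last:
  assumes D: "dual_derivations D a C d" and S: "S \<subseteq> C" "finite S" "i \<in> S" "k < d"
  shows "D i k (vol a (Suc k) S) = vol a k (S - {i})"
proof -
  have i: "i \<in> C"
    using S by blast
  note d = dual_derivationsD[OF D i S(4)]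
  have "D i k (vol a k (S - {j})) = 0" for j
    by (rule derivation_vol_0[OF d(1)]) (use d(2) S in auto)
  then have "D i k (vol a (Suc k) S) = (\<Sum>j\<in>S. D i k (a j k) * vol a k (S - {j}))"
    by (simp add: derivation_sum[OF d(1)] derivation_mult[OF d(1)])
  also have "\<dots> = (\<Sum>j\<in>S. if j = i then vol a k (S - {i}) else 0)"
    using d(2) S by (intro sum.cong) auto
  finally show ?thesis
    using S by simp
qed

text \<open>Differentiating by an entry of the last column leaves a smaller minor, and the empty
  minor is 1.\<close>

lemma vol_nonzero:
  assumes "dual_derivations D a C d" "S \<subseteq> C" "finite S" "card S = k" "k \<le> d"
  shows "vol a k S \<noteq> 0"
  using assms(2-)
proof (induction k arbitrary: S)
  case (Suc k)
  then obtain i where i: "i \<in> S"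
    by fastforce
  have "vol a k (S - {i}) \<noteq> 0"
    using Suc.prems i by (intro Suc.IH) auto
  then have "D i k (vol a (Suc k) S) \<noteq> 0"
    using derivation_vol_last[OF assms(1), of S i k] Suc.prems i by simp
  moreover have "derivation (D i k)"
    using dual_derivationsD(1)[OF assms(1), of i k] Suc.prems i by auto
  ultimately show ?case
    by (metis derivation_0)
qed simp

text \<open>One entry is differentiated in every column, that of row \<open>I k\<close> in column
  \<open>k\<close>. An index sequence thus also encodes a monomial in the rows.\<close>

fun iter_deriv :: "('v \<Rightarrow> nat \<Rightarrow> 'k \<Rightarrow> 'k) \<Rightarrow> (nat \<Rightarrow> 'v) \<Rightarrow> nat \<Rightarrow> 'k \<Rightarrow> 'k" where
  "iter_deriv D I 0 x = x"
| "iter_deriv D I (Suc k) x = D (I k) k (iter_deriv D I k x)"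

lemma iter_deriv_0: "(\<And>k. k < m \<Longrightarrow> derivation (D (I k) k)) \<Longrightarrow> iter_deriv D I m 0 = 0"
  by (induction m) auto

lemma iter_deriv_sum:
  "(\<And>k. k < m \<Longrightarrow> derivation (D (I k) k)) \<Longrightarrow> iter_deriv D I m (sum f A) = (\<Sum>x\<in>A. iter_deriv D I m (f x))"
  by (induction m) (auto simp: derivation_sum)

lemma iter_deriv_const:
  "(\<And>k. k < m \<Longrightarrow> derivation (D (I k) k)) \<Longrightarrow> (\<And>k. k < m \<Longrightarrow> D (I k) k c = 0) \<Longrightarrow>
    iter_deriv D I m (c * x) = c * iter_deriv D I m x"
  by (induction m) (auto simp: derivation_mult_const)

definition occ :: "(nat \<Rightarrow> 'v) \<Rightarrow> nat \<Rightarrow> 'v \<Rightarrow> nat"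
  where "occ I m i = card {k. k < m \<and> I k = i}"

lemma occ_0 [simp]: "occ I 0 i = 0"
  by (simp add: occ_def)

lemma occ_Suc: "occ I (Suc m) i = occ I m i + (if I m = i then 1 else 0)"
proof -
  have "{k. k < Suc m \<and> I k = i} = {k. k < m \<and> I k = i} \<union> (if I m = i then {m} else {})"
    by (auto simp: less_Suc_eq)
  then show ?thesis
    by (simp add: occ_def)
qed

lemma sum_occ: "finite C \<Longrightarrow> (\<And>k. k < m \<Longrightarrow> I k \<in> C) \<Longrightarrow> (\<Sum>i\<in>C. occ I m i) = m"
  by (induction m) (auto simp: occ_Suc sum.distrib)

text \<open>The minor omitting row \<open>i\<close> has exponent \<open>occ I m i - 1\<close>; the
  quotient accommodates the exponent -1 of a row that does not occur.\<close>

definition occ_weight :: "('v \<Rightarrow> nat \<Rightarrow> 'k::field) \<Rightarrow> (nat \<Rightarrow> 'v) \<Rightarrow> nat \<Rightarrow> nat \<Rightarrow> 'v set \<Rightarrow> 'k"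
  where "occ_weight a I m n C = (\<Prod>i\<in>C. vol a n (C - {i}) ^ occ I m i / vol a n (C - {i}))"

text \<open>Up to a square, which every derivation treats as a constant, multiplication by
  \<open>X s\<close> toggles membership of \<open>s\<close> in \<open>T\<close>.\<close>

lemma prod_toggle:
  fixes X :: "'v \<Rightarrow> 'k::comm_ring_1"
  assumes "finite T"
  shows "X s * (\<Prod>i\<in>T. X i) = (if s \<in> T then (X s)\<^sup>2 * (\<Prod>i\<in>T - {s}. X i) else (\<Prod>i\<in>insert s T. X i))"
  using assms by (auto simp: prod.remove power2_eq_square mult.assoc)

text \<open>A row \<open>p\<close> with \<open>occ I m p = 0\<close> is not differentiated, so it can be used to eliminate column \<open>m\<close>.\<close>

lemma iter_deriv_partial_step:
  fixes a :: "'v \<Rightarrow> nat \<Rightarrow> 'k::field"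
  assumes two: "(1::'k) + 1 = 0" and C: "finite C" "card C = m + 2"
    and D: "dual_derivations D a C (Suc m)" and I: "\<And>k. k < m \<Longrightarrow> I k \<in> C"
    and T: "T \<subseteq> C" "odd (card T)"
    and IH: "\<And>(a' :: 'v \<Rightarrow> nat \<Rightarrow> 'k) C' T. finite C' \<Longrightarrow> card C' = m + 1 \<Longrightarrow> dual_derivations D a' C' m \<Longrightarrow>
      (\<And>k. k < m \<Longrightarrow> I k \<in> C') \<Longrightarrow> T \<subseteq> C' \<Longrightarrow> even (card T) \<Longrightarrow>
      iter_deriv D I m ((\<Prod>i\<in>T. vol a' m (C' - {i})) * occ_weight a' I m m C')
        = (if T = {} then (occ_weight a' I m m C')\<^sup>2 else 0)"
  shows "iter_deriv D I m ((\<Prod>i\<in>T. vol a (Suc m) (C - {i})) * occ_weight a I m (Suc m) C)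
     = (\<Sum>i\<in>C. if T = {i} then a i m * (vol a (Suc m) (C - {i}) * occ_weight a I m (Suc m) C)\<^sup>2 else 0)"
proof -
  define X where "X i = vol a (Suc m) (C - {i})" for i
  define W where "W = occ_weight a I m (Suc m) C"
  \<comment> \<open>There are m differentiations but m + 2 rows.\<close>
  have "\<exists>p\<in>C. occ I m p = 0"
  proof (rule ccontr)
    assume none: "\<not> (\<exists>p\<in>C. occ I m p = 0)"
    have "1 \<le> occ I m i" if "i \<in> C" for i
      using none that by (cases "occ I m i") auto
    then have "(\<Sum>i\<in>C. 1) \<le> (\<Sum>i\<in>C. occ I m i)"
      by (rule sum_mono)
    moreover have "(\<Sum>i\<in>C. occ I m i) = m"
      by (rule sum_occ[OF C(1) I])
    ultimately show False
      using C(2) by simp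
  qed
  then obtain p where p: "p \<in> C" "occ I m p = 0" by blast
  define C' where "C' = C - {p}"
  have C': "finite C'" "card C' = m + 1" "p \<notin> C'" "C = insert p C'" "C' \<subseteq> C"
    using C p by (auto simp: C'_def)
  have I': "I k \<in> C'" if "k < m" for k
  proof -
    have "I k \<noteq> p"
      using p(2) that by (auto simp: occ_def)
    then show ?thesis
      using I[OF that] by (simp add: C'_def)
  qed
  define r where "r = a p m"
  have "r \<noteq> 0"
    using dual_derivationsD(1)[OF D p(1), of m] dual_derivationsD(2)[OF D p(1), of m p m] p(1)
    by (auto simp: r_def)
  \<comment> \<open>Elimination of column m by row \<open>p\<close>. The correction involves only
    row \<open>p\<close> and column m, neither of which is differentiated here, so the derivations
    stay dual to the new entries.\<close>
  define a' where "a' i k = a i k + a i m / a p m * a p k" for i k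
  have D': "dual_derivations D a' C' m"
    unfolding dual_derivations_def
  proof (intro ballI allI impI conjI)
    fix i k assume i: "i \<in> C'" "k < m"
    then have ik: "i \<in> C" "k < Suc m" using C' by auto
    note d = dual_derivationsD[OF D ik]
    show "derivation (D i k)" by (rule d(1))
    fix j l assume j: "j \<in> C'" "l < m"
    have "D i k (a j m) = 0" "D i k (a p m) = 0" "D i k (a p l) = 0"
      using i j p C' by (auto simp: d(2))
    then have "D i k (a j m / a p m * a p l) = 0"
      unfolding derivation_mult[OF d(1)] using derivation_divide_0[OF d(1)] by simp
    then have "D i k (a' j l) = D i k (a j l)"
      unfolding a'_def derivation_add[OF d(1)] by simp
    then show "D i k (a' j l) = (if i = j \<and> k = l then 1 else 0)"
      using d(2)[of j l] j C'(5) by auto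
  qed
  define X' where "X' i = vol a' m (C' - {i})" for i
  have X': "X i = r * X' i" if "i \<in> C'" for i
  proof -
    have "C - {i} = insert p (C' - {i})"
      using that C' by auto
    then have "X i = vol a (Suc m) (insert p (C' - {i}))"
      by (simp only: X_def)
    also have "\<dots> = r * X' i"
      unfolding X'_def r_def a'_def
      by (rule vol_eliminate[OF two]) (use C' that \<open>r \<noteq> 0\<close> in \<open>auto simp: r_def\<close>)
    finally show ?thesis .
  qed
  have X_nz: "X i \<noteq> 0" if "i \<in> C" for i
    unfolding X_def using C that by (intro vol_nonzero[OF D]) auto
  define Y' where "Y' = occ_weight a' I m m C'"
  define Y where "Y = (\<Prod>i\<in>C'. X i ^ occ I m i / X i)"
  \<comment> \<open>The m + 1 minors in \<open>Y\<close> carry total exponent m - (m + 1) = -1, so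
    the common factor \<open>r\<close> of the minors enters to the power -1.\<close>
  have Y': "Y' = r * Y"
  proof -
    have "Y = (\<Prod>i\<in>C'. (r ^ occ I m i / r) * (X' i ^ occ I m i / X' i))"
      unfolding Y_def by (intro prod.cong) (simp_all add: X' power_mult_distrib)
    also have "\<dots> = (\<Prod>i\<in>C'. r ^ occ I m i / r) * Y'"
      by (simp only: prod.distrib Y'_def occ_weight_def X'_def)
    also have "(\<Prod>i\<in>C'. r ^ occ I m i / r) = r ^ m / r ^ (m + 1)"
    proof -
      have "(\<Sum>i\<in>C'. occ I m i) = m"
        by (rule sum_occ[OF C'(1)]) (rule I')
      then show ?thesis
        unfolding prod_dividef power_sum[symmetric] by (simp add: C'(2))
    qed
    also have "r ^ m / r ^ (m + 1) = 1 / r"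
      using \<open>r \<noteq> 0\<close> by simp
    finally show ?thesis
      using \<open>r \<noteq> 0\<close> by simp
  qed
  have W: "W = Y / X p"
  proof -
    have "W = (\<Prod>i\<in>insert p C'. X i ^ occ I m i / X i)"
      by (simp only: W_def occ_weight_def X_def C'(4)[symmetric])
    also have "\<dots> = Y / X p"
      using C'(1,3) p(2) by (simp add: Y_def)
    finally show ?thesis .
  qed
  have iterY: "iter_deriv D I m ((\<Prod>i\<in>T. X i) * Y) = (if T = {} then r * Y\<^sup>2 else 0)"
    if T: "T \<subseteq> C'" "even (card T)" for T
  proof -
    have "(\<Prod>i\<in>T. X i) * Y = (r ^ card T / r) * ((\<Prod>i\<in>T. X' i) * Y')"
    proof -
      have "(\<Prod>i\<in>T. X i) = (\<Prod>i\<in>T. r * X' i)"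
        using T X' by (intro prod.cong) auto
      then show ?thesis
        using \<open>r \<noteq> 0\<close> by (simp add: prod.distrib Y')
    qed
    also have "iter_deriv D I m \<dots> = (r ^ card T / r) * iter_deriv D I m ((\<Prod>i\<in>T. X' i) * Y')"
    proof (rule iter_deriv_const)
      fix k assume k: "k < m"
      have ik: "I k \<in> C" "k < Suc m" using I k by auto
      note d = dual_derivationsD[OF D ik]
      show "derivation (D (I k) k)" by (rule d(1))
      have r0: "D (I k) k r = 0" using d(2)[of p m] p k by (simp add: r_def)
      have "D (I k) k (r ^ n) = 0" for n
        by (induction n) (simp_all add: d(1) derivation_mult[OF d(1)] r0)
      then show "D (I k) k (r ^ card T / r) = 0"
        by (intro derivation_divide_0[OF d(1)] r0)
    qed
    also have "iter_deriv D I m ((\<Prod>i\<in>T. X' i) * Y') = (if T = {} then Y'\<^sup>2 else 0)"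
      unfolding X'_def Y'_def by (rule IH[OF C'(1,2) D' _ T]) (rule I')
    finally show ?thesis
      using \<open>r \<noteq> 0\<close> by (simp add: Y' power2_eq_square)
  qed
  have const: "iter_deriv D I m (c * x) = c * iter_deriv D I m x"
    if "\<And>k. k < m \<Longrightarrow> D (I k) k c = 0" for c x
    using dual_derivationsD(1)[OF D] I that by (intro iter_deriv_const) auto
  have der: "derivation (D (I k) k)" if "k < m" for k
    using dual_derivationsD(1)[OF D, of "I k" k] I that by simp
  have finT: "finite T"
    using T C finite_subset by blast
  have "iter_deriv D I m ((\<Prod>i\<in>T. X i) * W) = (\<Sum>i\<in>C. if T = {i} then a i m * (X i * W)\<^sup>2 else 0)"
  proof (cases "p \<in> T")
    case True
    have T': "T - {p} \<subseteq> C'" "even (card (T - {p}))"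
      using T True finT by (auto simp: C'_def)
    have "(\<Prod>i\<in>T. X i) * W = (\<Prod>i\<in>T - {p}. X i) * Y"
      using True finT X_nz[OF p(1)] by (simp add: W prod.remove)
    then have *: "iter_deriv D I m ((\<Prod>i\<in>T. X i) * W) = (if T - {p} = {} then r * Y\<^sup>2 else 0)"
      using iterY[OF T'] by simp
    show ?thesis
    proof (cases "T = {p}")
      case True
      have "(\<Sum>i\<in>C. if T = {i} then a i m * (X i * W)\<^sup>2 else 0) = (\<Sum>i\<in>C. if p = i then a i m * (X i * W)\<^sup>2 else 0)"
        using True by (intro sum.cong) auto
      then show ?thesis
        using * True C p X_nz[OF p(1)] by (simp add: W r_def)
    next
      case False
      then have "T - {p} \<noteq> {}" "\<And>i. T \<noteq> {i}"
        using True by auto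
      then show ?thesis
        using * by simp
    qed
  next
    case False
    then have TC': "T \<subseteq> C'"
      using T by (auto simp: C'_def)
    \<comment> \<open>The minor \<open>X p\<close> in the denominator of \<open>W\<close> depends on
      differentiated rows. Writing \<open>1 / X p\<close> as \<open>X p * (1 / X p)\<^sup>2\<close>
      makes the square a constant, and Cramer's relation expresses the remaining \<open>X p\<close>
      by the other minors.\<close>
    have cramer: "X p = (\<Sum>i\<in>C'. a i m / r * X i)"
    proof -
      have "r * X p + (\<Sum>i\<in>C'. a i m * X i) = 0"
        using vol_cramer[OF two C(1), of m "Suc m" a] C' by (simp add: X_def r_def)
      then have "r * X p = (\<Sum>i\<in>C'. a i m * X i)"
        by (rule char2_eq[OF two])
      then show ?thesis
        using \<open>r \<noteq> 0\<close> by (simp add: sum_divide_distrib[symmetric] field_simps)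
    qed
    have expand: "(\<Prod>i\<in>T. X i) * W = (\<Sum>i\<in>C'. (a i m / r * (1 / X p)\<^sup>2) * (X i * (\<Prod>i\<in>T. X i) * Y))"
    proof -
      have "(\<Prod>i\<in>T. X i) * W = X p * ((1 / X p)\<^sup>2 * (\<Prod>i\<in>T. X i) * Y)"
        using X_nz[OF p(1)] by (simp add: W power2_eq_square)
      also have "\<dots> = (\<Sum>i\<in>C'. a i m / r * X i) * ((1 / X p)\<^sup>2 * (\<Prod>i\<in>T. X i) * Y)"
        by (simp only: cramer[symmetric])
      finally show ?thesis
        unfolding sum_distrib_right by (elim trans, intro sum.cong refl) (simp only: mult_ac)
    qed
    have step1: "iter_deriv D I m ((\<Prod>i\<in>T. X i) * W)
       = (\<Sum>i\<in>C'. iter_deriv D I m ((a i m / r * (1 / X p)\<^sup>2) * (X i * (\<Prod>i\<in>T. X i) * Y)))"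
      unfolding expand by (rule iter_deriv_sum) (rule der)
    have step2: "(\<Sum>i\<in>C'. iter_deriv D I m ((a i m / r * (1 / X p)\<^sup>2) * (X i * (\<Prod>i\<in>T. X i) * Y)))
        = (\<Sum>i\<in>C'. if T = {i} then a i m * (X i * W)\<^sup>2 else 0)"
    proof (rule sum.cong[OF refl])
      fix i assume i: "i \<in> C'"
      have c1: "D (I k) k (a i m / r * (1 / X p)\<^sup>2) = 0" if "k < m" for k
      proof -
        have ik: "I k \<in> C" "k < Suc m" using I that by auto
        note d = dual_derivationsD[OF D ik]
        have "D (I k) k (a i m) = 0" "D (I k) k r = 0"
          using d(2)[of p m] d(2)[of i m] that p(1) subsetD[OF C'(5) i] unfolding r_def by simp_all
        then have "D (I k) k (a i m / r) = 0"
          by (rule derivation_divide_0[OF d(1)])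
        then show ?thesis
          unfolding derivation_mult[OF d(1)] derivation_square_0[OF two d(1)] by simp
      qed
      have c2: "D (I k) k ((X i)\<^sup>2) = 0" if "k < m" for k
        by (rule derivation_square_0[OF two der[OF that]])
      have "iter_deriv D I m (X i * (\<Prod>i\<in>T. X i) * Y) = (if T = {i} then (X i)\<^sup>2 * (r * Y\<^sup>2) else 0)"
      proof (cases "i \<in> T")
        case True
        then have "X i * (\<Prod>i\<in>T. X i) * Y = (X i)\<^sup>2 * ((\<Prod>i\<in>T - {i}. X i) * Y)"
          by (simp only: prod_toggle[OF finT, of X i] if_True mult.assoc)
        then have "iter_deriv D I m (X i * (\<Prod>i\<in>T. X i) * Y)
            = (X i)\<^sup>2 * iter_deriv D I m ((\<Prod>i\<in>T - {i}. X i) * Y)"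
          by (simp only: const[of "(X i)\<^sup>2", OF c2])
        also have "\<dots> = (X i)\<^sup>2 * (if T - {i} = {} then r * Y\<^sup>2 else 0)"
          using TC' T(2) True finT by (subst iterY) auto
        also have "T - {i} = {} \<longleftrightarrow> T = {i}"
          using True by auto
        finally show ?thesis by simp
      next
        case False
        then have "iter_deriv D I m (X i * (\<Prod>i\<in>T. X i) * Y) = iter_deriv D I m ((\<Prod>i\<in>insert i T. X i) * Y)"
          by (simp only: prod_toggle[OF finT, of X i] if_False)
        also have "\<dots> = 0"
          using TC' T(2) False finT i by (subst iterY) auto
        finally show ?thesis
          using False by auto
      qed
      note main = this
      have pull: "iter_deriv D I m ((a i m / r * (1 / X p)\<^sup>2) * x)
          = (a i m / r * (1 / X p)\<^sup>2) * iter_deriv D I m x" for x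
        by (rule const) (rule c1)
      have coeff: "(a i m / r * (1 / X p)\<^sup>2) * ((X i)\<^sup>2 * (r * Y\<^sup>2)) = a i m * (X i * W)\<^sup>2"
        using \<open>r \<noteq> 0\<close> unfolding W power2_eq_square by simp
      show "iter_deriv D I m ((a i m / r * (1 / X p)\<^sup>2) * (X i * (\<Prod>i\<in>T. X i) * Y))
          = (if T = {i} then a i m * (X i * W)\<^sup>2 else 0)"
        unfolding pull main using coeff by (cases "T = {i}") (simp_all only: if_True if_False mult_zero_right simp_thms)
    qed
    have step3: "(\<Sum>i\<in>C'. if T = {i} then a i m * (X i * W)\<^sup>2 else 0)
        = (\<Sum>i\<in>C. if T = {i} then a i m * (X i * W)\<^sup>2 else 0)"
    proof (rule sum.mono_neutral_left[OF C(1) C'(5)], rule ballI)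
      fix i assume "i \<in> C - C'"
      then have "T \<noteq> {i}"
        using False unfolding C'_def by blast
      then show "(if T = {i} then a i m * (X i * W)\<^sup>2 else 0) = 0"
        by simp
    qed
    show ?thesis
      by (rule trans[OF step1 trans[OF step2 step3]])
  qed
  then show ?thesis
    by (simp only: X_def W_def)
qed


text \<open>\<open>occ_weight\<close> is the Jacobian of the logarithms of the ratios of the maximal minors with respect
  to the differentiated entries. The theorem expresses that the Cartier operator fixes logarithmic
  differential forms.\<close>

theorem iter_deriv_occ_weight:
  fixes a :: "'v \<Rightarrow> nat \<Rightarrow> 'k::field"
  assumes two: "(1::'k) + 1 = 0" and "finite C" "card C = d + 1"
    and "dual_derivations D a C d" and "\<And>k. k < d \<Longrightarrow> I k \<in> C"
    and "T \<subseteq> C" "even (card T)"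
  shows "iter_deriv D I d ((\<Prod>i\<in>T. vol a d (C - {i})) * occ_weight a I d d C)
     = (if T = {} then (occ_weight a I d d C)\<^sup>2 else 0)"
  using assms(2-)
proof (induction d arbitrary: a C T)
  case 0
  have "card C = 1"
    using 0(2) by simp
  then obtain c where "C = {c}"
    by (rule card_1_singletonE)
  with 0(5) have "T = {} \<or> T = {c}"
    by blast
  then have "T = {}"
    using 0(6) by auto
  with \<open>C = {c}\<close> show ?case
    by (simp add: occ_weight_def)
next
  case (Suc m)
  define s where "s = I m"
  have s: "s \<in> C"
    using Suc.prems(4)[of m] by (simp add: s_def)
  define X where "X i = vol a (Suc m) (C - {i})" for i
  define W where "W = occ_weight a I m (Suc m) C"
  have finT: "finite T"
    using Suc.prems finite_subset by blast
  have X_nz: "X i \<noteq> 0" if "i \<in> C" for i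
    unfolding X_def using Suc.prems that by (intro vol_nonzero[OF Suc.prems(3)]) auto
  have weight: "occ_weight a I (Suc m) (Suc m) C = X s * W"
  proof -
    have "occ_weight a I (Suc m) (Suc m) C
        = (\<Prod>i\<in>C. X i ^ (if I m = i then 1 else 0)) * (\<Prod>i\<in>C. X i ^ occ I m i / X i)"
      unfolding occ_weight_def X_def[symmetric] prod.distrib[symmetric]
      by (intro prod.cong) (simp_all add: occ_Suc power_add)
    also have "(\<Prod>i\<in>C. X i ^ (if I m = i then 1 else 0)) = (\<Prod>i\<in>C. if i = s then X i else 1)"
      by (intro prod.cong) (auto simp: s_def)
    also have "\<dots> = X s"
      using s Suc.prems(1) by simp
    finally show ?thesis
      by (simp only: W_def occ_weight_def X_def)
  qed
  have der: "derivation (D (I k) k)" if "k < Suc m" for k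
    using dual_derivationsD(1)[OF Suc.prems(3), of "I k" k] Suc.prems(4) that by simp
  note der_s = der[of m, folded s_def, OF lessI]
  \<comment> \<open>The additional factor \<open>X s\<close> of the full weight changes the parity
    of \<open>T\<close>, so an even \<open>T\<close> leads to the partial step for an odd
    set.\<close>
  have step: "iter_deriv D I m ((\<Prod>i\<in>T. X i) * W) = (\<Sum>i\<in>C. if T = {i} then a i m * (X i * W)\<^sup>2 else 0)"
    if "T \<subseteq> C" "odd (card T)" for T
    unfolding X_def W_def
  proof (rule iter_deriv_partial_step[OF two Suc.prems(1) _ Suc.prems(3) _ that])
    show "card C = m + 2"
      using Suc.prems(2) by simp
    show "I k \<in> C" if "k < m" for k
      using Suc.prems(4) that by simp
  qed (rule Suc.IH)
  have D_a: "D s m (a i m * z\<^sup>2) = (if i = s then z\<^sup>2 else 0)" if "i \<in> C" for i z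
  proof -
    have "D s m (a i m) = (if i = s then 1 else 0)"
      using dual_derivationsD(2)[OF Suc.prems(3) s, of m i m] that by auto
    then show ?thesis
      unfolding derivation_mult[OF der_s] derivation_square_0[OF two der_s] by simp
  qed
  \<comment> \<open>After m derivations the result is linear in column m with squares as
    coefficients, and the last derivation extracts the coefficient of row \<open>s\<close>.\<close>
  have D_sum: "D s m (\<Sum>i\<in>C. if Q i then a i m * (f i)\<^sup>2 else 0) = (if Q s then (f s)\<^sup>2 else 0)" for Q f
  proof -
    have "D s m (\<Sum>i\<in>C. if Q i then a i m * (f i)\<^sup>2 else 0) = (\<Sum>i\<in>C. if i = s then (if Q s then (f s)\<^sup>2 else 0) else 0)"
      unfolding derivation_sum[OF der_s] using D_a der_s by (intro sum.cong) auto
    then show ?thesis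
      using s Suc.prems(1) by simp
  qed
  have "iter_deriv D I (Suc m) ((\<Prod>i\<in>T. X i) * (X s * W)) = (if T = {} then (X s * W)\<^sup>2 else 0)"
  proof (cases "s \<in> T")
    case True
    have e1: "(\<Prod>i\<in>T. X i) * (X s * W) = (X s)\<^sup>2 * ((\<Prod>i\<in>T - {s}. X i) * W)"
      using prod_toggle[OF finT, of X s] True by (simp add: mult_ac)
    have e2: "iter_deriv D I m ((X s)\<^sup>2 * x) = (X s)\<^sup>2 * iter_deriv D I m x" for x
      by (rule iter_deriv_const) (simp_all add: der derivation_square_0[OF two])
    have e3: "T - {s} \<subseteq> C" "odd (card (T - {s}))"
      using Suc.prems(5,6) True finT by auto
    have "iter_deriv D I (Suc m) ((\<Prod>i\<in>T. X i) * (X s * W))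
        = D s m ((X s)\<^sup>2 * (\<Sum>i\<in>C. if T - {s} = {i} then a i m * (X i * W)\<^sup>2 else 0))"
      unfolding iter_deriv.simps e1 e2 step[OF e3] s_def[symmetric] ..
    also have "\<dots> = (X s)\<^sup>2 * (if T - {s} = {s} then (X s * W)\<^sup>2 else 0)"
      unfolding derivation_mult_const[OF der_s derivation_square_0[OF two der_s]] D_sum ..
    also have "\<dots> = 0"
      by auto
    finally show ?thesis
      using True by auto
  next
    case False
    have e1: "(\<Prod>i\<in>T. X i) * (X s * W) = (\<Prod>i\<in>insert s T. X i) * W"
      using prod_toggle[OF finT, of X s] False by (simp add: mult_ac)
    have e3: "insert s T \<subseteq> C" "odd (card (insert s T))"
      using Suc.prems(5,6) False finT s by auto
    have "iter_deriv D I (Suc m) ((\<Prod>i\<in>T. X i) * (X s * W))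
        = D s m (\<Sum>i\<in>C. if insert s T = {i} then a i m * (X i * W)\<^sup>2 else 0)"
      unfolding iter_deriv.simps e1 step[OF e3] s_def[symmetric] ..
    also have "\<dots> = (if insert s T = {s} then (X s * W)\<^sup>2 else 0)"
      by (rule D_sum)
    also have "insert s T = {s} \<longleftrightarrow> T = {}"
      using False by auto
    finally show ?thesis .
  qed
  then show ?case
    by (simp only: weight X_def)
qed

section \<open>The degree functional of a simplicial cycle\<close>

text \<open>Elimination of one unknown per equation. It supplies the coefficients of the element to
  which anisotropy is applied.\<close>

lemma homogeneous_system_nontrivial:
  fixes m :: "'s \<Rightarrow> 't \<Rightarrow> 'k::field"
  assumes "finite S" "finite T" "card S < card T"
  shows "\<exists>c. (\<exists>t\<in>T. c t \<noteq> 0) \<and> (\<forall>s\<in>S. (\<Sum>t\<in>T. c t * m s t) = 0)"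
  using assms
proof (induction S arbitrary: T m)
  case empty
  then have "T \<noteq> {}" by auto
  then show ?case
    by (intro exI[of _ "\<lambda>_. 1"]) auto
next
  case (insert s S)
  show ?case
  proof (cases "\<forall>t\<in>T. m s t = 0")
    case True
    have "card S < card T"
      using insert.prems insert.hyps by simp
    from insert.IH[OF insert.prems(1) this, of m] True show ?thesis
      by auto
  next
    case False
    then obtain t0 where t0: "t0 \<in> T" "m s t0 \<noteq> 0" by blast
    define T' where "T' = T - {t0}"
    have T': "finite T'" "t0 \<notin> T'" "T = insert t0 T'" "card S < card T'"
      using insert.prems insert.hyps t0 by (auto simp: T'_def)
    obtain c where c: "\<exists>t\<in>T'. c t \<noteq> 0"
      "\<And>s'. s' \<in> S \<Longrightarrow> (\<Sum>t\<in>T'. c t * (m s' t - m s' t0 / m s t0 * m s t)) = 0"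
      using insert.IH[OF T'(1,4), of "\<lambda>s' t. m s' t - m s' t0 / m s t0 * m s t"] by blast
    define \<sigma> where "\<sigma> = (\<Sum>t\<in>T'. c t * m s t)"
    define c' where "c' = c(t0 := - \<sigma> / m s t0)"
    have sum: "(\<Sum>t\<in>T. c' t * m s' t) = (\<Sum>t\<in>T'. c t * m s' t) - \<sigma> / m s t0 * m s' t0" for s'
    proof -
      have "(\<Sum>t\<in>T'. c' t * m s' t) = (\<Sum>t\<in>T'. c t * m s' t)"
        using T'(2) by (intro sum.cong) (auto simp: c'_def)
      then show ?thesis
        unfolding T'(3) sum.insert[OF T'(1,2)] by (simp add: c'_def)
    qed
    have "(\<Sum>t\<in>T. c' t * m s' t) = 0" if "s' \<in> S" for s'
    proof -
      have "(\<Sum>t\<in>T'. c t * (m s' t - m s' t0 / m s t0 * m s t))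
          = (\<Sum>t\<in>T'. c t * m s' t) - m s' t0 / m s t0 * \<sigma>"
        unfolding \<sigma>_def sum_distrib_left sum_subtractf[symmetric]
        by (intro sum.cong) (simp_all add: algebra_simps)
      then show ?thesis
        using c(2)[OF that] unfolding sum by simp
    qed
    moreover have "(\<Sum>t\<in>T. c' t * m s t) = 0"
      unfolding sum using t0(2) by (simp add: \<sigma>_def)
    moreover have "\<exists>t\<in>T. c' t \<noteq> 0"
      using c(1) T'(2,3) by (auto simp: c'_def)
    ultimately show ?thesis
      by blast
  qed
qed

lemma char2_of_nat_even:
  assumes "(1::'k::comm_ring_1) + 1 = 0" "even n"
  shows "of_nat n = (0::'k)"
proof -
  obtain k where "n = k + k"
    using assms(2) by (metis dvdE mult_2)
  then show ?thesis
    using char2_add_self[OF assms(1), of "of_nat k"] by (simp only: of_nat_add)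
qed

section \<open>Polynomial functions and homogeneity\<close>

definition mon :: "'v multiset \<Rightarrow> ('v \<Rightarrow> 'k::comm_ring_1) \<Rightarrow> 'k"
  where "mon M x = (\<Prod>v\<in>#M. x v)"

lemma mon_empty [simp]: "mon {#} x = 1"
  by (simp add: mon_def)

lemma mon_add_mset [simp]: "mon (add_mset v M) x = x v * mon M x"
  by (simp add: mon_def)

lemma mon_union [simp]: "mon (M + N) x = mon M x * mon N x"
  by (simp add: mon_def)

lemma mon_union_fun: "mon (M + N) = (\<lambda>x. mon M x * mon N x)"
  by (simp add: fun_eq_iff)

lemma card_set_mset_le_size: "card (set_mset M) \<le> size M"
  by (induction M) (simp_all add: card_insert_if)

lemma mon_mset_set: "mon (mset_set A) x = (\<Prod>v\<in>A. x v)"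
  by (simp add: mon_def prod_unfold_prod_mset)

lemma mon_eq_0_iff: "mon M (x :: 'v \<Rightarrow> 'k::field) = 0 \<longleftrightarrow> (\<exists>v\<in>#M. x v = 0)"
  by (induction M) auto

text \<open>A polynomial is represented by the function that it induces, and homogeneity by closing
  the monomials of degree \<open>n\<close> under linear combinations. Vanishing of a linear
  functional on them is then a rule induction.\<close>

inductive homogeneous :: "'v set \<Rightarrow> nat \<Rightarrow> (('v \<Rightarrow> 'k::comm_ring_1) \<Rightarrow> 'k) \<Rightarrow> bool" for V where
  monomial: "set_mset M \<subseteq> V \<Longrightarrow> size M = n \<Longrightarrow> homogeneous V n (mon M)"
| zero: "homogeneous V n (\<lambda>_. 0)"
| add: "homogeneous V n f \<Longrightarrow> homogeneous V n g \<Longrightarrow> homogeneous V n (\<lambda>x. f x + g x)"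
| scale: "homogeneous V n f \<Longrightarrow> homogeneous V n (\<lambda>x. c * f x)"

lemma homogeneous_sum:
  assumes "\<And>i. i \<in> A \<Longrightarrow> homogeneous V n (f i)"
  shows "homogeneous V n (\<lambda>x. \<Sum>i\<in>A. f i x)"
  using assms by (induction A rule: infinite_finite_induct) (auto intro: homogeneous.intros)

lemma homogeneous_mon_mult:
  assumes "homogeneous V n f" "set_mset M \<subseteq> V"
  shows "homogeneous V (size M + n) (\<lambda>x. mon M x * f x)"
  using assms(1)
proof induction
  case (monomial N n)
  then have "homogeneous V (size M + n) (mon (M + N))"
    using assms(2) by (intro homogeneous.monomial) auto
  then show ?case by (simp only: mon_union_fun)
next
  case (scale n f c)
  from homogeneous.scale[OF scale.IH, of c] show ?case
    by (simp only: mult.left_commute)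
qed (simp_all add: distrib_left homogeneous.intros)

lemma homogeneous_mult:
  assumes "homogeneous V n f" "homogeneous V m g"
  shows "homogeneous V (n + m) (\<lambda>x. f x * g x)"
  using assms(1)
proof induction
  case (monomial M n)
  then show ?case
    using homogeneous_mon_mult[OF assms(2)] by blast
next
  case (scale n f c)
  from homogeneous.scale[OF scale.IH, of c] show ?case
    by (simp only: mult.assoc)
qed (simp_all add: distrib_right homogeneous.intros)

lemma homogeneous_linear:
  fixes c :: "'v \<Rightarrow> 'k::comm_ring_1"
  shows "homogeneous V 1 (\<lambda>x. \<Sum>v\<in>V. c v * x v)"
proof (intro homogeneous_sum homogeneous.scale)
  fix v assume "v \<in> V"
  then have "homogeneous V 1 (mon {#v#} :: ('v \<Rightarrow> 'k) \<Rightarrow> 'k)"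
    by (intro homogeneous.monomial) auto
  moreover have "mon {#v#} = (\<lambda>x :: 'v \<Rightarrow> 'k. x v)"
    by (simp add: fun_eq_iff)
  ultimately show "homogeneous V 1 (\<lambda>x :: 'v \<Rightarrow> 'k. x v)"
    by simp
qed

lemma homogeneous_prod_linear:
  fixes c :: "'j \<Rightarrow> 'v \<Rightarrow> 'k::comm_ring_1"
  shows "homogeneous V (card J) (\<lambda>x. \<Prod>j\<in>J. \<Sum>v\<in>V. c j v * x v)"
proof (induction J rule: infinite_finite_induct)
  have one: "homogeneous V 0 (\<lambda>x :: 'v \<Rightarrow> 'k. 1)"
  proof -
    have "homogeneous V 0 (mon {#} :: ('v \<Rightarrow> 'k) \<Rightarrow> 'k)"
      by (rule homogeneous.monomial) auto
    moreover have "mon {#} = (\<lambda>x :: 'v \<Rightarrow> 'k. 1)"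
      by (simp add: fun_eq_iff)
    ultimately show ?thesis
      by simp
  qed
  {
    case (infinite J)
    with one show ?case by simp
  next
    case empty
    from one show ?case by simp
  }
next
  case (insert j J)
  have "homogeneous V (1 + card J) (\<lambda>x. (\<Sum>v\<in>V. c j v * x v) * (\<Prod>j\<in>J. \<Sum>v\<in>V. c j v * x v))"
    by (rule homogeneous_mult[OF homogeneous_linear insert.IH])
  with insert.hyps show ?case by simp
qed

text \<open>Columns \<open>l < d\<close> of \<open>a\<close> are the coefficients of a generic linear system of parameters, columns
  \<open>d + j\<close> those of generic Lefschetz elements. The auxiliary vertex \<open>star\<close> writes the cycle \<open>\<Delta>\<close> as the sum
  of the boundaries of the simplices \<open>insert star F\<close>.\<close>

locale lefschetz_setup =
  fixes \<Delta> :: "'v set set" and star :: 'v and d :: nat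
    and a :: "'v \<Rightarrow> nat \<Rightarrow> 'k::field" and D :: "'v \<Rightarrow> nat \<Rightarrow> 'k \<Rightarrow> 'k"
  assumes two: "(1::'k) + 1 = 0"
    and finite_facets: "finite \<Delta>"
    and facet: "F \<in> \<Delta> \<Longrightarrow> finite F" "F \<in> \<Delta> \<Longrightarrow> card F = d" "F \<in> \<Delta> \<Longrightarrow> star \<notin> F"
    and ridge: "F \<in> \<Delta> \<Longrightarrow> G \<subseteq> F \<Longrightarrow> card G + 1 = d \<Longrightarrow> even (card {F \<in> \<Delta>. G \<subseteq> F})"
    and dual: "dual_derivations D a (insert star (\<Union>\<Delta>)) (2 * d)"
begin

abbreviation V :: "'v set" where "V \<equiv> \<Union>\<Delta>"

lemma finite_V: "finite V"
  using finite_facets facet by blast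

text \<open>By Cramer's rule the face ring of the boundary of \<open>insert star F\<close> modulo the linear system of
  parameters is evaluation at the point \<open>p F\<close>, so \<open>deg\<close> is a weighted sum of point evaluations.\<close>

definition p :: "'v set \<Rightarrow> 'v \<Rightarrow> 'k"
  where "p F v = (if v \<in> F then vol a d (insert star (F - {v})) else 0)"

text \<open>The weight gives the squarefree monomial of a facet \<open>F\<close> the degree
  \<open>1 / vol a d F\<close>, since that monomial vanishes at the points of all other
  facets.\<close>

definition \<mu> :: "'v set \<Rightarrow> 'k"
  where "\<mu> F = 1 / (vol a d F * (\<Prod>v\<in>F. p F v))"

definition deg :: "(('v \<Rightarrow> 'k) \<Rightarrow> 'k) \<Rightarrow> 'k"
  where "deg f = (\<Sum>F\<in>\<Delta>. \<mu> F * f (p F))"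

definition lin :: "nat \<Rightarrow> ('v \<Rightarrow> 'k) \<Rightarrow> 'k"
  where "lin l x = (\<Sum>v\<in>V. a v l * x v)"

lemma deg_add: "deg (\<lambda>x. f x + g x) = deg f + deg g"
  by (simp add: deg_def distrib_left sum.distrib)

lemma deg_scale: "deg (\<lambda>x. c * f x) = c * deg f"
  by (simp add: deg_def sum_distrib_left mult.left_commute)

lemma deg_0: "deg (\<lambda>x. 0) = 0"
  by (simp add: deg_def)

lemma deg_sum: "deg (\<lambda>x. \<Sum>i\<in>A. f i x) = (\<Sum>i\<in>A. deg (f i))"
  by (induction A rule: infinite_finite_induct) (simp_all add: deg_0 deg_add)

lemma vol_d_nonzero: "S \<subseteq> insert star V \<Longrightarrow> finite S \<Longrightarrow> card S = k \<Longrightarrow> k \<le> d \<Longrightarrow> vol a k S \<noteq> 0"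
  by (rule vol_nonzero[OF dual]) auto

lemma vol_facet_nonzero: "F \<in> \<Delta> \<Longrightarrow> vol a d F \<noteq> 0"
  by (rule vol_d_nonzero) (auto simp: facet)

lemma card_swap_star: "F \<in> \<Delta> \<Longrightarrow> v \<in> F \<Longrightarrow> card (insert star (F - {v})) = d"
  using facet[of F] card_Suc_Diff1[of F v] by simp

lemma p_nonzero: "F \<in> \<Delta> \<Longrightarrow> v \<in> F \<Longrightarrow> p F v \<noteq> 0"
  unfolding p_def using vol_d_nonzero[of "insert star (F - {v})" d] card_swap_star facet(1) by auto

lemma mon_p_eq_0_iff: "F \<in> \<Delta> \<Longrightarrow> mon M (p F) = 0 \<longleftrightarrow> \<not> set_mset M \<subseteq> F"
  unfolding mon_eq_0_iff using p_nonzero by (auto simp: p_def)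

text \<open>Cramer's relation for the d + 1 rows \<open>insert star F\<close>, solved for the term
  of \<open>star\<close>. The value depends on \<open>F\<close> only through
  \<open>vol a d F\<close>, which cancels against \<mu>.\<close>

lemma linear_form_p:
  assumes "F \<in> \<Delta>" "l < d"
  shows "lin l (p F) = a star l * vol a d F"
proof -
  note f = facet[OF assms(1)]
  have "(\<Sum>i\<in>insert star F. a i l * vol a d (insert star F - {i})) = 0"
    by (rule vol_cramer[OF two]) (use f assms in auto)
  moreover have "(\<Sum>i\<in>F. a i l * vol a d (insert star F - {i})) = (\<Sum>v\<in>F. a v l * p F v)"
  proof (rule sum.cong[OF refl])
    fix v assume "v \<in> F"
    then have "insert star F - {v} = insert star (F - {v})"
      using f by auto
    with \<open>v \<in> F\<close> show "a v l * vol a d (insert star F - {v}) = a v l * p F v"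
      by (simp add: p_def)
  qed
  ultimately have "a star l * vol a d F + (\<Sum>v\<in>F. a v l * p F v) = 0"
    using f by simp
  then have "a star l * vol a d F = (\<Sum>v\<in>F. a v l * p F v)"
    by (rule char2_eq[OF two])
  also have "\<dots> = lin l (p F)"
    unfolding lin_def using finite_V assms(1) by (intro sum.mono_neutral_left) (auto simp: p_def)
  finally show ?thesis by simp
qed

text \<open>The degree of a linear form times \<open>mon M\<close>, up to the factor
  \<open>a star l\<close>.\<close>

definition residue_sum :: "'v multiset \<Rightarrow> 'k"
  where "residue_sum M = (\<Sum>F\<in>\<Delta>. mon M (p F) / (\<Prod>v\<in>F. p F v))"

text \<open>The cofactors of \<open>H\<close> combine the linear forms so that the coefficients of
  the vertices in \<open>H\<close> vanish. Because \<open>star\<close> belongs to \<open>H\<close>,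
  the same combination annihilates the right-hand sides \<open>a star l\<close>.\<close>

lemma linear_relation:
  assumes "finite H" "card H + 1 = m" "m \<le> d"
    and F: "F \<in> \<Delta>" and star: "star \<in> H"
  shows "(\<Sum>u\<in>V - H. vol a m (insert u H) * p F u) = 0"
proof -
  obtain c where c: "\<And>u. (\<Sum>l<m. c l * a u l) = (if u \<in> H then 0 else vol a m (insert u H))"
    using vol_cofactors[OF two assms(1,2), of a] by blast
  have "(\<Sum>u\<in>V - H. vol a m (insert u H) * p F u) = (\<Sum>u\<in>V. (\<Sum>l<m. c l * a u l) * p F u)"
    using finite_V by (intro sum.mono_neutral_cong_left) (auto simp: c)
  also have "\<dots> = (\<Sum>l<m. c l * lin l (p F))"
    unfolding lin_def sum_distrib_left sum_distrib_right by (subst sum.swap) (simp only: mult.assoc)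
  also have "\<dots> = (\<Sum>l<m. c l * a star l) * vol a d F"
    using assms(3) by (simp add: linear_form_p[OF F] sum_distrib_right mult.assoc)
  also have "\<dots> = 0"
    using star by (simp add: c)
  finally show ?thesis .
qed

text \<open>A repeated vertex is traded for vertices outside the support by a linear relation, until the
  support is a ridge, where the two adjacent facets cancel.\<close>

lemma residue_sum_0:
  assumes "size M + 1 = d" "set_mset M \<subseteq> V"
  shows "residue_sum M = 0"
  using assms
proof (induction "d - card (set_mset M)" arbitrary: M rule: less_induct)
  case less
  define G where "G = set_mset M"
  have G: "finite G" "star \<notin> G" "G \<subseteq> V"
    using less.prems facet(3) by (auto simp: G_def)
  show ?case
  proof (cases "M = mset_set G")
    case True
    then have cG: "card G + 1 = d"
    proof -
      have "size M = card G"
        by (subst True) (rule size_mset_set)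
      then show ?thesis
        using less.prems(1) by simp
    qed
    \<comment> \<open>The monomial cancels all factors of the denominator but one, and that one is
      the minor of \<open>insert star G\<close>, the same for every facet around the ridge.\<close>
    have "residue_sum M = (\<Sum>F\<in>{F \<in> \<Delta>. G \<subseteq> F}. 1 / vol a d (insert star G))"
      unfolding residue_sum_def
    proof (rule sum.mono_neutral_cong_right[OF finite_facets])
      show "\<forall>F\<in>\<Delta> - {F \<in> \<Delta>. G \<subseteq> F}. mon M (p F) / (\<Prod>v\<in>F. p F v) = 0"
        by (auto simp: mon_p_eq_0_iff G_def)
      fix F assume "F \<in> {F \<in> \<Delta>. G \<subseteq> F}"
      then have F: "F \<in> \<Delta>" "G \<subseteq> F" by auto
      have "card (F - G) = 1"
        using cG F facet[OF F(1)] G(1) by (simp add: card_Diff_subset)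
      then obtain w where w: "F - G = {w}"
        by (rule card_1_singletonE)
      then have Fw: "F = insert w G" "w \<notin> G" "F - {w} = G"
        using F by auto
      have "(\<Prod>v\<in>F. p F v) = p F w * mon M (p F)"
        unfolding Fw(1) True using Fw(2) G(1) by (simp add: mon_mset_set)
      moreover have "p F w = vol a d (insert star G)"
        using Fw by (simp add: p_def)
      moreover have "mon M (p F) \<noteq> 0"
        using F by (simp add: mon_p_eq_0_iff G_def[symmetric])
      ultimately show "mon M (p F) / (\<Prod>v\<in>F. p F v) = 1 / vol a d (insert star G)"
        by simp
    qed auto
    also have "\<dots> = of_nat (card {F \<in> \<Delta>. G \<subseteq> F}) / vol a d (insert star G)"
      by simp
    also have "\<dots> = 0"
    proof (cases "{F \<in> \<Delta>. G \<subseteq> F} = {}")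
      case False
      then obtain F where "F \<in> \<Delta>" "G \<subseteq> F" by blast
      then show ?thesis
        using char2_of_nat_even[OF two ridge[OF _ _ cG]] by simp
    qed (simp only: card.empty of_nat_0 div_0)
    finally show ?thesis .
  next
    case False
    have "\<exists>v. count M v \<ge> 2"
    proof (rule ccontr)
      assume none: "\<not> (\<exists>v. count M v \<ge> 2)"
      have "M = mset_set G"
      proof (rule multiset_eqI)
        fix v
        have "count M v \<le> 1"
        proof -
          have "\<not> count M v \<ge> 2"
            using none by blast
          then show ?thesis by simp
        qed
        moreover have "v \<in> G \<Longrightarrow> 1 \<le> count M v" "v \<notin> G \<Longrightarrow> count M v = 0"
          by (simp_all add: G_def not_in_iff)
        ultimately show "count M v = count (mset_set G) v"
          using G(1) by (cases "v \<in> G") (simp_all add: le_antisym)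
      qed
      with False show False ..
    qed
    then obtain v where v: "count M v \<ge> 2" by blast
    define M' where "M' = M - {#v#}"
    have "v \<in># M"
      using v by (auto intro: count_inI)
    then have M: "M = add_mset v M'"
      by (simp add: M'_def)
    then have "count M' v \<ge> 1"
      using v by simp
    then have "v \<in># M'"
      by (auto intro: count_inI)
    then have setM': "set_mset M' = G" "v \<in> G"
      using M by (auto simp: G_def)
    \<comment> \<open>Putting \<open>star\<close> in place of \<open>v\<close> gives a relation
      among \<open>v\<close> and the vertices outside the support. All its terms other than that of
      \<open>v\<close> lead to a larger support.\<close>
    define H where "H = insert star (G - {v})"
    have cardH: "card H = card G"
      unfolding H_def using G setM'(2) card_Suc_Diff1[of G v] by simp
    have "card G < size M"
    proof -
      have "card (set_mset M') \<le> size M'"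
        by (rule card_set_mset_le_size)
      then show ?thesis
        using M setM' by simp
    qed
    then have H: "finite H" "card H + 1 = card G + 1" "card G + 1 \<le> d" "star \<in> H"
      using G cardH less.prems by (auto simp: H_def)
    have vH: "v \<in> V - H"
      using G setM'(2) by (auto simp: H_def)
    have "(\<Sum>u\<in>V - H. vol a (card G + 1) (insert u H) * residue_sum (add_mset u M'))
       = (\<Sum>F\<in>\<Delta>. (\<Sum>u\<in>V - H. vol a (card G + 1) (insert u H) * p F u) * (mon M' (p F) / (\<Prod>v\<in>F. p F v)))"
      unfolding residue_sum_def sum_distrib_left sum_distrib_right by (subst sum.swap) (simp add: mult_ac)
    also have "\<dots> = 0"
      using linear_relation[OF H(1,2,3) _ H(4)] by simp
    finally have "(\<Sum>u\<in>V - H. vol a (card G + 1) (insert u H) * residue_sum (add_mset u M')) = 0" .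
    moreover have "(\<Sum>u\<in>V - H. vol a (card G + 1) (insert u H) * residue_sum (add_mset u M'))
       = vol a (card G + 1) (insert v H) * residue_sum M
        + (\<Sum>u\<in>V - H - {v}. vol a (card G + 1) (insert u H) * residue_sum (add_mset u M'))"
      using finite_V vH by (subst sum.remove[of _ v]) (auto simp: M)
    moreover have "residue_sum (add_mset u M') = 0" if "u \<in> V - H - {v}" for u
    proof (rule less.hyps)
      have u: "u \<notin> G" "u \<in> V"
        using that by (auto simp: H_def)
      have "card (set_mset (add_mset u M')) = card G + 1"
        using u setM' G by simp
      then show "d - card (set_mset (add_mset u M')) < d - card (set_mset M)"
        using H(3) by (simp add: G_def[symmetric])
      show "size (add_mset u M') + 1 = d" "set_mset (add_mset u M') \<subseteq> V"
        using less.prems u M setM' G by auto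
    qed
    moreover have "vol a (card G + 1) (insert v H) \<noteq> 0"
    proof (rule vol_d_nonzero)
      have "insert v H = insert star G"
        using setM'(2) by (auto simp: H_def)
      then show "insert v H \<subseteq> insert star V" "finite (insert v H)" "card (insert v H) = card G + 1"
        using G by auto
    qed (rule H(3))
    ultimately show ?thesis
      by simp
  qed
qed

text \<open>In degree d the functional \<open>deg\<close> thereby factors through the quotient by
  the linear system of parameters.\<close>

lemma deg_lin_mult_0:
  assumes "homogeneous V n f" "n + 1 = d" "l < d"
  shows "deg (\<lambda>x. lin l x * f x) = 0"
  using assms
proof induction
  case (monomial M n)
  have "deg (\<lambda>x. lin l x * mon M x) = (\<Sum>F\<in>\<Delta>. a star l * (mon M (p F) / (\<Prod>v\<in>F. p F v)))"
    unfolding deg_def \<mu>_def using monomial.prems vol_facet_nonzero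
    by (intro sum.cong refl) (simp add: linear_form_p)
  also have "\<dots> = a star l * residue_sum M"
    by (simp add: residue_sum_def sum_distrib_left)
  finally show ?case
    using residue_sum_0[of M] monomial by simp
next
  case (scale n f c)
  then show ?case
    using deg_scale[of c "\<lambda>x. lin l x * f x"] by (simp add: mult.left_commute)
qed (simp_all add: deg_0 deg_add distrib_left)

end

section \<open>Anisotropy\<close>

lemma derivation_inverse:
  assumes "derivation D"
  shows "D (inverse x :: 'k::field) = - (D x) * (inverse x * inverse x)"
proof (cases "x = 0")
  case False
  have "D x * inverse x + x * D (inverse x) = 0"
    using derivation_mult[OF assms, of x "inverse x"] False assms by simp
  then have "x * D (inverse x) = - (D x * inverse x)"
    by (simp add: eq_neg_iff_add_eq_0 add.commute)
  then have "inverse x * (x * D (inverse x)) = inverse x * - (D x * inverse x)"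
    by simp
  moreover have "inverse x * (x * D (inverse x)) = D (inverse x)"
    using False by simp
  ultimately show ?thesis
    by (simp add: mult_ac)
qed (simp add: assms)

text \<open>Differentiation by an entry of a row outside \<open>C\<close> vanishes on this field,
  which discards the facets that miss a differentiated vertex.\<close>

inductive_set entry_field :: "('v \<Rightarrow> nat \<Rightarrow> 'k::field) \<Rightarrow> 'v set \<Rightarrow> nat \<Rightarrow> 'k set" for a C d where
  entry: "v \<in> C \<Longrightarrow> l < d \<Longrightarrow> a v l \<in> entry_field a C d"
| zero: "0 \<in> entry_field a C d"
| one: "1 \<in> entry_field a C d"
| add: "x \<in> entry_field a C d \<Longrightarrow> y \<in> entry_field a C d \<Longrightarrow> x + y \<in> entry_field a C d"
| uminus: "x \<in> entry_field a C d \<Longrightarrow> - x \<in> entry_field a C d"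
| mult: "x \<in> entry_field a C d \<Longrightarrow> y \<in> entry_field a C d \<Longrightarrow> x * y \<in> entry_field a C d"
| inverse: "x \<in> entry_field a C d \<Longrightarrow> inverse x \<in> entry_field a C d"

lemma entry_field_sum: "(\<And>i. i \<in> A \<Longrightarrow> f i \<in> entry_field a C d) \<Longrightarrow> sum f A \<in> entry_field a C d"
  by (induction A rule: infinite_finite_induct) (auto intro: entry_field.intros)

lemma entry_field_prod: "(\<And>i. i \<in> A \<Longrightarrow> f i \<in> entry_field a C d) \<Longrightarrow> prod f A \<in> entry_field a C d"
  by (induction A rule: infinite_finite_induct) (auto intro: entry_field.intros)

lemma entry_field_vol: "S \<subseteq> C \<Longrightarrow> k \<le> d \<Longrightarrow> vol a k S \<in> entry_field a C d"
proof (induction k arbitrary: S)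
  case (Suc k)
  show ?case
    unfolding vol.simps
  proof (intro entry_field_sum entry_field.mult)
    fix i assume i: "i \<in> S"
    show "a i k \<in> entry_field a C d"
      using Suc.prems i by (intro entry_field.entry) auto
    show "vol a k (S - {i}) \<in> entry_field a C d"
      using Suc.prems by (intro Suc.IH) auto
  qed
qed (simp add: entry_field.one)

lemma entry_field_mon: "(\<And>v. v \<in># M \<Longrightarrow> x v \<in> entry_field a C d) \<Longrightarrow> mon M x \<in> entry_field a C d"
  by (induction M) (auto intro: entry_field.intros)

lemma derivation_entry_field_0:
  assumes "x \<in> entry_field a C d" "derivation D" "\<And>v l. v \<in> C \<Longrightarrow> l < d \<Longrightarrow> D (a v l) = 0"
  shows "D x = 0"
  using assms(1)
proof induction
  case (uminus x)
  have "D x + D (- x) = D (x + - x)"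
    by (rule derivation_add[OF assms(2), symmetric])
  then show ?case
    using uminus assms(2) by simp
qed (simp_all add: assms derivation_add[OF assms(2)] derivation_mult[OF assms(2)] derivation_inverse[OF assms(2)])

lemma derivation_entry_field:
  assumes "x \<in> entry_field a C d" "derivation D" "\<And>v l. v \<in> C \<Longrightarrow> l < d \<Longrightarrow> D (a v l) \<in> entry_field a C d"
  shows "D x \<in> entry_field a C d"
  using assms(1)
proof induction
  case (uminus x)
  have "D x + D (- x) = D (x + - x)"
    by (rule derivation_add[OF assms(2), symmetric])
  then have "D (- x) = - D x"
    using assms(2) by (simp add: eq_neg_iff_add_eq_0 add.commute)
  then show ?case
    using uminus by (simp add: entry_field.uminus)
qed (auto simp: assms derivation_add[OF assms(2)] derivation_mult[OF assms(2)] derivation_inverse[OF assms(2)]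
    intro!: entry_field.intros)

lemma prod_power_occ:
  assumes "finite C" "\<And>k. k < m \<Longrightarrow> I k \<in> C"
  shows "(\<Prod>i\<in>C. X i ^ occ I m i) = (\<Prod>k<m. X (I k) :: 'k::comm_ring_1)"
  using assms(2)
proof (induction m)
  case (Suc m)
  have "(\<Prod>i\<in>C. X i ^ occ I (Suc m) i) = (\<Prod>i\<in>C. X i ^ occ I m i) * (\<Prod>i\<in>C. if i = I m then X i else 1)"
    unfolding prod.distrib[symmetric] by (intro prod.cong) (auto simp: occ_Suc)
  also have "(\<Prod>i\<in>C. if i = I m then X i else 1) = X (I m)"
    using assms(1) Suc.prems[of m] by simp
  finally show ?case
    using Suc by simp
qed simp

text \<open>Derivatives of the generators are 0 or 1, so the field is preserved. Once a row outside
  \<open>C\<close> has been differentiated the value is 0 and remains so.\<close>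

lemma iter_deriv_entry_field:
  assumes D: "dual_derivations D a W d" and "C \<subseteq> W" and I: "\<And>k. k < d \<Longrightarrow> I k \<in> W"
    and x: "x \<in> entry_field a C d" and "m \<le> d"
  shows "iter_deriv D I m x \<in> entry_field a C d"
    and "(\<exists>k<m. I k \<notin> C) \<Longrightarrow> iter_deriv D I m x = 0"
proof -
  have "iter_deriv D I m x \<in> entry_field a C d \<and> ((\<exists>k<m. I k \<notin> C) \<longrightarrow> iter_deriv D I m x = 0)"
    using \<open>m \<le> d\<close>
  proof (induction m)
    case (Suc m)
    then have IH: "iter_deriv D I m x \<in> entry_field a C d" "(\<exists>k<m. I k \<notin> C) \<Longrightarrow> iter_deriv D I m x = 0"
      by auto
    have m: "m < d" "I m \<in> W"
      using Suc.prems I by auto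
    note dd = dual_derivationsD[OF D m(2,1)]
    have "D (I m) m (a v l) \<in> entry_field a C d" if "v \<in> C" "l < d" for v l
    proof -
      have "D (I m) m (a v l) = (if I m = v \<and> m = l then 1 else 0)"
        using dd(2)[of v l] that assms(2) by blast
      then show ?thesis
        by (simp add: entry_field.zero entry_field.one)
    qed
    then have "D (I m) m (iter_deriv D I m x) \<in> entry_field a C d"
      by (rule derivation_entry_field[OF IH(1) dd(1)])
    moreover have "D (I m) m (iter_deriv D I m x) = 0" if "I m \<notin> C"
    proof (rule derivation_entry_field_0[OF IH(1) dd(1)])
      fix v l assume "v \<in> C" "l < d"
      then show "D (I m) m (a v l) = 0"
        using dd(2)[of v l] that assms(2) by auto
    qed
    moreover have "D (I m) m (iter_deriv D I m x) = 0" if "\<exists>k<m. I k \<notin> C"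
      using IH(2)[OF that] dd(1) by simp
    ultimately show ?case
      unfolding iter_deriv.simps less_Suc_eq by blast
  qed (simp add: x)
  then show "iter_deriv D I m x \<in> entry_field a C d" "(\<exists>k<m. I k \<notin> C) \<Longrightarrow> iter_deriv D I m x = 0"
    by auto
qed

context lefschetz_setup
begin

lemma dual_d: "dual_derivations D a (insert star V) d"
  by (rule dual_derivations_mono[OF dual]) auto

lemma p_entry_field: "F \<in> \<Delta> \<Longrightarrow> v \<in> F \<Longrightarrow> p F v \<in> entry_field a (insert star F) d"
  unfolding p_def by (auto intro!: entry_field_vol)

lemma \<mu>_entry_field: "F \<in> \<Delta> \<Longrightarrow> \<mu> F \<in> entry_field a (insert star F) d"
  unfolding \<mu>_def divide_inverse
  by (intro entry_field.intros entry_field_vol entry_field_prod p_entry_field) auto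

text \<open>If the supports of \<open>A\<close>, \<open>L\<close> and \<open>M\<close> lie in
  \<open>F\<close>, the term is the square of \<open>M / L\<close> times the weight of the rows
  \<open>insert star F\<close>, and that weight is mapped to its square. Otherwise both sides
  vanish: a monomial is zero at \<open>p F\<close>, or a vertex outside \<open>F\<close> is
  differentiated.\<close>

lemma iter_deriv_term:
  assumes F: "F \<in> \<Delta>" and I: "\<And>k. k < d \<Longrightarrow> I k \<in> V"
    and AL: "image_mset I (mset_set {..<d}) = A + L + L"
  shows "iter_deriv D I d (\<mu> F * (mon A (p F) * (mon M (p F))\<^sup>2)) = (\<mu> F * mon (A + L + M) (p F))\<^sup>2"
proof -
  let ?C = "insert star F"
  note f = facet[OF F]
  have CW: "?C \<subseteq> insert star V"
    using F by auto
  have Iset: "I ` {..<d} = set_mset A \<union> set_mset L"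
    using arg_cong[OF AL, of set_mset] by simp
  have der: "derivation (D (I k) k)" if "k < d" for k
    using dual_derivationsD(1)[OF dual_d, of "I k" k] I[OF that] that by auto
  have zero: "iter_deriv D I d 0 = 0"
    by (rule iter_deriv_0) (rule der)
  show ?thesis
  proof (cases "set_mset A \<union> set_mset M \<subseteq> F")
    case False
    then have z1: "mon A (p F) * (mon M (p F))\<^sup>2 = 0"
      using mon_p_eq_0_iff[OF F] by auto
    have z2: "mon (A + L + M) (p F) = 0"
      unfolding mon_p_eq_0_iff[OF F] using False by auto
    show ?thesis
      unfolding z1 z2 using zero by simp
  next
    case AM: True
    show ?thesis
    proof (cases "set_mset L \<subseteq> F")
      case False
      have "\<mu> F * (mon A (p F) * (mon M (p F))\<^sup>2) \<in> entry_field a ?C d"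
        unfolding power2_eq_square using AM
        by (intro entry_field.mult \<mu>_entry_field[OF F] entry_field_mon p_entry_field[OF F]) auto
      moreover have "\<exists>k<d. I k \<notin> ?C"
      proof -
        obtain u where u: "u \<in># L" "u \<notin> F"
          using False by blast
        then obtain k where "k < d" "I k = u"
          using Iset by (metis UnI2 imageE lessThan_iff)
        moreover have "u \<noteq> star"
          using I facet(3) \<open>I k = u\<close> \<open>k < d\<close> by blast
        ultimately show ?thesis
          using u by blast
      qed
      ultimately have "iter_deriv D I d (\<mu> F * (mon A (p F) * (mon M (p F))\<^sup>2)) = 0"
        using I by (intro iter_deriv_entry_field(2)[OF dual_d CW]) auto
      moreover have "mon (A + L + M) (p F) = 0"
        unfolding mon_p_eq_0_iff[OF F] using False by auto
      ultimately show ?thesis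
        by (simp only: mult_zero_right power2_eq_square)
    next
      case L: True
      have IF: "I k \<in> F" if "k < d" for k
        using Iset L AM that by blast
      have X: "vol a d (?C - {v}) = p F v" if "v \<in> F" for v
      proof -
        have "?C - {v} = insert star (F - {v})"
          using that f by auto
        with that show ?thesis by (simp add: p_def)
      qed
      have weight: "occ_weight a I d d ?C = \<mu> F * mon (A + L + L) (p F)"
      proof -
        \<comment> \<open>The row \<open>star\<close> is never differentiated; its exponent -1
          supplies the factor \<open>1 / vol a d F\<close> of \<mu>.\<close>
        have star: "occ I d star = 0"
          using IF f(3) by (auto simp: occ_def)
        have "occ_weight a I d d ?C = 1 / vol a d F * (\<Prod>v\<in>F. vol a d (?C - {v}) ^ occ I d v / vol a d (?C - {v}))"
          using f star by (simp add: occ_weight_def)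
        also have "(\<Prod>v\<in>F. vol a d (?C - {v}) ^ occ I d v / vol a d (?C - {v}))
            = (\<Prod>v\<in>F. p F v ^ occ I d v / p F v)"
          by (intro prod.cong) (simp_all only: X)
        also have "\<dots> = (\<Prod>v\<in>F. p F v ^ occ I d v) / (\<Prod>v\<in>F. p F v)"
          by (rule prod_dividef)
        also have "(\<Prod>v\<in>F. p F v ^ occ I d v) = (\<Prod>k<d. p F (I k))"
          by (rule prod_power_occ[OF f(1) IF])
        also have "\<dots> = mon (image_mset I (mset_set {..<d})) (p F)"
          by (simp add: mon_def prod_unfold_prod_mset image_mset.compositionality comp_def)
        finally show ?thesis
          unfolding AL by (simp add: \<mu>_def)
      qed
      define u where "u = mon M (p F) / mon L (p F)"
      have L_nz: "mon L (p F) \<noteq> 0"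
        using L mon_p_eq_0_iff[OF F] by auto
      have main: "iter_deriv D I d (occ_weight a I d d ?C) = (occ_weight a I d d ?C)\<^sup>2"
      proof -
        have "card ?C = d + 1"
          using f by simp
        moreover have "dual_derivations D a ?C d"
          by (rule dual_derivations_mono[OF dual_d CW]) simp
        ultimately show ?thesis
          using iter_deriv_occ_weight[OF two, of ?C d D a I "{}"] f(1) IF by simp
      qed
      have "\<mu> F * (mon A (p F) * (mon M (p F))\<^sup>2) = u\<^sup>2 * occ_weight a I d d ?C"
        unfolding weight u_def using L_nz by (simp add: power2_eq_square)
      moreover have "iter_deriv D I d (u\<^sup>2 * x) = u\<^sup>2 * iter_deriv D I d x" for x
        by (rule iter_deriv_const) (simp_all add: der derivation_square_0[OF two])
      ultimately have "iter_deriv D I d (\<mu> F * (mon A (p F) * (mon M (p F))\<^sup>2)) = (u * occ_weight a I d d ?C)\<^sup>2"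
        by (simp only: main power_mult_distrib)
      also have "u * occ_weight a I d d ?C = \<mu> F * mon (A + L + M) (p F)"
        unfolding weight u_def using L_nz by simp
      finally show ?thesis .
    qed
  qed
qed

text \<open>The form \<open>lin (d + j)\<close> is linear in column d + j, and its derivative by the
  entry of row \<open>vs j\<close> is the coordinate of that vertex. The point \<open>p F\<close>
  involves only columns below d and behaves as a constant.\<close>

lemma iter_deriv_lin:
  assumes "F \<in> \<Delta>" "q \<le> d" "\<And>j. j < q \<Longrightarrow> vs j \<in> V"
    and "\<And>j. j < q \<Longrightarrow> D (vs j) (d + j) c = 0"
  shows "iter_deriv (\<lambda>v j. D v (d + j)) vs q (c * (\<Prod>j<q. lin (d + j) (p F))) = c * (\<Prod>j<q. p F (vs j))"
  using assms(2-)
proof (induction q arbitrary: c)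
  case (Suc q)
  have Fp: "p F v \<in> entry_field a (insert star V) d" for v
    by (cases "v \<in> F")
      (use assms(1) facet in \<open>auto simp: p_def intro!: entry_field_vol entry_field.zero\<close>)
  have dj: "derivation (D (vs j) (d + j))" "v \<in> V \<Longrightarrow> D (vs j) (d + j) (a v (d + i)) = (if v = vs j \<and> i = j then 1 else 0)"
    "D (vs j) (d + j) (p F v) = 0"
    if "j \<le> q" "i \<le> q" for i j v
  proof -
    have j: "vs j \<in> insert star V" "d + j < 2 * d"
      using Suc.prems that by auto
    note dd = dual_derivationsD[OF dual j]
    show d1: "derivation (D (vs j) (d + j))" by (rule dd(1))
    show "v \<in> V \<Longrightarrow> D (vs j) (d + j) (a v (d + i)) = (if v = vs j \<and> i = j then 1 else 0)"
      using dd(2)[of v "d + i"] Suc.prems(1) that by auto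
    show "D (vs j) (d + j) (p F v) = 0"
      by (rule derivation_entry_field_0[OF Fp d1]) (use dd(2) in auto)
  qed
  have Dlin: "D (vs j) (d + j) (lin (d + q) (p F)) = (if j = q then p F (vs q) else 0)" if "j \<le> q" for j
  proof -
    note d1 = dj(1)[OF that that]
    have "D (vs j) (d + j) (lin (d + q) (p F)) = (\<Sum>v\<in>V. if v = vs j then (if j = q then p F (vs q) else 0) else 0)"
      unfolding lin_def derivation_sum[OF d1] derivation_mult[OF d1]
      using dj(2,3)[OF that order_refl] by (intro sum.cong) auto
    then show ?thesis
      using finite_V Suc.prems(2)[of j] that by simp
  qed
  \<comment> \<open>The last form is moved into the constant, since the first q derivations do not
    see column d + q.\<close>
  have "iter_deriv (\<lambda>v j. D v (d + j)) vs q ((c * lin (d + q) (p F)) * (\<Prod>j<q. lin (d + j) (p F)))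
      = (c * lin (d + q) (p F)) * (\<Prod>j<q. p F (vs j))"
  proof (rule Suc.IH)
    fix j assume j: "j < q"
    then show "vs j \<in> V" using Suc.prems by simp
    have "D (vs j) (d + j) c = 0"
      using Suc.prems(3) j by simp
    then show "D (vs j) (d + j) (c * lin (d + q) (p F)) = 0"
      unfolding derivation_mult[OF dj(1)[OF less_imp_le[OF j] order_refl]] using Dlin[of j] j by simp
  qed (use Suc.prems in simp)
  then have "iter_deriv (\<lambda>v j. D v (d + j)) vs (Suc q) (c * (\<Prod>j<Suc q. lin (d + j) (p F)))
      = D (vs q) (d + q) ((c * (\<Prod>j<q. p F (vs j))) * lin (d + q) (p F))"
    by (simp add: mult_ac)
  also have "\<dots> = (c * (\<Prod>j<q. p F (vs j))) * D (vs q) (d + q) (lin (d + q) (p F))"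
  proof (rule derivation_mult_const)
    show d1: "derivation (D (vs q) (d + q))"
      by (rule dj(1)[OF order_refl order_refl])
    have "D (vs q) (d + q) (\<Prod>j<m. p F (vs j)) = 0" for m
      by (induction m) (simp_all add: d1 derivation_mult[OF d1] dj(3)[OF order_refl order_refl])
    then show "D (vs q) (d + q) (c * (\<Prod>j<q. p F (vs j))) = 0"
      using Suc.prems(3)[of q] by (simp add: derivation_mult[OF d1])
  qed
  also have "\<dots> = c * (\<Prod>j<Suc q. p F (vs j))"
    using Dlin[of q] by (simp add: mult_ac)
  finally show ?case .
qed simp

text \<open>Squares are constants for every derivation, so differentiating the coefficients of the \<open>q\<close> Lefschetz
  elements and then along \<open>I = A + 2 L\<close>, where \<open>N = A + L\<close>, turns the hypothesis into the square of
  the conclusion.\<close>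

theorem anisotropy:
  fixes c :: "'t \<Rightarrow> 'k" and M :: "'t \<Rightarrow> 'v multiset"
  assumes q: "q + 2 * m = d"
    and zero: "deg (\<lambda>x. (\<Prod>j<q. lin (d + j) x) * (\<Sum>t\<in>T. c t * mon (M t) x)\<^sup>2) = 0"
    and N: "set_mset N \<subseteq> V" "size N = q + m"
  shows "deg (\<lambda>x. mon N x * (\<Sum>t\<in>T. c t * mon (M t) x)) = 0"
proof -
  define g where "g x = (\<Sum>t\<in>T. c t * mon (M t) x)" for x
  obtain xs where xs: "mset xs = N"
    using ex_mset by blast
  have len: "length xs = q + m"
    using xs N(2) by (metis size_mset)
  define vs where "vs j = xs ! j" for j
  \<comment> \<open>The q vertices of \<open>A\<close> differentiate the Lefschetz forms. Later
    \<open>I\<close> runs through \<open>A\<close>, \<open>L\<close> and once more \<open>L\<close>,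
    of total length q + 2 m = d, one vertex for each column.\<close>
  define A where "A = mset (take q xs)"
  define L where "L = mset (drop q xs)"
  have NAL: "N = A + L"
    unfolding A_def L_def xs[symmetric] by (metis append_take_drop_id mset_append)
  have setxs: "set xs \<subseteq> V"
    using N(1) xs by (metis set_mset_mset)
  have vs: "vs j \<in> V" if "j < q" for j
  proof -
    have "xs ! j \<in> set xs"
      by (rule nth_mem) (use len that in simp)
    then show ?thesis
      using setxs unfolding vs_def by blast
  qed
  have prodA: "(\<Prod>j<q. x (vs j)) = mon A x" for x :: "'v \<Rightarrow> 'k"
  proof -
    have "A = image_mset vs (mset_set {..<q})"
    proof -
      have "take q xs = map vs [0..<q]"
        using len by (intro nth_equalityI) (auto simp: vs_def)
      then show ?thesis
        by (simp add: A_def lessThan_atLeast0)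
    qed
    then show ?thesis
      by (simp add: mon_def prod_unfold_prod_mset image_mset.compositionality comp_def)
  qed
  have der: "derivation (D (vs j) (d + j))" if "j < q" for j
    using dual_derivationsD(1)[OF dual, of "vs j" "d + j"] vs[OF that] that q by auto
  have "iter_deriv (\<lambda>v j. D v (d + j)) vs q (deg (\<lambda>x. (\<Prod>j<q. lin (d + j) x) * (g x)\<^sup>2))
      = (\<Sum>F\<in>\<Delta>. iter_deriv (\<lambda>v j. D v (d + j)) vs q ((\<mu> F * (g (p F))\<^sup>2) * (\<Prod>j<q. lin (d + j) (p F))))"
  proof -
    have "deg (\<lambda>x. (\<Prod>j<q. lin (d + j) x) * (g x)\<^sup>2)
        = (\<Sum>F\<in>\<Delta>. (\<mu> F * (g (p F))\<^sup>2) * (\<Prod>j<q. lin (d + j) (p F)))"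
      unfolding deg_def by (intro sum.cong) (simp_all only: mult_ac)
    then show ?thesis
      by (simp only: iter_deriv_sum[where D = "\<lambda>v j. D v (d + j)" and I = vs and m = q, OF der])
  qed
  also have "\<dots> = (\<Sum>F\<in>\<Delta>. (\<mu> F * (g (p F))\<^sup>2) * (\<Prod>j<q. p F (vs j)))"
  proof (intro sum.cong refl iter_deriv_lin)
    fix F j assume F: "F \<in> \<Delta>" and j: "j < q"
    have "D (vs j) (d + j) (\<mu> F) = 0"
    proof (rule derivation_entry_field_0[OF \<mu>_entry_field[OF F] der[OF j]])
      fix v l assume "v \<in> insert star F" "l < d"
      then show "D (vs j) (d + j) (a v l) = 0"
        using dual_derivationsD(2)[OF dual, of "vs j" "d + j" v l] vs[OF j] j q F by auto
    qed
    then show "D (vs j) (d + j) (\<mu> F * (g (p F))\<^sup>2) = 0"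
      by (simp add: derivation_mult[OF der[OF j]] derivation_square_0[OF two der[OF j]])
  qed (use q vs in auto)
  also have "\<dots> = (\<Sum>F\<in>\<Delta>. \<Sum>t\<in>T. (c t)\<^sup>2 * (\<mu> F * (mon A (p F) * (mon (M t) (p F))\<^sup>2)))"
  proof (intro sum.cong refl)
    fix F
    have "(g (p F))\<^sup>2 = (\<Sum>t\<in>T. (c t)\<^sup>2 * (mon (M t) (p F))\<^sup>2)"
      unfolding g_def char2_sum_square[OF two] by (simp only: power_mult_distrib)
    then have "(\<mu> F * (g (p F))\<^sup>2) * (\<Prod>j<q. p F (vs j)) = \<mu> F * (\<Sum>t\<in>T. (c t)\<^sup>2 * (mon (M t) (p F))\<^sup>2) * mon A (p F)"
      by (simp only: prodA)
    also have "\<dots> = (\<Sum>t\<in>T. (c t)\<^sup>2 * (\<mu> F * (mon A (p F) * (mon (M t) (p F))\<^sup>2)))"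
      unfolding sum_distrib_left sum_distrib_right by (intro sum.cong) (simp_all only: mult_ac)
    finally show "(\<mu> F * (g (p F))\<^sup>2) * (\<Prod>j<q. p F (vs j)) = \<dots>" .
  qed
  finally have E1: "(\<Sum>F\<in>\<Delta>. \<Sum>t\<in>T. (c t)\<^sup>2 * (\<mu> F * (mon A (p F) * (mon (M t) (p F))\<^sup>2))) = 0"
    using zero iter_deriv_0[of q "\<lambda>v j. D v (d + j)" vs, OF der] by (simp only: g_def[symmetric])
  define ys where "ys = xs @ drop q xs"
  define I where "I k = ys ! k" for k
  have lenys: "length ys = d"
    using len q by (simp add: ys_def)
  have I: "I k \<in> V" if "k < d" for k
  proof -
    have "set ys \<subseteq> V"
      using setxs set_drop_subset[of q xs] unfolding ys_def set_append by blast
    moreover have "ys ! k \<in> set ys"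
      by (rule nth_mem) (use lenys that in simp)
    ultimately show ?thesis
      unfolding I_def by blast
  qed
  have AL: "image_mset I (mset_set {..<d}) = A + L + L"
  proof -
    have "ys = map I [0..<d]"
      using lenys by (intro nth_equalityI) (auto simp: I_def)
    then have "mset ys = image_mset I (mset_set {..<d})"
      by (simp add: lessThan_atLeast0)
    moreover have "mset ys = A + L + L"
      using xs NAL by (simp add: ys_def L_def)
    ultimately show ?thesis by simp
  qed
  have derI: "derivation (D (I k) k)" if "k < d" for k
    using dual_derivationsD(1)[OF dual_d, of "I k" k] I[OF that] that by auto
  have pull: "iter_deriv D I d (s\<^sup>2 * x) = s\<^sup>2 * iter_deriv D I d x" for s x
    by (rule iter_deriv_const) (simp_all add: derI derivation_square_0[OF two])
  have "0 = iter_deriv D I d (\<Sum>F\<in>\<Delta>. \<Sum>t\<in>T. (c t)\<^sup>2 * (\<mu> F * (mon A (p F) * (mon (M t) (p F))\<^sup>2)))"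
    unfolding E1 using iter_deriv_0[of d D I, OF derI] by simp
  also have "\<dots> = (\<Sum>F\<in>\<Delta>. \<Sum>t\<in>T. (c t * (\<mu> F * mon (A + L + M t) (p F)))\<^sup>2)"
  proof -
    have "iter_deriv D I d ((c t)\<^sup>2 * (\<mu> F * (mon A (p F) * (mon (M t) (p F))\<^sup>2)))
        = (c t * (\<mu> F * mon (A + L + M t) (p F)))\<^sup>2" if "F \<in> \<Delta>" for F t
    proof -
      have "iter_deriv D I d (\<mu> F * (mon A (p F) * (mon (M t) (p F))\<^sup>2)) = (\<mu> F * mon (A + L + M t) (p F))\<^sup>2"
        by (rule iter_deriv_term[OF that _ AL]) (rule I)
      then show ?thesis
        unfolding pull power_mult_distrib[of "c t"] by (rule arg_cong)
    qed
    then show ?thesis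
      unfolding iter_deriv_sum[where D = D and I = I and m = d, OF derI, simplified] by (intro sum.cong refl)
  qed
  \<comment> \<open>Additivity of squaring collects the terms into one square, and a vanishing
    square in a field has a vanishing root.\<close>
  also have "\<dots> = (\<Sum>F\<in>\<Delta>. \<Sum>t\<in>T. c t * (\<mu> F * mon (A + L + M t) (p F)))\<^sup>2"
    by (simp only: char2_sum_square[OF two])
  finally have "(\<Sum>F\<in>\<Delta>. \<Sum>t\<in>T. c t * (\<mu> F * mon (A + L + M t) (p F))) = 0"
    by simp
  moreover have "deg (\<lambda>x. mon N x * g x) = (\<Sum>F\<in>\<Delta>. \<Sum>t\<in>T. c t * (\<mu> F * mon (A + L + M t) (p F)))"
    unfolding deg_def g_def sum_distrib_left NAL by (intro sum.cong refl) (simp only: mon_union mult_ac)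
  ultimately show ?thesis
    by (simp only: g_def)
qed

end

section \<open>Shellings\<close>

text \<open>A shelling given by heights, among which ties may occur, with \<open>R F\<close> as the
  minimal new face of \<open>F\<close>. The condition \<open>R_upper\<close> is
  \<open>R_lower\<close> for the reversed shelling, whose restriction sets are the complements
  \<open>F - R F\<close>.\<close>

locale shelled_complex =
  fixes \<Delta> :: "'v set set" and d :: nat and R :: "'v set \<Rightarrow> 'v set" and h :: "'v set \<Rightarrow> real"
  assumes finite_\<Delta>: "finite \<Delta>"
    and finite_facet: "F \<in> \<Delta> \<Longrightarrow> finite F" and card_facet: "F \<in> \<Delta> \<Longrightarrow> card F = d"
    and even_ridge: "F \<in> \<Delta> \<Longrightarrow> G \<subseteq> F \<Longrightarrow> card G + 1 = d \<Longrightarrow> even (card {F \<in> \<Delta>. G \<subseteq> F})"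
    and R_subset: "F \<in> \<Delta> \<Longrightarrow> R F \<subseteq> F"
    and R_lower: "F \<in> \<Delta> \<Longrightarrow> F' \<in> \<Delta> \<Longrightarrow> R F \<subseteq> F' \<Longrightarrow> F' \<noteq> F \<Longrightarrow> h F < h F'"
    and R_upper: "F \<in> \<Delta> \<Longrightarrow> F' \<in> \<Delta> \<Longrightarrow> F - R F \<subseteq> F' \<Longrightarrow> F' \<noteq> F \<Longrightarrow> h F' < h F"
    and R_descend: "F \<in> \<Delta> \<Longrightarrow> G \<subseteq> F \<Longrightarrow> \<not> R F \<subseteq> G \<Longrightarrow> \<exists>F'\<in>\<Delta>. G \<subseteq> F' \<and> h F' < h F"
begin

text \<open>A facet of least height among those containing \<open>G\<close> has this property, by
  \<open>R_descend\<close>.\<close>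

lemma minimal_facet:
  assumes "F \<in> \<Delta>" "G \<subseteq> F"
  shows "\<exists>F\<in>\<Delta>. R F \<subseteq> G \<and> G \<subseteq> F"
proof -
  have fin: "finite (h ` {F \<in> \<Delta>. G \<subseteq> F})"
    using finite_\<Delta> by simp
  have "h ` {F \<in> \<Delta>. G \<subseteq> F} \<noteq> {}"
    using assms by auto
  from Min_in[OF fin this] obtain F' where F': "F' \<in> \<Delta>" "G \<subseteq> F'" "h F' = Min (h ` {F \<in> \<Delta>. G \<subseteq> F})"
    by auto
  have "R F' \<subseteq> G"
  proof (rule ccontr)
    assume "\<not> R F' \<subseteq> G"
    from R_descend[OF F'(1,2) this] obtain F'' where "F'' \<in> \<Delta>" "G \<subseteq> F''" "h F'' < h F'"
      by blast
    moreover from this have "Min (h ` {F \<in> \<Delta>. G \<subseteq> F}) \<le> h F''"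
      by (intro Min_le fin) auto
    ultimately show False
      using F'(3) by simp
  qed
  with F' show ?thesis
    by blast
qed

definition initial :: "real \<Rightarrow> 'v set set"
  where "initial c = {F \<in> \<Delta>. h F < c}"

end

locale shelled_lefschetz = shelled_complex \<Delta> d R h + lefschetz_setup \<Delta> star d a D
  for \<Delta> :: "'v set set" and d R h star and a :: "'v \<Rightarrow> nat \<Rightarrow> 'k::field" and D
begin

text \<open>The functionals on the face ring of \<open>initial c\<close> are determined by the restriction monomials: a linear
  relation rewrites any other monomial into ones whose first facet comes later in the shelling.\<close>

lemma functional_eq_0:
  fixes \<phi> :: "'v multiset \<Rightarrow> 'k"
  assumes off: "\<And>M. size M = s \<Longrightarrow> set_mset M \<subseteq> V \<Longrightarrow> (\<And>F. F \<in> initial c \<Longrightarrow> \<not> set_mset M \<subseteq> F) \<Longrightarrow> \<phi> M = 0"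
    and lin: "\<And>M l. size M + 1 = s \<Longrightarrow> set_mset M \<subseteq> V \<Longrightarrow> l < d \<Longrightarrow> (\<Sum>v\<in>V. a v l * \<phi> (add_mset v M)) = 0"
    and restr: "\<And>F. F \<in> initial c \<Longrightarrow> card (R F) = s \<Longrightarrow> \<phi> (mset_set (R F)) = 0"
    and M: "size M = s" "set_mset M \<subseteq> V"
  shows "\<phi> M = 0"
proof -
  have main: "\<phi> M = 0" if "F \<in> \<Delta>" "R F \<subseteq> set_mset M" "set_mset M \<subseteq> F" "size M = s" for F M
    using that
  \<comment> \<open>The measure is the number of facets strictly higher than the one assigned to the
    support of \<open>M\<close>.\<close>
  proof (induction "card {F' \<in> \<Delta>. h F < h F'}" arbitrary: F M rule: less_induct)
    case less
    note F = \<open>F \<in> \<Delta>\<close>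
    have MV: "set_mset M \<subseteq> V"
      using less.prems by blast
    show ?case
    proof (cases "F \<in> initial c")
      case False
      show ?thesis
      proof (rule off[OF less.prems(4) MV], rule notI)
        fix F' assume F': "F' \<in> initial c" "set_mset M \<subseteq> F'"
        then have "F' = F \<or> h F < h F'"
          using R_lower[OF F, of F'] less.prems(2) by (auto simp: initial_def)
        then show False
          using F' False F by (auto simp: initial_def)
      qed
    next
      case inB: True
      show ?thesis
      proof (cases "M = mset_set (R F)")
        case True
        then have "card (R F) = s"
          using less.prems(4) by (metis size_mset_set)
        with restr[OF inB] True show ?thesis
          by simp
      next
        case neq: False
        \<comment> \<open>Unless \<open>M\<close> is the restriction monomial itself, one factor can
          be removed while the support still contains \<open>R F\<close>.\<close>
        have "\<exists>v. v \<in># M \<and> R F \<subseteq> set_mset (M - {#v#})"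
        proof (rule ccontr)
          assume none: "\<not> (\<exists>v. v \<in># M \<and> R F \<subseteq> set_mset (M - {#v#}))"
          have R: "v \<in> R F" and one: "count M v = 1" if v: "v \<in># M" for v
          proof -
            have "\<not> R F \<subseteq> set_mset (M - {#v#})"
              using none v by blast
            then obtain w where w: "w \<in> R F" "w \<notin># M - {#v#}"
              by blast
            then have "w \<in># M"
              using less.prems(2) by blast
            then have "w = v"
              using w(2) by (cases "w = v") (auto simp: in_diff_count)
            with w show "v \<in> R F" by simp
            have "count (M - {#v#}) v = 0"
              using w(2) \<open>w = v\<close> by (simp add: not_in_iff)
            then have "count M v \<le> 1"
              by simp
            moreover have "1 \<le> count M v"
              using v by simp
            ultimately show "count M v = 1"
              by (rule le_antisym)
          qed
          have finR: "finite (R F)"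
            using R_subset[OF F] finite_facet[OF F] by (rule finite_subset)
          have "M = mset_set (R F)"
          proof (rule multiset_eqI)
            fix v
            show "count M v = count (mset_set (R F)) v"
            proof (cases "v \<in># M")
              case True
              then show ?thesis using R one finR by simp
            next
              case False
              then have "v \<notin> R F" using less.prems(2) by blast
              then show ?thesis using False by (simp add: not_in_iff)
            qed
          qed
          with neq show False ..
        qed
        then obtain v where v: "v \<in># M" "R F \<subseteq> set_mset (M - {#v#})"
          by blast
        define M' where "M' = M - {#v#}"
        have M: "M = add_mset v M'"
          using v by (simp add: M'_def)
        have vF: "v \<in> F"
          using v less.prems by blast
        have finH: "finite (F - {v})" "card (F - {v}) + 1 = d"
          using finite_facet[OF F] card_facet[OF F] vF card_Suc_Diff1[of F v] by auto
        \<comment> \<open>The combination of linear forms that vanishes on \<open>F - {v}\<close>: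
          it expresses \<open>M\<close> by monomials in which \<open>v\<close> is replaced by
          vertices outside \<open>F\<close>.\<close>
        obtain c where c: "\<And>u. (\<Sum>l<d. c l * a u l) = (if u \<in> F - {v} then 0 else vol a d (insert u (F - {v})))"
          using vol_cofactors[OF two finH, of a] by blast
        have "(\<Sum>u\<in>V. (\<Sum>l<d. c l * a u l) * \<phi> (add_mset u M'))
            = (\<Sum>l<d. c l * (\<Sum>u\<in>V. a u l * \<phi> (add_mset u M')))"
          unfolding sum_distrib_left sum_distrib_right by (subst sum.swap) (simp only: mult.assoc)
        also have "\<dots> = 0"
        proof -
          have "size M' + 1 = s" "set_mset M' \<subseteq> V"
            using M less.prems(4) MV by auto
          then show ?thesis
            using lin by simp
        qed
        finally have sum0: "(\<Sum>u\<in>V. (\<Sum>l<d. c l * a u l) * \<phi> (add_mset u M')) = 0" .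
        have "(\<Sum>l<d. c l * a u l) * \<phi> (add_mset u M') = 0" if u: "u \<in> V - {v}" for u
        proof (cases "u \<in> F")
          case True
          with u show ?thesis by (simp add: c)
        next
          case False
          have size: "size (add_mset u M') = s" and sub: "set_mset (add_mset u M') \<subseteq> V"
            using M less.prems(4) MV u by auto
          have "\<phi> (add_mset u M') = 0"
          proof (cases "\<exists>F\<in>\<Delta>. set_mset (add_mset u M') \<subseteq> F")
            case True
            then obtain F' where F': "F' \<in> \<Delta>" "R F' \<subseteq> set_mset (add_mset u M')" "set_mset (add_mset u M') \<subseteq> F'"
              using minimal_facet by blast
            have "R F \<subseteq> F'"
              using v(2) F'(3) unfolding M'_def[symmetric] by auto
            moreover have "F' \<noteq> F"
              using F'(3) False by auto
            ultimately have "h F < h F'"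
              by (rule R_lower[OF F F'(1)])
            then have "{G \<in> \<Delta>. h F' < h G} \<subset> {G \<in> \<Delta>. h F < h G}"
              using F'(1) by auto
            then have "card {G \<in> \<Delta>. h F' < h G} < card {G \<in> \<Delta>. h F < h G}"
              using finite_\<Delta> by (intro psubset_card_mono) auto
            from less.hyps[OF this F' size] show ?thesis .
          next
            case False
            show ?thesis
              by (rule off[OF size sub]) (use False in \<open>auto simp: initial_def\<close>)
          qed
          then show ?thesis by simp
        qed
        then have "(\<Sum>u\<in>V - {v}. (\<Sum>l<d. c l * a u l) * \<phi> (add_mset u M')) = 0"
          by (intro sum.neutral ballI)
        moreover have "v \<in> V"
          using vF F by blast
        ultimately have "(\<Sum>u\<in>V. (\<Sum>l<d. c l * a u l) * \<phi> (add_mset u M')) = (\<Sum>l<d. c l * a v l) * \<phi> M"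
          unfolding sum.remove[OF finite_V \<open>v \<in> V\<close>] by (simp only: M add_0_right)
        moreover have "insert v (F - {v}) = F"
          using vF by auto
        ultimately have "vol a d F * \<phi> M = 0"
          using sum0 by (simp add: c)
        then show ?thesis
          using vol_facet_nonzero[OF F] by simp
      qed
    qed
  qed
  show ?thesis
  proof (cases "\<exists>F\<in>\<Delta>. set_mset M \<subseteq> F")
    case True
    then obtain F where "F \<in> \<Delta>" "R F \<subseteq> set_mset M" "set_mset M \<subseteq> F"
      using minimal_facet by blast
    then show ?thesis
      using main M(1) by blast
  next
    case False
    show ?thesis
      by (rule off[OF M]) (use False in \<open>auto simp: initial_def\<close>)
  qed
qed

text \<open>If there were more sets of size r, a nonzero combination \<open>g\<close> of the
  monomials on \<open>t - R t\<close>, of degree d - r, would pair to zero with all restriction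
  monomials of size s, and hence with everything of degree s. Multiples of \<open>g\<close> by
  generic forms are among the latter, so anisotropy makes \<open>g\<close> pair to zero with all
  monomials of degree r. The pairing with the sets \<open>R t\<close> is triangular, a
  contradiction.\<close>

theorem card_restriction_le:
  assumes ab: "s \<le> r" "r \<le> d" "d \<le> s + r"
  shows "card {F \<in> initial c. card (R F) = r} \<le> card {F \<in> initial c. card (R F) = s}"
proof (rule ccontr)
  assume less: "\<not> ?thesis"
  define T where "T = {F \<in> initial c. card (R F) = r}"
  define S where "S = {F \<in> initial c. card (R F) = s}"
  have fin: "finite T" "finite S"
    using finite_\<Delta> by (auto simp: T_def S_def initial_def)
  have T\<Delta>: "t \<in> \<Delta>" "card (R t) = r" "h t < c" if "t \<in> T" for t
    using that by (auto simp: T_def initial_def)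
  define W where "W A x = (\<Prod>j\<in>A. lin (d + j) x)" for A x
  have hom_W: "homogeneous V (card A) (W A)" for A
    unfolding W_def lin_def by (rule homogeneous_prod_linear)
  \<comment> \<open>These are the restriction sets of the reversed shelling.\<close>
  define c1 where "c1 F = F - R F" for F
  define mt where "mt t = mset_set (c1 t)" for t
  \<comment> \<open>With \<open>e\<close> generic forms the degrees d - r and s add up to d; with
    \<open>q\<close> forms two copies of d - r do. The inequality \<open>e \<le> q\<close> amounts
    to d \<le> s + r.\<close>
  define e where "e = r - s"
  define q where "q = 2 * r - d"
  have eq: "e \<le> q" "e + s = r" "(q - e) + (d - r) = s" "(d - r) + e + s = d" "q + 2 * (d - r) = d" "q + (d - r) = r"
    using ab by (auto simp: e_def q_def)
  have R_fin: "finite (R t)" "R t \<subseteq> t" "finite (c1 t)" "c1 t \<subseteq> t" "card (c1 t) = d - r" if "t \<in> T" for t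
  proof -
    note t = finite_facet[OF T\<Delta>(1)[OF that]] R_subset[OF T\<Delta>(1)[OF that]]
    show "finite (R t)" "R t \<subseteq> t" "finite (c1 t)" "c1 t \<subseteq> t"
      using t finite_subset by (auto simp: c1_def)
    then show "card (c1 t) = d - r"
      unfolding c1_def using t T\<Delta>[OF that] by (simp add: card_Diff_subset card_facet)
  qed
  have "card S < card T"
    using less by (simp add: T_def S_def)
  from homogeneous_system_nontrivial[OF fin(2,1) this,
      of "\<lambda>s t. deg (\<lambda>x. mon (mt t) x * (W {..<e} x * mon (mset_set (R s)) x))"]
  obtain k where k: "\<exists>t\<in>T. k t \<noteq> 0"
    and k0: "\<And>s. s \<in> S \<Longrightarrow> (\<Sum>t\<in>T. k t * deg (\<lambda>x. mon (mt t) x * (W {..<e} x * mon (mset_set (R s)) x))) = 0"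
    by blast
  define g where "g x = (\<Sum>t\<in>T. k t * mon (mt t) x)" for x
  have hom_g: "homogeneous V (d - r) g"
    unfolding g_def
  proof (intro homogeneous_sum homogeneous.scale homogeneous.monomial)
    fix t assume t: "t \<in> T"
    note R_fin[OF t] T\<Delta>[OF t]
    then show "set_mset (mt t) \<subseteq> V" "size (mt t) = d - r"
      by (auto simp: mt_def)
  qed
  have deg_g: "deg (\<lambda>x. g x * f x) = (\<Sum>t\<in>T. k t * deg (\<lambda>x. mon (mt t) x * f x))" for f
    unfolding g_def sum_distrib_right deg_sum by (intro sum.cong refl) (simp only: mult.assoc deg_scale)
  define \<phi> where "\<phi> M = deg (\<lambda>x. g x * (W {..<e} x * mon M x))" for M
  \<comment> \<open>A facet containing \<open>t - R t\<close> is \<open>t\<close> or lower, so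
    \<open>g\<close> is supported on the initial segment and \<phi> ignores monomials off
    it.\<close>
  have g_off: "g (p F) = 0" if F: "F \<in> \<Delta>" "F \<notin> initial c" for F
    unfolding g_def
  proof (rule sum.neutral, rule ballI)
    fix t assume t: "t \<in> T"
    have "\<not> c1 t \<subseteq> F"
    proof
      assume "c1 t \<subseteq> F"
      then have "F = t \<or> h F < h t"
        using R_upper[OF T\<Delta>(1)[OF t] F(1)] by (auto simp: c1_def)
      then show False
        using T\<Delta>[OF t] F by (auto simp: initial_def)
    qed
    then have "mon (mt t) (p F) = 0"
      unfolding mon_p_eq_0_iff[OF F(1)] using R_fin(3)[OF t] by (simp add: mt_def)
    then show "k t * mon (mt t) (p F) = 0"
      by simp
  qed
  have \<phi>0: "\<phi> M = 0" if M: "size M = s" "set_mset M \<subseteq> V" for M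
  proof (rule functional_eq_0[where s = s and c = c and \<phi> = \<phi>])
    fix M :: "'v multiset"
    assume "size M = s" "set_mset M \<subseteq> V" and off: "\<And>F. F \<in> initial c \<Longrightarrow> \<not> set_mset M \<subseteq> F"
    have "g (p F) * (W {..<e} (p F) * mon M (p F)) = 0" if "F \<in> \<Delta>" for F
      using off[of F] g_off[OF that] mon_p_eq_0_iff[OF that, of M] by auto
    then show "\<phi> M = 0"
      unfolding \<phi>_def deg_def by (intro sum.neutral ballI) (simp only: mult_zero_right)
  next
    fix M :: "'v multiset" and l
    assume M: "size M + 1 = s" "set_mset M \<subseteq> V" and l: "l < d"
    have "homogeneous V (d - r + (card {..<e} + size M)) (\<lambda>x. g x * (W {..<e} x * mon M x))"
      using M by (intro homogeneous_mult hom_g hom_W homogeneous.monomial) auto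
    then have "deg (\<lambda>x. lin l x * (g x * (W {..<e} x * mon M x))) = 0"
      by (rule deg_lin_mult_0) (use eq M l in auto)
    moreover have "deg (\<lambda>x. lin l x * (g x * (W {..<e} x * mon M x))) = (\<Sum>v\<in>V. a v l * \<phi> (add_mset v M))"
      unfolding lin_def sum_distrib_right deg_sum \<phi>_def deg_scale[symmetric]
      by (intro sum.cong refl arg_cong[where f = deg] ext) (simp add: mult_ac)
    ultimately show "(\<Sum>v\<in>V. a v l * \<phi> (add_mset v M)) = 0"
      by simp
  next
    fix F assume "F \<in> initial c" "card (R F) = s"
    then have "F \<in> S"
      by (simp add: S_def)
    from k0[OF this] show "\<phi> (mset_set (R F)) = 0"
      unfolding \<phi>_def deg_g .
  qed (rule M)+
  have hom0: "deg (\<lambda>x. g x * (W {..<e} x * f x)) = 0" if "homogeneous V s f" for f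
  proof -
    have "homogeneous V n f \<Longrightarrow> n = s \<Longrightarrow> deg (\<lambda>x. g x * (W {..<e} x * f x)) = 0" for n f
    proof (induction rule: homogeneous.induct)
      case (monomial M n)
      then show ?case
        using \<phi>0 by (simp add: \<phi>_def)
    next
      case (scale n f b)
      then show ?case
        using deg_scale[of b "\<lambda>x. g x * (W {..<e} x * f x)"] by (simp add: mult.left_commute)
    qed (simp_all add: deg_0 deg_add distrib_left)
    with that show ?thesis
      by blast
  qed
  \<comment> \<open>The test polynomial is \<open>g\<close> times the remaining q - e forms, which
    has degree s.\<close>
  have "homogeneous V (card {e..<q} + (d - r)) (\<lambda>x. W {e..<q} x * g x)"
    by (intro homogeneous_mult hom_W hom_g)
  then have "homogeneous V s (\<lambda>x. W {e..<q} x * g x)"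
    using eq by simp
  from hom0[OF this] have "deg (\<lambda>x. g x * (W {..<e} x * (W {e..<q} x * g x))) = 0" .
  moreover have "g x * (W {..<e} x * (W {e..<q} x * g x)) = (\<Prod>j<q. lin (d + j) x) * (g x)\<^sup>2" for x
  proof -
    have "{..<q} = {..<e} \<union> {e..<q}" "{..<e} \<inter> {e..<q} = {}"
      using eq(1) by auto
    then have "(\<Prod>j<q. lin (d + j) x) = W {..<e} x * W {e..<q} x"
      unfolding W_def by (simp add: prod.union_disjoint)
    then show ?thesis
      by (simp add: power2_eq_square mult_ac)
  qed
  ultimately have zero: "deg (\<lambda>x. (\<Prod>j<q. lin (d + j) x) * (\<Sum>t\<in>T. k t * mon (mt t) x)\<^sup>2) = 0"
    by (simp add: g_def)
  \<comment> \<open>Choose \<open>t\<close> highest among the nonzero coefficients. A facet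
    \<open>F\<close> containing \<open>R t\<close> and \<open>t' - R t'\<close> is not below
    \<open>t\<close> and not above \<open>t'\<close>, while \<open>t'\<close> is not above
    \<open>t\<close>; this forces \<open>F = t = t'\<close>.\<close>
  have "Max (h ` {t \<in> T. k t \<noteq> 0}) \<in> h ` {t \<in> T. k t \<noteq> 0}"
    using k fin(1) by (intro Max_in) auto
  then obtain t where t: "t \<in> T" "k t \<noteq> 0" "Max (h ` {t \<in> T. k t \<noteq> 0}) = h t"
    by auto
  have max: "h t' \<le> h t" if "t' \<in> T" "k t' \<noteq> 0" for t'
    unfolding t(3)[symmetric] using that fin(1) by (intro Max_ge) auto
  note tt = T\<Delta>[OF t(1)] R_fin[OF t(1)]
  have "deg (\<lambda>x. mon (mset_set (R t)) x * (\<Sum>t\<in>T. k t * mon (mt t) x)) = 0"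
    by (rule anisotropy[OF eq(5) zero]) (use tt eq in auto)
  moreover have "deg (\<lambda>x. mon (mset_set (R t)) x * (\<Sum>t\<in>T. k t * mon (mt t) x)) = k t * (1 / vol a d t)"
  proof -
    have product: "mon (mset_set (R t)) (p F) * (k t' * mon (mt t') (p F)) = (if t' = t \<and> F = t then k t * (\<Prod>v\<in>t. p t v) else 0)"
      if t': "t' \<in> T" and F: "F \<in> \<Delta>" for t' F
    proof (cases "t' = t \<and> F = t")
      case True
      have "(\<Prod>v\<in>t. p t v) = (\<Prod>v\<in>R t. p t v) * (\<Prod>v\<in>c1 t. p t v)"
      proof -
        have "t = R t \<union> c1 t" "R t \<inter> c1 t = {}"
          using tt by (auto simp: c1_def)
        then show ?thesis
          using prod.union_disjoint[of "R t" "c1 t" "p t"] tt by simp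
      qed
      with True show ?thesis
        by (simp add: mt_def mon_mset_set mult_ac)
    next
      case False
      have "k t' = 0 \<or> \<not> R t \<subseteq> F \<or> \<not> c1 t' \<subseteq> F"
      proof (rule ccontr)
        assume "\<not> ?thesis"
        then have *: "k t' \<noteq> 0" "R t \<subseteq> F" "t' - R t' \<subseteq> F"
          by (auto simp: c1_def)
        have 1: "F = t \<or> h t < h F"
          using R_lower[OF tt(1) F *(2)] by blast
        have 2: "F = t' \<or> h F < h t'"
          using R_upper[OF T\<Delta>(1)[OF t'] F *(3)] by blast
        from 1 2 max[OF t' *(1)] False show False
          by auto
      qed
      then have "mon (mset_set (R t)) (p F) * (k t' * mon (mt t') (p F)) = 0"
        using mon_p_eq_0_iff[OF F] tt R_fin(3)[OF t'] by (auto simp: mt_def)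
      with False show ?thesis
        by (simp only: if_False)
    qed
    have "\<mu> F * (mon (mset_set (R t)) (p F) * (\<Sum>t'\<in>T. k t' * mon (mt t') (p F)))
        = (if F = t then k t * (\<mu> t * (\<Prod>v\<in>t. p t v)) else 0)" if F: "F \<in> \<Delta>" for F
    proof -
      have "(mon (mset_set (R t)) (p F) * (\<Sum>t'\<in>T. k t' * mon (mt t') (p F)))
         = (\<Sum>t'\<in>T. if t' = t then (if F = t then k t * (\<Prod>v\<in>t. p t v) else 0) else 0)"
        unfolding sum_distrib_left
        using product F
        by (intro sum.cong refl) auto
      also have "\<dots> = (if F = t then k t * (\<Prod>v\<in>t. p t v) else 0)"
        using t(1) fin(1) by simp
      finally show ?thesis
        by simp
    qed
    then have "deg (\<lambda>x. mon (mset_set (R t)) x * (\<Sum>t'\<in>T. k t' * mon (mt t') x))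
        = (\<Sum>F\<in>\<Delta>. if F = t then k t * (\<mu> t * (\<Prod>v\<in>t. p t v)) else 0)"
      unfolding deg_def by (intro sum.cong refl) blast
    also have "\<dots> = k t * (\<mu> t * (\<Prod>v\<in>t. p t v))"
      using tt finite_\<Delta> by simp
    also have "\<mu> t * (\<Prod>v\<in>t. p t v) = 1 / vol a d t"
      using p_nonzero[OF tt(1)] finite_facet[OF tt(1)] by (simp add: \<mu>_def)
    finally show ?thesis .
  qed
  ultimately show False
    using t(2) vol_facet_nonzero[OF tt(1)] by simp
qed

end

text \<open>The data of the Lefschetz argument are chosen here: a new vertex \<open>star\<close>,
  available because the vertex type is infinite, and a separate variable for every pair of a vertex
  and a column.\<close>

theorem (in shelled_complex) card_restriction_monotone:
  assumes "infinite (UNIV :: 'v set)" "s \<le> r" "r \<le> d" "d \<le> s + r"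
  shows "card {F \<in> initial c. card (R F) = r} \<le> card {F \<in> initial c. card (R F) = s}"
proof -
  have finV: "finite (\<Union>\<Delta>)"
    using finite_\<Delta> finite_facet by blast
  then obtain star where star: "star \<notin> \<Union>\<Delta>"
    using ex_new_if_finite[OF assms(1)] by blast
  obtain X :: "nat \<Rightarrow> gf2_polys fract" and D' where two: "(1 :: gf2_polys fract) + 1 = 0"
    and der: "\<And>i. derivation (D' i)" and X: "\<And>i j. D' i (X j) = (if i = j then 1 else 0)"
    using ex_char2_field_with_derivations by blast
  obtain e :: "'v \<Rightarrow> nat" where e: "inj_on e (insert star (\<Union>\<Delta>))"
    using finite_imp_inj_to_nat_seg[of "insert star (\<Union>\<Delta>)"] finV by auto
  define a where "a v l = X (prod_encode (e v, l))" for v l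
  define D where "D v l = D' (prod_encode (e v, l))" for v l
  interpret shelled_lefschetz \<Delta> d R h star a D
  proof
    show "dual_derivations D a (insert star (\<Union>\<Delta>)) (2 * d)"
      unfolding dual_derivations_def
    proof (intro ballI allI impI conjI)
      fix i k j l assume ij: "i \<in> insert star (\<Union>\<Delta>)" "j \<in> insert star (\<Union>\<Delta>)"
      have "D i k (a j l) = (if e i = e j \<and> k = l then 1 else 0)"
        unfolding D_def a_def X by (simp add: prod_encode_eq)
      then show "D i k (a j l) = (if i = j \<and> k = l then 1 else 0)"
        using inj_on_eq_iff[OF e ij] by simp
    qed (simp add: D_def der)
  qed (use two finite_\<Delta> finite_facet card_facet star even_ridge in auto)
  show ?thesis
    by (rule card_restriction_le[OF assms(2-)])
qed

section \<open>Chambers and h-transforms\<close>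

definition chamber :: "'a::euclidean_space set \<Rightarrow> 'a set \<Rightarrow> 'a set"
  where "chamber N T = {x. (\<forall>n\<in>T. 0 \<le> n \<bullet> x) \<and> (\<forall>n\<in>N - T. n \<bullet> x \<le> 0)}"

lemma polyhedral_cone_UNIV: "polyhedral_cone UNIV"
  by (auto simp: polyhedral_cone_def convex_cone_iff)

lemma polyhedral_cone_Int: "polyhedral_cone C \<Longrightarrow> polyhedral_cone C' \<Longrightarrow> polyhedral_cone (C \<inter> C')"
  by (auto simp: polyhedral_cone_def convex_cone_iff)

lemma polyhedral_cone_halfspace:
  "polyhedral_cone {x. n \<bullet> x \<le> 0}" "polyhedral_cone {x. 0 \<le> n \<bullet> x}"
  using polyhedron_halfspace_le[of n 0] polyhedron_halfspace_ge[of 0 n]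
  by (auto simp: polyhedral_cone_def convex_cone_iff inner_add_right mult_nonneg_nonpos)

lemma polyhedral_cone_INT:
  assumes "finite M" "\<And>n. n \<in> M \<Longrightarrow> polyhedral_cone (f n)"
  shows "polyhedral_cone (\<Inter>n\<in>M. f n)"
  using assms by (induction M) (auto intro: polyhedral_cone_UNIV polyhedral_cone_Int)

lemma polyhedral_cone_le0: "finite M \<Longrightarrow> polyhedral_cone {x. \<forall>n\<in>M. n \<bullet> x \<le> 0}"
  using polyhedral_cone_INT[of M "\<lambda>n. {x. n \<bullet> x \<le> 0}"]
  by (simp add: polyhedral_cone_halfspace INTER_eq)

lemma polyhedral_cone_ge0: "finite M \<Longrightarrow> polyhedral_cone {x. \<forall>n\<in>M. 0 \<le> n \<bullet> x}"
  using polyhedral_cone_INT[of M "\<lambda>n. {x. 0 \<le> n \<bullet> x}"]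
  by (simp add: polyhedral_cone_halfspace INTER_eq)

lemma polyhedral_cone_chamber:
  assumes "finite N" "T \<subseteq> N"
  shows "polyhedral_cone (chamber N T)"
proof -
  have "chamber N T = {x. \<forall>n\<in>T. 0 \<le> n \<bullet> x} \<inter> {x. \<forall>n\<in>N - T. n \<bullet> x \<le> 0}"
    by (auto simp: chamber_def)
  then show ?thesis
    using assms finite_subset by (auto intro!: polyhedral_cone_Int polyhedral_cone_ge0 polyhedral_cone_le0)
qed

context
  fixes \<alpha> :: "'a::euclidean_space set \<Rightarrow> real"
  assumes \<alpha>: "cone_angle \<alpha>"
begin

lemma cone_angle_in_hyperplane:
  assumes "polyhedral_cone C" "n \<noteq> 0" "C \<subseteq> {x. n \<bullet> x = 0}"
  shows "\<alpha> C = 0"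
proof -
  have "dim C \<le> dim {x. n \<bullet> x = 0}"
    by (rule dim_subset[OF assms(3)])
  also have "\<dots> = DIM('a) - 1"
    by (rule dim_hyperplane[OF assms(2)])
  also have "\<dots> < DIM('a)"
    by simp
  finally show ?thesis
    using \<alpha> assms(1) by (simp add: cone_angle_def simple_on_cones_def)
qed

lemma cone_angle_split:
  assumes C: "polyhedral_cone C" and n: "n \<noteq> 0"
  shows "\<alpha> C = \<alpha> (C \<inter> {x. n \<bullet> x \<le> 0}) + \<alpha> (C \<inter> {x. 0 \<le> n \<bullet> x})"
proof -
  define C1 where "C1 = C \<inter> {x. n \<bullet> x \<le> 0}"
  define C2 where "C2 = C \<inter> {x. 0 \<le> n \<bullet> x}"
  have cones: "polyhedral_cone C1" "polyhedral_cone C2"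
    unfolding C1_def C2_def by (intro polyhedral_cone_Int C polyhedral_cone_halfspace)+
  have "C1 \<union> C2 = C"
    by (auto simp: C1_def C2_def)
  then have "\<alpha> C = \<alpha> C1 + \<alpha> C2 - \<alpha> (C1 \<inter> C2)"
    using \<alpha> C cones unfolding cone_angle_def cone_valuation_def by metis
  moreover have "\<alpha> (C1 \<inter> C2) = 0"
    by (rule cone_angle_in_hyperplane[OF polyhedral_cone_Int[OF cones] n])
      (auto simp: C1_def C2_def)
  ultimately show ?thesis
    by (simp add: C1_def C2_def)
qed

lemma cone_angle_chambers:
  assumes "finite N" "0 \<notin> N" "polyhedral_cone C"
  shows "\<alpha> C = (\<Sum>T\<in>Pow N. \<alpha> (C \<inter> chamber N T))"
  using assms(1,2)
proof (induction N)
  case empty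
  then show ?case by (simp add: chamber_def)
next
  case (insert n N)
  have ch1: "chamber (insert n N) T = chamber N T \<inter> {x. n \<bullet> x \<le> 0}"
    and ch2: "chamber (insert n N) (insert n T) = chamber N T \<inter> {x. 0 \<le> n \<bullet> x}" if "T \<in> Pow N" for T
    using that insert.hyps by (auto simp: chamber_def)
  have "\<alpha> C = (\<Sum>T\<in>Pow N. \<alpha> (C \<inter> chamber N T))"
    using insert by simp
  also have "\<dots> = (\<Sum>T\<in>Pow N. \<alpha> (C \<inter> chamber (insert n N) T) + \<alpha> (C \<inter> chamber (insert n N) (insert n T)))"
  proof (rule sum.cong[OF refl])
    fix T assume T: "T \<in> Pow N"
    then have "polyhedral_cone (C \<inter> chamber N T)"
      using insert.hyps(1) assms(3) by (intro polyhedral_cone_Int polyhedral_cone_chamber) auto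
    moreover have "n \<noteq> 0"
      using insert.prems by auto
    ultimately show "\<alpha> (C \<inter> chamber N T)
        = \<alpha> (C \<inter> chamber (insert n N) T) + \<alpha> (C \<inter> chamber (insert n N) (insert n T))"
      unfolding ch1[OF T] ch2[OF T] using cone_angle_split by (simp add: Int_assoc)
  qed
  also have "\<dots> = (\<Sum>T\<in>Pow (insert n N). \<alpha> (C \<inter> chamber (insert n N) T))"
  proof -
    have "inj_on (insert n) (Pow N)"
      using insert.hyps(2) by (intro inj_onI) (metis PowD insert_ident subsetD)
    moreover have "Pow N \<inter> insert n ` Pow N = {}"
      using insert.hyps(2) by auto
    ultimately show ?thesis
      unfolding Pow_insert sum.distrib using insert.hyps(1)
      by (subst sum.union_disjoint) (simp_all add: sum.reindex)
  qed
  finally show ?case .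
qed

text \<open>A chamber either lies in the cone or meets it within a hyperplane orthogonal to some
  \<open>n\<close> in \<open>M\<close>.\<close>

lemma cone_angle_eq_chamber_sum:
  assumes N: "finite N" "0 \<notin> N" and M: "M \<subseteq> N"
  shows "\<alpha> {x. \<forall>n\<in>M. n \<bullet> x \<le> 0} = (\<Sum>T\<in>Pow N. if M \<inter> T = {} then \<alpha> (chamber N T) else 0)"
    and "\<alpha> {x. \<forall>n\<in>M. 0 \<le> n \<bullet> x} = (\<Sum>T\<in>Pow N. if M \<subseteq> T then \<alpha> (chamber N T) else 0)"
proof -
  have fin: "finite M"
    using N M finite_subset by blast
  have zero: "\<alpha> (C \<inter> chamber N T) = 0"
    if "T \<in> Pow N" "polyhedral_cone C" "n \<in> N" "C \<inter> chamber N T \<subseteq> {x. n \<bullet> x = 0}" for C T n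
  proof (rule cone_angle_in_hyperplane[OF _ _ that(4)])
    show "polyhedral_cone (C \<inter> chamber N T)"
      using that N by (intro polyhedral_cone_Int polyhedral_cone_chamber) auto
    show "n \<noteq> 0"
      using that N by auto
  qed
  let ?C = "{x. \<forall>n\<in>M. n \<bullet> x \<le> 0}" and ?C' = "{x. \<forall>n\<in>M. 0 \<le> n \<bullet> x}"
  have C: "polyhedral_cone ?C" "polyhedral_cone ?C'"
    using fin by (auto intro: polyhedral_cone_le0 polyhedral_cone_ge0)
  show "\<alpha> ?C = (\<Sum>T\<in>Pow N. if M \<inter> T = {} then \<alpha> (chamber N T) else 0)"
    unfolding cone_angle_chambers[OF N C(1)]
  proof (rule sum.cong[OF refl])
    fix T assume T: "T \<in> Pow N"
    show "\<alpha> (?C \<inter> chamber N T) = (if M \<inter> T = {} then \<alpha> (chamber N T) else 0)"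
    proof (cases "M \<inter> T = {}")
      case True
      then have "?C \<inter> chamber N T = chamber N T"
        using M by (auto simp: chamber_def)
      with True show ?thesis by simp
    next
      case False
      then obtain n where n: "n \<in> M" "n \<in> T" by blast
      have "?C \<inter> chamber N T \<subseteq> {x. n \<bullet> x = 0}"
        using n by (auto simp: chamber_def intro!: antisym)
      with zero[OF T C(1), of n] n M False show ?thesis by auto
    qed
  qed
  show "\<alpha> ?C' = (\<Sum>T\<in>Pow N. if M \<subseteq> T then \<alpha> (chamber N T) else 0)"
    unfolding cone_angle_chambers[OF N C(2)]
  proof (rule sum.cong[OF refl])
    fix T assume T: "T \<in> Pow N"
    show "\<alpha> (?C' \<inter> chamber N T) = (if M \<subseteq> T then \<alpha> (chamber N T) else 0)"
    proof (cases "M \<subseteq> T")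
      case True
      then have "?C' \<inter> chamber N T = chamber N T"
        by (auto simp: chamber_def)
      with True show ?thesis by simp
    next
      case False
      then obtain n where n: "n \<in> M" "n \<notin> T" by blast
      have "?C' \<inter> chamber N T \<subseteq> {x. n \<bullet> x = 0}"
        using n M by (auto simp: chamber_def intro!: antisym)
      with zero[OF T C(2), of n] n M False show ?thesis by auto
    qed
  qed
qed

lemma cone_angle_sum_chambers:
  assumes "finite N" "0 \<notin> N"
  shows "(\<Sum>T\<in>Pow N. \<alpha> (chamber N T)) = 1"
  using cone_angle_chambers[OF assms polyhedral_cone_UNIV] \<alpha> by (simp add: cone_angle_def)

text \<open>A chamber of nonzero angle lies in none of the hyperplanes. The sum of one point off
  each hyperplane is off all of them, because the signs within a chamber agree.\<close>

lemma generic_point_of_chamber: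
  assumes N: "finite N" "0 \<notin> N" and T: "T \<subseteq> N" and nz: "\<alpha> (chamber N T) \<noteq> 0"
  shows "\<exists>w. \<forall>n\<in>N. (if n \<in> T then 0 < n \<bullet> w else n \<bullet> w < 0)"
proof -
  have "\<exists>x\<in>chamber N T. n \<bullet> x \<noteq> 0" if "n \<in> N" for n
  proof (rule ccontr)
    assume "\<not> (\<exists>x\<in>chamber N T. n \<bullet> x \<noteq> 0)"
    then have "chamber N T \<subseteq> {x. n \<bullet> x = 0}" by auto
    moreover have "n \<noteq> 0" using that N by auto
    ultimately have "\<alpha> (chamber N T) = 0"
      using cone_angle_in_hyperplane polyhedral_cone_chamber[OF N(1) T] by blast
    with nz show False ..
  qed
  then obtain x where x: "\<And>n. n \<in> N \<Longrightarrow> x n \<in> chamber N T" "\<And>n. n \<in> N \<Longrightarrow> n \<bullet> x n \<noteq> 0"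
    by metis
  define w where "w = (\<Sum>n\<in>N. x n)"
  have pos: "0 < n \<bullet> w" if n: "n \<in> T" for n
    unfolding w_def inner_sum_right
  proof (rule sum_pos2[OF N(1)])
    show "n \<in> N" using n T by auto
    then show "0 < n \<bullet> x n"
      using x[of n] n by (auto simp: chamber_def less_le)
    show "0 \<le> n \<bullet> x i" if "i \<in> N" for i
      using x(1)[OF that] n by (auto simp: chamber_def)
  qed
  have neg: "n \<bullet> w < 0" if n: "n \<in> N - T" for n
  proof -
    have "0 < (\<Sum>i\<in>N. - (n \<bullet> x i))"
    proof (rule sum_pos2[OF N(1)])
      show "n \<in> N" using n by auto
      then show "0 < - (n \<bullet> x n)"
        using x[of n] n by (auto simp: chamber_def less_le)
      show "0 \<le> - (n \<bullet> x i)" if "i \<in> N" for i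
        using x(1)[OF that] n by (auto simp: chamber_def)
    qed
    then show ?thesis
      by (simp add: w_def inner_sum_right sum_negf)
  qed
  from pos neg show ?thesis
    by (intro exI[of _ w]) auto
qed

end

section \<open>The h-transform of binomial and linear combinations\<close>

lemma smult_sum_right: "smult c (\<Sum>i\<in>A. f i) = (\<Sum>i\<in>A. smult c (f i))"
  by (induction A rule: infinite_finite_induct) (simp_all add: smult_add_right)

text \<open>The binomial theorem for t = (t - 1) + 1 turns the polynomial into the sum of the terms
  \<open>c A\<close> times t to the power \<open>r A\<close>.\<close>

lemma h_transform_binomial:
  assumes "finite S" and r: "\<And>A. A \<in> S \<Longrightarrow> r A \<le> d"
    and a: "\<And>j. j \<le> d \<Longrightarrow> a (int j - 1) = (\<Sum>A\<in>S. c A * real (r A choose (d - j)))"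
    and k: "k \<le> d"
  shows "h_transform d a k = (\<Sum>A\<in>S. if r A = d - k then c A else 0)"
proof -
  let ?t = "[:-1, 1::real:]"
  have "(\<Sum>i=0..d. smult (a (int i - 1)) (?t ^ (d - i)))
      = (\<Sum>i=0..d. \<Sum>A\<in>S. smult (c A) (smult (real (r A choose (d - i))) (?t ^ (d - i))))"
    by (intro sum.cong refl) (simp add: a smult_sum)
  also have "\<dots> = (\<Sum>A\<in>S. smult (c A) (\<Sum>i=0..d. smult (real (r A choose (d - i))) (?t ^ (d - i))))"
    by (subst sum.swap) (simp add: smult_sum_right)
  also have "\<dots> = (\<Sum>A\<in>S. smult (c A) (monom 1 (r A)))"
  proof (intro sum.cong refl arg_cong2[where f = smult])
    fix A assume A: "A \<in> S"
    have "(\<Sum>i=0..d. smult (real (r A choose (d - i))) (?t ^ (d - i)))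
        = (\<Sum>m=0..d. smult (real (r A choose m)) (?t ^ m))"
      by (rule sum.reindex_bij_witness[of _ "\<lambda>m. d - m" "\<lambda>i. d - i"]) auto
    also have "\<dots> = (\<Sum>m\<le>r A. smult (real (r A choose m)) (?t ^ m))"
      using r[OF A] by (intro sum.mono_neutral_right) (auto simp: binomial_eq_0)
    also have "\<dots> = (\<Sum>m\<le>r A. of_nat (r A choose m) * ?t ^ m * 1 ^ (r A - m))"
      by (intro sum.cong refl) (simp add: of_nat_poly)
    also have "\<dots> = (?t + 1) ^ r A"
      by (rule binomial_ring[symmetric])
    also have "?t + 1 = [:0, 1:]"
      by (simp add: one_pCons)
    also have "[:0, 1:] ^ r A = (monom 1 (r A) :: real poly)"
      by (simp add: monom_altdef)
    finally show "(\<Sum>i=0..d. smult (real (r A choose (d - i))) (?t ^ (d - i))) = monom 1 (r A)" .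
  qed
  finally have "h_transform d a k = (\<Sum>A\<in>S. coeff (smult (c A) (monom 1 (r A))) (d - k))"
    by (simp add: h_transform_def coeff_sum)
  also have "\<dots> = (\<Sum>A\<in>S. if r A = d - k then c A else 0)"
    by (intro sum.cong) auto
  finally show ?thesis .
qed

lemma h_transform_linear:
  assumes "\<And>j. j \<le> d \<Longrightarrow> a (int j - 1) = (\<Sum>t\<in>T. c t * b t (int j - 1))"
  shows "h_transform d a k = (\<Sum>t\<in>T. c t * h_transform d (b t) k)"
proof -
  have "(\<Sum>i=0..d. smult (a (int i - 1)) ([:-1, 1:] ^ (d - i)))
      = (\<Sum>i=0..d. \<Sum>t\<in>T. smult (c t) (smult (b t (int i - 1)) ([:-1, 1:] ^ (d - i))))"
    by (intro sum.cong refl) (simp add: assms smult_sum)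
  also have "\<dots> = (\<Sum>t\<in>T. smult (c t) (\<Sum>i=0..d. smult (b t (int i - 1)) ([:-1, 1:] ^ (d - i))))"
    by (subst sum.swap) (simp add: smult_sum_right)
  finally show ?thesis
    by (simp add: h_transform_def coeff_sum)
qed

section \<open>Line shellings of simplicial polytopes\<close>

text \<open>The interior point \<open>z\<close> serves as origin, so that facet inequalities can be
  normalised to \<open>n \<bullet> (x - z) \<le> 1\<close>.\<close>

locale simplicial_geometry =
  fixes P :: "'a::euclidean_space set" and z :: 'a
  assumes simplicial: "simplicial_polytope P" and z: "z \<in> interior P"
begin

text \<open>Facets are represented by their vertex sets, so proper faces become subsets of
  members.\<close>

definition facets :: "'a set set"
  where "facets = {A. \<not> affine_dependent A \<and> convex hull A facet_of P}"

lemma P_props: "polytope P" "polyhedron P" "convex P" "closed P" "bounded P" "aff_dim P = int DIM('a)" "P \<noteq> {}"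
proof -
  show p: "polytope P" "aff_dim P = int DIM('a)"
    using simplicial by (auto simp: simplicial_polytope_def full_polytope_def)
  show "polyhedron P" "convex P" "closed P" "bounded P"
    using p(1) by (simp_all add: polytope_imp_polyhedron polytope_imp_convex polytope_imp_closed polytope_imp_bounded)
  show "P \<noteq> {}"
    using z interior_subset by blast
qed

lemma facet_ex:
  assumes "F facet_of P"
  shows "\<exists>A\<in>facets. F = convex hull A"
proof -
  have "F face_of P" "F \<noteq> P"
    using assms by (auto simp: facet_of_imp_face_of)
  then obtain n where "n simplex F"
    using simplicial by (auto simp: simplicial_polytope_def)
  then obtain A where "\<not> affine_dependent A" "F = convex hull A"
    unfolding simplex by blast
  with assms show ?thesis
    by (auto simp: facets_def)
qed

lemma extreme_points_facet: "A \<in> facets \<Longrightarrow> {v. v extreme_point_of (convex hull A)} = A"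
  by (auto simp: facets_def extreme_point_of_convex_hull_affine_independent)

lemma finite_facets: "finite facets"
proof (rule finite_imageD)
  show "finite ((hull) convex ` facets)"
    by (rule finite_subset[OF _ finite_polytope_facets[OF P_props(1)]]) (auto simp: facets_def)
  show "inj_on ((hull) convex) facets"
    by (rule inj_onI) (metis extreme_points_facet)
qed

lemma finite_facet: "A \<in> facets \<Longrightarrow> finite A"
  by (auto simp: facets_def aff_independent_finite)

lemma card_facet: "A \<in> facets \<Longrightarrow> card A = DIM('a)"
  using aff_dim_affine_independent[of A] P_props(6)
  by (auto simp: facets_def facet_of_def aff_dim_convex_hull)

lemma facet_eqI: "A \<in> facets \<Longrightarrow> B \<in> facets \<Longrightarrow> A \<subseteq> B \<Longrightarrow> A = B"
  by (simp add: card_subset_eq finite_facet card_facet)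

lemma facet_face: "A \<in> facets \<Longrightarrow> convex hull A face_of P"
  by (auto simp: facets_def facet_of_imp_face_of)

lemma facet_subset: "A \<in> facets \<Longrightarrow> convex hull A \<subseteq> P" "A \<in> facets \<Longrightarrow> A \<subseteq> P"
  using face_of_imp_subset[OF facet_face] hull_subset[of A convex] by auto

lemma vertex_in_facet:
  assumes "A \<in> facets" "B \<in> facets" "v \<in> A" "v \<in> convex hull B"
  shows "v \<in> B"
proof -
  have "v extreme_point_of P"
    using extreme_points_facet[OF assms(1)] assms(3) extreme_point_of_face[OF facet_face[OF assms(1)]] by blast
  then have "v extreme_point_of (convex hull B)"
    using assms(4) extreme_point_of_face[OF facet_face[OF assms(2)]] by blast
  then show ?thesis
    using extreme_points_facet[OF assms(2)] by blast
qed

lemma normal_ex: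
  assumes "A \<in> facets"
  shows "\<exists>n. (\<forall>x\<in>P. n \<bullet> (x - z) \<le> 1) \<and> convex hull A = P \<inter> {x. n \<bullet> (x - z) = 1}"
proof -
  obtain a b where ab: "a \<noteq> 0" "P \<subseteq> {x. a \<bullet> x \<le> b}" "convex hull A = P \<inter> {x. a \<bullet> x = b}"
    using facet_of_polyhedron[OF P_props(2), of "convex hull A"] assms by (auto simp: facets_def)
  have "interior P \<subseteq> interior {x. a \<bullet> x \<le> b}"
    by (rule interior_mono[OF ab(2)])
  then have pos: "0 < b - a \<bullet> z"
    using z ab(1) by auto
  define n where "n = (1 / (b - a \<bullet> z)) *\<^sub>R a"
  have n: "n \<bullet> (x - z) = (a \<bullet> x - a \<bullet> z) / (b - a \<bullet> z)" for x
    by (simp add: n_def inner_diff_right diff_divide_distrib)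
  have "n \<bullet> (x - z) \<le> 1 \<longleftrightarrow> a \<bullet> x \<le> b" "n \<bullet> (x - z) = 1 \<longleftrightarrow> a \<bullet> x = b" for x
    unfolding n using pos by (auto simp: field_simps)
  with ab show ?thesis
    by (intro exI[of _ n]) auto
qed

definition nrm :: "'a set \<Rightarrow> 'a"
  where "nrm A = (SOME n. (\<forall>x\<in>P. n \<bullet> (x - z) \<le> 1) \<and> convex hull A = P \<inter> {x. n \<bullet> (x - z) = 1})"

lemma nrm:
  assumes "A \<in> facets"
  shows "x \<in> P \<Longrightarrow> nrm A \<bullet> (x - z) \<le> 1" "convex hull A = P \<inter> {x. nrm A \<bullet> (x - z) = 1}"
  using someI_ex[OF normal_ex[OF assms]] unfolding nrm_def[symmetric] by auto

lemma nrm_vertex: "A \<in> facets \<Longrightarrow> v \<in> A \<Longrightarrow> nrm A \<bullet> (v - z) = 1"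
  using nrm(2)[of A] hull_subset[of A convex] by auto

lemma nrm_vertex_iff:
  assumes "A \<in> facets" "B \<in> facets" "v \<in> A"
  shows "nrm B \<bullet> (v - z) = 1 \<longleftrightarrow> v \<in> B"
  using nrm(2)[OF assms(2)] vertex_in_facet[OF assms] nrm_vertex[OF assms(2)] facet_subset(2)[OF assms(1)] assms(3)
  by auto

text \<open>The segment from \<open>z\<close> to a point outside leaves \<open>P\<close> through
  some facet before its end, and the normal of that facet exceeds 1 at the end.\<close>

lemma in_P_iff: "x \<in> P \<longleftrightarrow> (\<forall>A\<in>facets. nrm A \<bullet> (x - z) \<le> 1)"
proof
  assume *: "\<forall>A\<in>facets. nrm A \<bullet> (x - z) \<le> 1"
  show "x \<in> P"
  proof (rule ccontr)
    assume xP: "x \<notin> P"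
    then have "x - z \<noteq> 0"
      using z interior_subset by auto
    then obtain t where t: "0 < t" "z + t *\<^sub>R (x - z) \<in> frontier P"
      "\<And>e. 0 \<le> e \<Longrightarrow> e < t \<Longrightarrow> z + e *\<^sub>R (x - z) \<in> interior P"
      using ray_to_frontier[OF P_props(5) z] by blast
    have "t < 1"
    proof (rule ccontr)
      assume "\<not> t < 1"
      then have "z + 1 *\<^sub>R (x - z) \<in> P"
        using t(3)[of 1] t(2) interior_subset[of P] frontier_subset_closed[OF P_props(4)]
        by (cases "t = 1") auto
      with xP show False by simp
    qed
    have "frontier P = \<Union> {F. F facet_of P}"
      using rel_frontier_of_polyhedron[OF P_props(2)] rel_frontier_nonempty_interior[of P] z by auto
    then obtain A where A: "A \<in> facets" "z + t *\<^sub>R (x - z) \<in> convex hull A"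
      using t(2) facet_ex by blast
    then have "t * (nrm A \<bullet> (x - z)) = 1"
      using nrm(2)[OF A(1)] by auto
    moreover have "t * (nrm A \<bullet> (x - z)) \<le> t * 1"
      using * A(1) t(1) by (intro mult_left_mono) auto
    ultimately show False
      using \<open>t < 1\<close> by simp
  qed
qed (use nrm in blast)

text \<open>The point \<open>z\<close> is off the hyperplane of the facet, so the vectors
  \<open>v - z\<close> form a basis.\<close>

lemma orthogonal_vertices_0:
  assumes A: "A \<in> facets" and u: "\<And>v. v \<in> A \<Longrightarrow> u \<bullet> (v - z) = 0"
  shows "u = 0"
proof (rule ccontr)
  assume "u \<noteq> 0"
  have "z \<notin> affine hull A"
  proof
    assume "z \<in> affine hull A"
    moreover have "affine hull A \<subseteq> {x. nrm A \<bullet> x = 1 + nrm A \<bullet> z}"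
      using nrm_vertex[OF A, unfolded inner_diff_right]
      by (intro hull_minimal affine_hyperplane) (auto simp: diff_eq_eq)
    ultimately show False by auto
  qed
  then have "aff_dim (insert z A) = aff_dim A + 1"
    by (simp add: aff_dim_insert)
  also have "\<dots> = int (card A)"
    using A aff_dim_affine_independent[of A] by (simp add: facets_def)
  finally have "aff_dim (insert z A) = int DIM('a)"
    using card_facet[OF A] by simp
  moreover have "insert z A \<subseteq> {x. u \<bullet> x = u \<bullet> z}"
    using u by (auto simp: inner_diff_right)
  then have "aff_dim (insert z A) \<le> aff_dim {x. u \<bullet> x = u \<bullet> z}"
    by (rule aff_dim_subset)
  ultimately show False
    using \<open>u \<noteq> 0\<close> by (simp add: aff_dim_hyperplane)
qed

lemma dual_vector_ex:
  assumes A: "A \<in> facets" and v: "v \<in> A"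
  shows "\<exists>u. \<forall>v'\<in>A. u \<bullet> (v' - z) = (if v' = v then 1 else 0)"
proof -
  have "dim ((\<lambda>x. x - z) ` (A - {v})) \<le> card ((\<lambda>x. x - z) ` (A - {v}))"
    using finite_facet[OF A] by (intro dim_le_card') simp
  also have "\<dots> \<le> card (A - {v})"
    using finite_facet[OF A] by (intro card_image_le) simp
  also have "\<dots> < DIM('a)"
    using card_facet[OF A] finite_facet[OF A] v by (metis card_Diff1_less)
  finally obtain u where u: "u \<noteq> 0" "\<And>y. y \<in> span ((\<lambda>x. x - z) ` (A - {v})) \<Longrightarrow> orthogonal u y"
    using orthogonal_to_subspace_exists by blast
  have u0: "u \<bullet> (v' - z) = 0" if "v' \<in> A" "v' \<noteq> v" for v'
    using u(2)[of "v' - z"] that by (auto simp: orthogonal_def intro: span_base)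
  have "u \<bullet> (v - z) \<noteq> 0"
    using orthogonal_vertices_0[OF A, of u] u0 u(1) by metis
  then show ?thesis
    using u0 by (intro exI[of _ "(1 / (u \<bullet> (v - z))) *\<^sub>R u"]) auto
qed

text \<open>\<open>dvec A\<close> is the basis dual to the vectors \<open>v - z\<close> for \<open>v \<in> A\<close>.\<close>

definition dvec :: "'a set \<Rightarrow> 'a \<Rightarrow> 'a"
  where "dvec A v = (SOME u. \<forall>v'\<in>A. u \<bullet> (v' - z) = (if v' = v then 1 else 0))"

lemma dvec: "A \<in> facets \<Longrightarrow> v \<in> A \<Longrightarrow> v' \<in> A \<Longrightarrow> dvec A v \<bullet> (v' - z) = (if v' = v then 1 else 0)"
  using someI_ex[OF dual_vector_ex] unfolding dvec_def[symmetric] by blast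

lemma dvec_nonzero: "A \<in> facets \<Longrightarrow> v \<in> A \<Longrightarrow> dvec A v \<noteq> 0"
  using dvec[of A v v] by auto

lemma nrm_nonzero:
  assumes "A \<in> facets"
  shows "nrm A \<noteq> 0"
proof -
  have "A \<noteq> {}"
    using card_facet[OF assms] by auto
  then show ?thesis
    using nrm_vertex[OF assms] by force
qed

lemma dual_expansion:
  assumes A: "A \<in> facets"
  shows "m = (\<Sum>v\<in>A. (m \<bullet> (v - z)) *\<^sub>R dvec A v)"
proof -
  have "m - (\<Sum>v\<in>A. (m \<bullet> (v - z)) *\<^sub>R dvec A v) = 0"
  proof (rule orthogonal_vertices_0[OF A])
    fix v' assume v': "v' \<in> A"
    have "(\<Sum>v\<in>A. (m \<bullet> (v - z)) *\<^sub>R dvec A v) \<bullet> (v' - z) = (\<Sum>v\<in>A. if v = v' then m \<bullet> (v' - z) else 0)"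
      unfolding inner_sum_left using dvec[OF A _ v'] by (intro sum.cong) auto
    also have "\<dots> = m \<bullet> (v' - z)"
      using v' finite_facet[OF A] by simp
    finally show "(m - (\<Sum>v\<in>A. (m \<bullet> (v - z)) *\<^sub>R dvec A v)) \<bullet> (v' - z) = 0"
      by (simp only: inner_diff_left)
  qed
  then show ?thesis by simp
qed

text \<open>The coefficients \<open>1 - nrm B \<bullet> (v - z)\<close> are nonnegative and vanish
  exactly at the vertices shared with \<open>B\<close>. The comparison of heights is thus read off
  from the signs of \<open>dvec A v \<bullet> w\<close>.\<close>

lemma height_diff:
  assumes A: "A \<in> facets" and B: "B \<in> facets"
  shows "nrm A \<bullet> w - nrm B \<bullet> w = (\<Sum>v\<in>A. (1 - nrm B \<bullet> (v - z)) * (dvec A v \<bullet> w))"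
proof -
  have "nrm A - nrm B = (\<Sum>v\<in>A. ((nrm A - nrm B) \<bullet> (v - z)) *\<^sub>R dvec A v)"
    by (rule dual_expansion[OF A])
  also have "\<dots> = (\<Sum>v\<in>A. (1 - nrm B \<bullet> (v - z)) *\<^sub>R dvec A v)"
    by (intro sum.cong refl) (simp add: inner_diff_left nrm_vertex[OF A])
  finally have "(nrm A - nrm B) \<bullet> w = (\<Sum>v\<in>A. (1 - nrm B \<bullet> (v - z)) * (dvec A v \<bullet> w))"
    by (simp only: inner_sum_left inner_scaleR_left)
  then show ?thesis
    by (simp only: inner_diff_left)
qed

text \<open>The normal is the sum of the dual basis. Hence a facet whose restriction set is full has
  positive height, which later makes entry 0 of the gamma vector vanish.\<close>

lemma height_pos:
  assumes A: "A \<in> facets" and pos: "\<And>v. v \<in> A \<Longrightarrow> 0 < dvec A v \<bullet> w"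
  shows "0 < nrm A \<bullet> w"
proof -
  have "nrm A = (\<Sum>v\<in>A. dvec A v)"
    using dual_expansion[OF A, of "nrm A"] nrm_vertex[OF A] by simp
  then have "nrm A \<bullet> w = (\<Sum>v\<in>A. dvec A v \<bullet> w)"
    by (metis inner_sum_left)
  moreover have "A \<noteq> {}"
    using card_facet[OF A] by auto
  ultimately show ?thesis
    using pos finite_facet[OF A] by (simp add: sum_pos)
qed

text \<open>The supporting hyperplane of \<open>A\<close> is tilted about the ridge
  \<open>A - {v}\<close> until it reaches a further extreme point \<open>y\<close>, as in a pivot
  step of the simplex method. The ratio \<rho> is the tilt at which a point becomes tight.\<close>

lemma neighbour_ex:
  assumes A: "A \<in> facets" and v: "v \<in> A"
  shows "\<exists>B\<in>facets. B \<noteq> A \<and> A - {v} \<subseteq> B"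
proof -
  define u where "u = dvec A v"
  define E where "E = {x. x extreme_point_of P}"
  have finE: "finite E"
    unfolding E_def by (rule finite_polyhedron_extreme_points[OF P_props(2)])
  have PE: "P = convex hull E"
    unfolding E_def using Krein_Milman_Minkowski[of P] P_props polytope_imp_compact by blast
  have EP: "E \<subseteq> P"
    using PE hull_subset by metis
  have sub: "P \<subseteq> {x. n \<bullet> (x - z) \<le> c}" if "\<And>x. x \<in> E \<Longrightarrow> n \<bullet> (x - z) \<le> c" for n c
  proof -
    have "convex {x. n \<bullet> x \<le> c + n \<bullet> z}"
      by (rule convex_halfspace_le)
    moreover have "{x. n \<bullet> x \<le> c + n \<bullet> z} = {x. n \<bullet> (x - z) \<le> c}"
      by (auto simp: inner_diff_right)
    ultimately show ?thesis
      unfolding PE using that by (intro hull_minimal) auto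
  qed
  define S where "S = {x \<in> E. u \<bullet> (x - z) < 0}"
  \<comment> \<open>Otherwise \<open>P\<close> lies in a half-space whose boundary passes through
    the interior point \<open>z\<close>.\<close>
  have "S \<noteq> {}"
  proof
    assume "S = {}"
    then have "P \<subseteq> {x. (- u) \<bullet> (x - z) \<le> 0}"
      by (intro sub) (force simp: S_def)
    then have "interior P \<subseteq> interior {x. (- u) \<bullet> x \<le> (- u) \<bullet> z}"
      by (intro interior_mono) (auto simp: inner_diff_right)
    moreover have "- u \<noteq> 0"
      using dvec_nonzero[OF A v] by (simp add: u_def)
    then have "interior {x. (- u) \<bullet> x \<le> (- u) \<bullet> z} = {x. (- u) \<bullet> x < (- u) \<bullet> z}"
      by (rule interior_halfspace_le)
    ultimately show False
      using z by auto
  qed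
  define \<rho> where "\<rho> x = (1 - nrm A \<bullet> (x - z)) / (- (u \<bullet> (x - z)))" for x
  define t where "t = Min (\<rho> ` S)"
  have finS: "finite S"
    using finE by (simp add: S_def)
  have "t \<in> \<rho> ` S"
    unfolding t_def using finS \<open>S \<noteq> {}\<close> by (intro Min_in) auto
  then obtain y where y: "y \<in> S" "\<rho> y = t"
    by blast
  have t_le: "t \<le> \<rho> x" if "x \<in> S" for x
    using that finS by (simp add: t_def)
  have slack: "0 \<le> 1 - nrm A \<bullet> (x - z)" if "x \<in> E" for x
    using nrm(1)[OF A] that EP by auto
  have t0: "0 \<le> t"
    unfolding y(2)[symmetric] \<rho>_def
    by (rule divide_nonneg_pos) (use y(1) slack in \<open>auto simp: S_def\<close>)
  define m where "m = nrm A - t *\<^sub>R u"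
  have m: "m \<bullet> (x - z) = nrm A \<bullet> (x - z) - t * (u \<bullet> (x - z))" for x
    by (simp add: m_def inner_diff_left)
  have "m \<bullet> (x - z) \<le> 1" if x: "x \<in> E" for x
  proof (cases "x \<in> S")
    case True
    then have "- (u \<bullet> (x - z)) > 0"
      by (simp add: S_def)
    then have "t * (- (u \<bullet> (x - z))) \<le> \<rho> x * (- (u \<bullet> (x - z)))"
      using t_le[OF True] by (intro mult_right_mono) simp_all
    also have "\<dots> = 1 - nrm A \<bullet> (x - z)"
      using \<open>- (u \<bullet> (x - z)) > 0\<close> by (simp add: \<rho>_def)
    finally have "t * (- (u \<bullet> (x - z))) \<le> 1 - nrm A \<bullet> (x - z)" .
    then show ?thesis
      unfolding m by simp
  next
    case False
    then have "0 \<le> t * (u \<bullet> (x - z))"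
      using t0 x by (auto simp: S_def)
    then show ?thesis
      unfolding m using slack[OF x] by linarith
  qed
  then have mP: "P \<subseteq> {x. m \<bullet> (x - z) \<le> 1}"
    by (rule sub)
  define K where "K = P \<inter> {x. m \<bullet> x = 1 + m \<bullet> z}"
  have K: "K = P \<inter> {x. m \<bullet> (x - z) = 1}"
    by (auto simp: K_def inner_diff_right)
  have "K face_of P"
    unfolding K_def using mP by (intro face_of_Int_supporting_hyperplane_le P_props) (auto simp: inner_diff_right)
  moreover have yK: "y \<in> K"
  proof -
    have "- (u \<bullet> (y - z)) > 0"
      using y(1) by (simp add: S_def)
    then have "t * (- (u \<bullet> (y - z))) = 1 - nrm A \<bullet> (y - z)"
      unfolding y(2)[symmetric] \<rho>_def by simp
    then have "m \<bullet> (y - z) = 1"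
      unfolding m by simp
    then show ?thesis
      using y(1) EP by (auto simp: K S_def)
  qed
  moreover have "K \<noteq> P"
  proof
    assume "K = P"
    then have "z \<in> K" using z interior_subset by auto
    then show False by (simp add: K)
  qed
  ultimately obtain F where "F facet_of P" "K \<subseteq> F"
    using face_of_polyhedron_subset_facet[OF P_props(2), of K] by auto
  then obtain B where B: "B \<in> facets" "K \<subseteq> convex hull B"
    using facet_ex by blast
  have "A - {v} \<subseteq> B"
  proof
    fix x assume x: "x \<in> A - {v}"
    then have "m \<bullet> (x - z) = 1"
      unfolding m u_def using dvec[OF A v] nrm_vertex[OF A] by auto
    then have "x \<in> K"
      using x facet_subset(2)[OF A] by (auto simp: K)
    then show "x \<in> B"
      using vertex_in_facet[OF A B(1)] B(2) x by auto
  qed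
  moreover have "B \<noteq> A"
  proof
    assume "B = A"
    then have yA: "y \<in> convex hull A"
      using yK B(2) by auto
    have "convex {x. u \<bullet> x \<ge> u \<bullet> z}"
      by (rule convex_halfspace_ge)
    moreover have "u \<bullet> z \<le> u \<bullet> x" if "x \<in> A" for x
    proof -
      have "0 \<le> u \<bullet> (x - z)"
        using dvec[OF A v that] by (simp add: u_def)
      then show ?thesis
        by (simp add: inner_diff_right)
    qed
    ultimately have "convex hull A \<subseteq> {x. u \<bullet> x \<ge> u \<bullet> z}"
      by (intro hull_minimal) auto
    then show False
      using yA y(1) by (auto simp: S_def inner_diff_right)
  qed
  ultimately show ?thesis
    using B(1) by blast
qed

text \<open>The difference of the normals vanishes on the common ridge, hence is a multiple of
  \<open>dvec A v\<close>; the factor is the slack of \<open>B\<close> at \<open>v\<close>.\<close>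

lemma neighbour_normal:
  assumes A: "A \<in> facets" and v: "v \<in> A" and B: "B \<in> facets" "B \<noteq> A" "A - {v} \<subseteq> B"
  shows "\<exists>c>0. nrm B = nrm A - c *\<^sub>R dvec A v"
proof -
  define c where "c = 1 - nrm B \<bullet> (v - z)"
  have "nrm A - nrm B = (\<Sum>x\<in>A. ((nrm A - nrm B) \<bullet> (x - z)) *\<^sub>R dvec A x)"
    by (rule dual_expansion[OF A])
  also have "\<dots> = (\<Sum>x\<in>A. if x = v then c *\<^sub>R dvec A v else 0)"
  proof (intro sum.cong refl)
    fix x assume x: "x \<in> A"
    have "x \<noteq> v \<Longrightarrow> nrm B \<bullet> (x - z) = 1"
      using nrm_vertex[OF B(1)] B(3) x by auto
    then show "((nrm A - nrm B) \<bullet> (x - z)) *\<^sub>R dvec A x = (if x = v then c *\<^sub>R dvec A v else 0)"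
      using nrm_vertex[OF A x] by (auto simp: inner_diff_left c_def)
  qed
  also have "\<dots> = c *\<^sub>R dvec A v"
    using v finite_facet[OF A] by simp
  finally have "nrm B = nrm A - c *\<^sub>R dvec A v"
    by (metis add_diff_cancel_left' diff_add_cancel)
  moreover have "v \<notin> B"
  proof
    assume "v \<in> B"
    then have "A \<subseteq> B"
      using B(3) by auto
    with facet_eqI[OF A B(1)] B(2) show False by blast
  qed
  then have "nrm B \<bullet> (v - z) \<noteq> 1"
    using nrm_vertex_iff[OF A B(1) v] by simp
  moreover have "nrm B \<bullet> (v - z) \<le> 1"
    using nrm(1)[OF B(1)] facet_subset(2)[OF A] v by auto
  ultimately have "0 < c" "nrm B = nrm A - c *\<^sub>R dvec A v"
    by (simp_all add: c_def)
  then show ?thesis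
    by blast
qed

text \<open>Both normals arise from \<open>nrm A\<close> by subtracting positive multiples of the
  same vector, which is nonpositive at the vertices of either neighbour. At vertices of the
  neighbour with the smaller multiple, the other normal is therefore at least 1, hence
  tight.\<close>

lemma neighbour_unique:
  assumes A: "A \<in> facets" and v: "v \<in> A"
    and B: "B \<in> facets" "B \<noteq> A" "A - {v} \<subseteq> B" and B': "B' \<in> facets" "B' \<noteq> A" "A - {v} \<subseteq> B'"
  shows "B = B'"
proof -
  obtain c where c: "c > 0" "nrm B = nrm A - c *\<^sub>R dvec A v"
    using neighbour_normal[OF A v B] by blast
  obtain c' where c': "c' > 0" "nrm B' = nrm A - c' *\<^sub>R dvec A v"
    using neighbour_normal[OF A v B'] by blast
  have main: "B1 \<subseteq> B2"
    if B1: "B1 \<in> facets" "nrm B1 = nrm A - c1 *\<^sub>R dvec A v" and B2: "B2 \<in> facets" "nrm B2 = nrm A - c2 *\<^sub>R dvec A v"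
      and cc: "0 < c1" "c1 \<le> c2" for B1 B2 c1 c2
  proof
    fix x assume x: "x \<in> B1"
    then have xP: "x \<in> P"
      using facet_subset(2)[OF B1(1)] by auto
    have 1: "nrm A \<bullet> (x - z) - c1 * (dvec A v \<bullet> (x - z)) = 1"
      using nrm_vertex[OF B1(1) x] by (simp add: B1(2) inner_diff_left)
    have 2: "nrm A \<bullet> (x - z) - c2 * (dvec A v \<bullet> (x - z)) \<le> 1"
      using nrm(1)[OF B2(1) xP] by (simp add: B2(2) inner_diff_left)
    have 3: "nrm A \<bullet> (x - z) \<le> 1"
      by (rule nrm(1)[OF A xP])
    have "dvec A v \<bullet> (x - z) \<le> 0"
    proof (rule ccontr)
      assume "\<not> dvec A v \<bullet> (x - z) \<le> 0"
      then have "c1 * (dvec A v \<bullet> (x - z)) > 0" using cc by simp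
      with 1 3 show False by linarith
    qed
    then have "c2 * (dvec A v \<bullet> (x - z)) \<le> c1 * (dvec A v \<bullet> (x - z))"
      using cc by (intro mult_right_mono_neg) auto
    with 1 2 have "nrm B2 \<bullet> (x - z) = 1"
      by (simp add: B2(2) inner_diff_left)
    then show "x \<in> B2"
      using nrm_vertex_iff[OF B1(1) B2(1) x] by simp
  qed
  show ?thesis
  proof (cases "c \<le> c'")
    case True
    from facet_eqI[OF B(1) B'(1) main[OF B(1) c(2) B'(1) c'(2) c(1) True]] show ?thesis .
  next
    case False
    then have "c' \<le> c" by simp
    from facet_eqI[OF B'(1) B(1) main[OF B'(1) c'(2) B(1) c(2) c'(1) this]] show ?thesis by simp
  qed
qed

lemma even_ridge:
  assumes A: "A \<in> facets" and G: "G \<subseteq> A" "card G + 1 = DIM('a)"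
  shows "even (card {B \<in> facets. G \<subseteq> B})"
proof -
  have "card (A - G) = 1"
    using G card_facet[OF A] finite_facet[OF A] by (simp add: card_Diff_subset finite_subset)
  then obtain v where "A - G = {v}"
    by (rule card_1_singletonE)
  then have v: "v \<in> A" "G = A - {v}"
    using G(1) by auto
  obtain B where B: "B \<in> facets" "B \<noteq> A" "A - {v} \<subseteq> B"
    using neighbour_ex[OF A v(1)] by blast
  have "{B \<in> facets. G \<subseteq> B} = {A, B}"
    using neighbour_unique[OF A v(1) B] A B v by blast
  then show ?thesis
    using B(2) by simp
qed

section \<open>Generic directions and the shellings that they induce\<close>

definition normals :: "'a set"
  where "normals = nrm ` facets \<union> (\<Union>A\<in>facets. dvec A ` A)"

lemma finite_normals: "finite normals"
  by (auto simp: normals_def finite_facets finite_facet)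

lemma zero_notin_normals: "0 \<notin> normals"
  using nrm_nonzero dvec_nonzero unfolding normals_def by force

definition generic :: "'a \<Rightarrow> bool"
  where "generic w \<longleftrightarrow> (\<forall>n\<in>normals. n \<bullet> w \<noteq> 0)"

text \<open>By \<open>neighbour_normal\<close>, these are the vertices opposite to the ridges across
  which the neighbouring facet is lower.\<close>

definition restr :: "'a \<Rightarrow> 'a set \<Rightarrow> 'a set"
  where "restr w A = {v \<in> A. 0 < dvec A v \<bullet> w}"

lemma genericD: "generic w \<Longrightarrow> A \<in> facets \<Longrightarrow> nrm A \<bullet> w \<noteq> 0"
  "generic w \<Longrightarrow> A \<in> facets \<Longrightarrow> v \<in> A \<Longrightarrow> dvec A v \<bullet> w \<noteq> 0"
  by (auto simp: generic_def normals_def)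

lemma generic_uminus: "generic w \<Longrightarrow> generic (- w)"
  by (simp add: generic_def)

lemma restr_uminus: "generic w \<Longrightarrow> A \<in> facets \<Longrightarrow> restr (- w) A = A - restr w A"
  using genericD(2)[of w A] by (force simp: restr_def)

text \<open>In \<open>height_diff\<close> the terms of \<open>restr w A\<close> vanish because these
  vertices lie in \<open>B\<close>. All others are nonpositive, and negative at a vertex outside
  \<open>B\<close>.\<close>

lemma restr_lower:
  assumes w: "generic w" and A: "A \<in> facets" and B: "B \<in> facets" "restr w A \<subseteq> B" "B \<noteq> A"
  shows "nrm A \<bullet> w < nrm B \<bullet> w"
proof -
  have "0 < (\<Sum>v\<in>A. - ((1 - nrm B \<bullet> (v - z)) * (dvec A v \<bullet> w)))"
  proof -
    have nonneg: "0 \<le> 1 - nrm B \<bullet> (v - z)" if "v \<in> A" for v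
      using nrm(1)[OF B(1)] facet_subset(2)[OF A] that by auto
    obtain v where v: "v \<in> A" "v \<notin> B"
      using facet_eqI[OF A B(1)] B(3) by blast
    show ?thesis
    proof (rule sum_pos2[OF finite_facet[OF A] v(1)])
      have "nrm B \<bullet> (v - z) \<noteq> 1"
        using nrm_vertex_iff[OF A B(1) v(1)] v(2) by simp
      then have "0 < 1 - nrm B \<bullet> (v - z)"
        using nonneg[OF v(1)] by simp
      moreover have "dvec A v \<bullet> w < 0"
        using v B(2) genericD(2)[OF w A v(1)] by (force simp: restr_def)
      ultimately show "0 < - ((1 - nrm B \<bullet> (v - z)) * (dvec A v \<bullet> w))"
        by (simp add: mult_pos_neg)
    next
      fix x assume x: "x \<in> A"
      show "0 \<le> - ((1 - nrm B \<bullet> (x - z)) * (dvec A x \<bullet> w))"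
      proof (cases "x \<in> restr w A")
        case True
        then show ?thesis
          using B(2) nrm_vertex[OF B(1)] by auto
      next
        case False
        then have "dvec A x \<bullet> w \<le> 0"
          using x by (simp add: restr_def)
        then show ?thesis
          using nonneg[OF x] by (simp add: mult_nonneg_nonpos)
      qed
    qed
  qed
  then show ?thesis
    using height_diff[OF A B(1), of w] by (simp add: sum_negf)
qed

text \<open>The direction \<open>- w\<close> reverses the shelling and complements the restriction
  sets.\<close>

lemma restr_upper:
  assumes w: "generic w" and A: "A \<in> facets" and B: "B \<in> facets" "A - restr w A \<subseteq> B" "B \<noteq> A"
  shows "nrm B \<bullet> w < nrm A \<bullet> w"
  using restr_lower[OF generic_uminus[OF w] A B(1) _ B(3)] B(2) restr_uminus[OF w A] by simp

lemma restr_descend: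
  assumes A: "A \<in> facets" and G: "G \<subseteq> A" "\<not> restr w A \<subseteq> G"
  shows "\<exists>B\<in>facets. G \<subseteq> B \<and> nrm B \<bullet> w < nrm A \<bullet> w"
proof -
  obtain v where v: "v \<in> A" "0 < dvec A v \<bullet> w" "v \<notin> G"
    using G(2) by (auto simp: restr_def)
  obtain B where B: "B \<in> facets" "B \<noteq> A" "A - {v} \<subseteq> B"
    using neighbour_ex[OF A v(1)] by blast
  obtain c where "c > 0" "nrm B = nrm A - c *\<^sub>R dvec A v"
    using neighbour_normal[OF A v(1) B] by blast
  then have "nrm B \<bullet> w < nrm A \<bullet> w"
    using v(2) by (simp add: inner_diff_left)
  then show ?thesis
    using B G(1) v(3) by blast
qed

lemma shelled_complex:
  assumes "generic w"
  shows "shelled_complex facets DIM('a) (restr w) (\<lambda>A. nrm A \<bullet> w)"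
proof
  show "restr w A \<subseteq> A" for A
    by (auto simp: restr_def)
qed (use finite_facets finite_facet card_facet even_ridge restr_lower[OF assms] restr_upper[OF assms] restr_descend in auto)

end

section \<open>Interior angles of simplicial polytopes\<close>

context simplicial_geometry
begin

text \<open>The index is the number of vertices, one more than the dimension; \<open>j = 0\<close>
  gives the empty face.\<close>

definition small_faces :: "nat \<Rightarrow> 'a set set"
  where "small_faces j = {G. card G = j \<and> (\<exists>A\<in>facets. G \<subseteq> A)}"

lemma finite_small_faces: "finite (small_faces j)"
proof (rule finite_subset)
  show "small_faces j \<subseteq> (\<Union>A\<in>facets. Pow A)"
    by (auto simp: small_faces_def)
qed (simp add: finite_facets finite_facet)

lemma facets_nonempty: "facets \<noteq> {}"
proof -
  have "P \<noteq> UNIV"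
    using P_props(5) not_bounded_UNIV by auto
  then show ?thesis
    using in_P_iff by auto
qed

lemma subset_facet_independent: "A \<in> facets \<Longrightarrow> G \<subseteq> A \<Longrightarrow> \<not> affine_dependent G"
  unfolding facets_def using affine_independent_subset by blast

lemma faces_of_dim_eq:
  assumes "1 \<le> j" "j \<le> DIM('a)"
  shows "faces_of_dim (int j - 1) P = (hull) convex ` small_faces j"
proof (intro equalityI subsetI)
  fix X assume "X \<in> faces_of_dim (int j - 1) P"
  then have X: "X face_of P" "aff_dim X = int j - 1"
    by (auto simp: faces_of_dim_def)
  have "X \<noteq> {}" "X \<noteq> P"
    using X(2) assms P_props(6) by auto
  then obtain F where "F facet_of P" "X \<subseteq> F"
    using face_of_polyhedron_subset_facet[OF P_props(2) X(1)] by blast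
  then obtain A where A: "A \<in> facets" "X \<subseteq> convex hull A"
    using facet_ex by blast
  have "X face_of convex hull A"
    using face_of_subset[OF X(1) A(2) facet_subset(1)[OF A(1)]] .
  then obtain G where G: "G \<subseteq> A" "X = convex hull G"
    using face_of_convex_hull_affine_independent[of A X] A(1) by (auto simp: facets_def)
  have "int (card G) = aff_dim X + 1"
    using aff_dim_affine_independent[OF subset_facet_independent[OF A(1) G(1)]] G(2)
    by (simp add: aff_dim_convex_hull)
  then have "G \<in> small_faces j"
    using X(2) A(1) G(1) by (auto simp: small_faces_def)
  with G(2) show "X \<in> (hull) convex ` small_faces j"
    by blast
next
  fix X assume "X \<in> (hull) convex ` small_faces j"
  then obtain G A where G: "X = convex hull G" "card G = j" "A \<in> facets" "G \<subseteq> A"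
    by (auto simp: small_faces_def)
  have "X face_of convex hull A"
    using face_of_convex_hull_affine_independent[of A X] G by (auto simp: facets_def)
  then have "X face_of P"
    using facet_face[OF G(3)] by (rule face_of_trans)
  moreover have "aff_dim X = int j - 1"
    using aff_dim_affine_independent[OF subset_facet_independent[OF G(3,4)]] G(1,2)
    by (simp add: aff_dim_convex_hull)
  ultimately show "X \<in> faces_of_dim (int j - 1) P"
    by (simp add: faces_of_dim_def)
qed

lemma inj_small_faces: "inj_on ((hull) convex) (small_faces j)"
proof (rule inj_onI)
  fix G G' assume G: "G \<in> small_faces j" "G' \<in> small_faces j" "convex hull G = convex hull G'"
  have "{v. v extreme_point_of (convex hull G)} = G" if "G \<in> small_faces j" for G
    using that subset_facet_independent extreme_point_of_convex_hull_affine_independent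
    unfolding small_faces_def by blast
  with G show "G = G'"
    by metis
qed

section \<open>Tangent cones and the faces that see a generic direction\<close>

definition face_normals :: "'a set \<Rightarrow> 'a set"
  where "face_normals G = nrm ` {B \<in> facets. G \<subseteq> B}"

lemma face_normals_subset: "face_normals G \<subseteq> normals"
  by (auto simp: face_normals_def normals_def)

text \<open>At a relative interior point of the face exactly the inequalities of the facets
  containing \<open>G\<close> are tight. The finitely many others leave room for a common positive
  step.\<close>

lemma tangent_cone_face:
  assumes G: "G \<in> small_faces j" "1 \<le> j"
  shows "tangent_cone (convex hull G) P = {x. \<forall>n\<in>face_normals G. n \<bullet> x \<le> 0}"
proof -
  obtain A where A: "A \<in> facets" "G \<subseteq> A" "card G = j"
    using G by (auto simp: small_faces_def)
  have face: "convex hull G face_of P"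
  proof -
    have "convex hull G face_of convex hull A"
      using face_of_convex_hull_affine_independent[of A "convex hull G"] A by (auto simp: facets_def)
    then show ?thesis
      using facet_face[OF A(1)] by (rule face_of_trans)
  qed
  have "G \<noteq> {}"
    using A(3) G(2) by auto
  then have "rel_interior (convex hull G) \<noteq> {}"
    by (simp add: rel_interior_eq_empty)
  then obtain q where q: "q \<in> rel_interior (convex hull G)"
    by blast
  then have qP: "q \<in> P"
    using rel_interior_subset face_of_imp_subset[OF face] by blast
  have active: "nrm B \<bullet> (q - z) = 1 \<longleftrightarrow> G \<subseteq> B" if B: "B \<in> facets" for B
  proof
    assume "nrm B \<bullet> (q - z) = 1"
    then have "q \<in> convex hull B"
      using nrm(2)[OF B] qP by auto
    then have "convex hull G \<subseteq> convex hull B"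
      using subset_of_face_of[OF facet_face[OF B] face_of_imp_subset[OF face]] q by blast
    then have "v \<in> convex hull B" if "v \<in> G" for v
      using that hull_subset[of G convex] by blast
    then show "G \<subseteq> B"
      using vertex_in_facet[OF A(1) B] A(2) by blast
  next
    assume "G \<subseteq> B"
    then have "q \<in> convex hull B"
      using q rel_interior_subset hull_mono[of G B convex] by blast
    then show "nrm B \<bullet> (q - z) = 1"
      using nrm(2)[OF B] by auto
  qed
  have step: "nrm B \<bullet> (q + \<epsilon> *\<^sub>R x - z) = nrm B \<bullet> (q - z) + \<epsilon> * (nrm B \<bullet> x)" for B \<epsilon> x
    by (simp add: inner_diff_right inner_add_right)
  have "(\<exists>\<epsilon>>0. q + \<epsilon> *\<^sub>R x \<in> P) \<longleftrightarrow> (\<forall>n\<in>face_normals G. n \<bullet> x \<le> 0)" for x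
  proof
    assume "\<exists>\<epsilon>>0. q + \<epsilon> *\<^sub>R x \<in> P"
    then obtain \<epsilon> where \<epsilon>: "\<epsilon> > 0" "q + \<epsilon> *\<^sub>R x \<in> P" by blast
    show "\<forall>n\<in>face_normals G. n \<bullet> x \<le> 0"
    proof
      fix n assume "n \<in> face_normals G"
      then obtain B where B: "B \<in> facets" "G \<subseteq> B" "n = nrm B"
        by (auto simp: face_normals_def)
      then have "\<epsilon> * (nrm B \<bullet> x) \<le> 0"
        using nrm(1)[OF B(1) \<epsilon>(2)] active[OF B(1)] unfolding step by simp
      then show "n \<bullet> x \<le> 0"
        using \<epsilon>(1) B(3) by (simp add: mult_le_0_iff)
    qed
  next
    assume le: "\<forall>n\<in>face_normals G. n \<bullet> x \<le> 0"
    have "\<exists>e>0. e * (nrm B \<bullet> x) \<le> 1 - nrm B \<bullet> (q - z)" if B: "B \<in> facets" for B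
    proof (cases "G \<subseteq> B")
      case True
      then have "nrm B \<bullet> x \<le> 0"
        using le B by (auto simp: face_normals_def)
      then show ?thesis
        using active[OF B] True by (intro exI[of _ 1]) simp
    next
      case False
      then have pos: "0 < 1 - nrm B \<bullet> (q - z)"
        using active[OF B] nrm(1)[OF B qP] by simp
      show ?thesis
      proof (cases "0 < nrm B \<bullet> x")
        case True
        then show ?thesis
          using pos by (intro exI[of _ "(1 - nrm B \<bullet> (q - z)) / (nrm B \<bullet> x)"]) simp
      next
        case False
        then show ?thesis
          using pos by (intro exI[of _ 1]) simp
      qed
    qed
    then obtain e where e: "\<And>B. B \<in> facets \<Longrightarrow> 0 < e B"
      "\<And>B. B \<in> facets \<Longrightarrow> e B * (nrm B \<bullet> x) \<le> 1 - nrm B \<bullet> (q - z)"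
      by metis
    define \<epsilon> where "\<epsilon> = Min (e ` facets)"
    have "\<epsilon> \<in> e ` facets"
      unfolding \<epsilon>_def using finite_facets facets_nonempty by (intro Min_in) auto
    then have \<epsilon>0: "0 < \<epsilon>"
      using e(1) by auto
    have "q + \<epsilon> *\<^sub>R x \<in> P"
      unfolding in_P_iff step
    proof
      fix B assume B: "B \<in> facets"
      have "\<epsilon> \<le> e B"
        unfolding \<epsilon>_def using B finite_facets by (intro Min_le) auto
      show "nrm B \<bullet> (q - z) + \<epsilon> * (nrm B \<bullet> x) \<le> 1"
      proof (cases "0 \<le> nrm B \<bullet> x")
        case True
        then have "\<epsilon> * (nrm B \<bullet> x) \<le> e B * (nrm B \<bullet> x)"
          using \<open>\<epsilon> \<le> e B\<close> by (rule mult_right_mono[rotated])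
        with e(2)[OF B] show ?thesis by linarith
      next
        case False
        then have "\<epsilon> * (nrm B \<bullet> x) \<le> 0"
          using \<epsilon>0 by (simp add: mult_le_0_iff)
        with nrm(1)[OF B qP] show ?thesis by linarith
      qed
    qed
    with \<epsilon>0 show "\<exists>\<epsilon>>0. q + \<epsilon> *\<^sub>R x \<in> P" by blast
  qed
  then show ?thesis
    unfolding tangent_cone_eq[OF P_props(3) face q] by blast
qed

text \<open>Each face \<open>G\<close> lies in exactly one interval \<open>A - restr w A \<subseteq> G \<subseteq> A\<close>, namely for the highest facet
  \<open>A\<close> containing it.\<close>

lemma card_small_faces_within:
  assumes w: "generic w" and S: "S \<subseteq> facets"
    and down: "\<And>A B. A \<in> S \<Longrightarrow> B \<in> facets \<Longrightarrow> nrm B \<bullet> w < nrm A \<bullet> w \<Longrightarrow> B \<in> S"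
    and j: "j \<le> DIM('a)"
  shows "card {G \<in> small_faces j. \<forall>B\<in>facets. G \<subseteq> B \<longrightarrow> B \<in> S}
    = (\<Sum>A\<in>S. card (restr w A) choose (DIM('a) - j))"
proof -
  define I where "I A = {G. A - restr w A \<subseteq> G \<and> G \<subseteq> A \<and> card G = j}" for A
  \<comment> \<open>For \<open>- w\<close> the facet of least height is the highest one with respect
    to \<open>w\<close>.\<close>
  interpret up: shelled_complex facets "DIM('a)" "restr (- w)" "\<lambda>A. nrm A \<bullet> (- w)"
    by (rule shelled_complex[OF generic_uminus[OF w]])
  have finS: "finite S"
    using S finite_facets finite_subset by blast
  have finI: "finite (I A)" if "A \<in> S" for A
    by (rule finite_subset[of _ "Pow A"]) (use that S finite_facet in \<open>auto simp: I_def\<close>)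
  have "{G \<in> small_faces j. \<forall>B\<in>facets. G \<subseteq> B \<longrightarrow> B \<in> S} = (\<Union>A\<in>S. I A)"
  proof (intro equalityI subsetI)
    fix G assume G: "G \<in> {G \<in> small_faces j. \<forall>B\<in>facets. G \<subseteq> B \<longrightarrow> B \<in> S}"
    then obtain A where "A \<in> facets" "G \<subseteq> A"
      by (auto simp: small_faces_def)
    from up.minimal_facet[OF this] obtain A where A: "A \<in> facets" "restr (- w) A \<subseteq> G" "G \<subseteq> A"
      by blast
    then have "G \<in> I A"
      using G restr_uminus[OF w A(1)] by (auto simp: I_def small_faces_def)
    moreover have "A \<in> S"
      using G A by blast
    ultimately show "G \<in> (\<Union>A\<in>S. I A)"
      by blast
  next
    fix G assume "G \<in> (\<Union>A\<in>S. I A)"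
    then obtain A where A: "A \<in> S" "G \<in> I A" by blast
    have "B \<in> S" if B: "B \<in> facets" "G \<subseteq> B" for B
    proof (cases "B = A")
      case False
      have "A - restr w A \<subseteq> B"
        using A(2) B(2) by (auto simp: I_def)
      from restr_upper[OF w _ B(1) this False] S A(1) down[OF A(1) B(1)] show ?thesis by blast
    qed (use A in simp)
    then show "G \<in> {G \<in> small_faces j. \<forall>B\<in>facets. G \<subseteq> B \<longrightarrow> B \<in> S}"
      using A S by (auto simp: I_def small_faces_def)
  qed
  moreover have "card (\<Union>A\<in>S. I A) = (\<Sum>A\<in>S. card (I A))"
  proof (rule card_UN_disjoint[OF finS])
    show "\<forall>A\<in>S. finite (I A)"
      using finI by blast
    show "\<forall>A\<in>S. \<forall>A'\<in>S. A \<noteq> A' \<longrightarrow> I A \<inter> I A' = {}"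
    proof (intro ballI impI)
      fix A A' assume A: "A \<in> S" "A' \<in> S" "A \<noteq> A'"
      show "I A \<inter> I A' = {}"
      proof (rule ccontr)
        assume "I A \<inter> I A' \<noteq> {}"
        then have "A - restr w A \<subseteq> A'" "A' - restr w A' \<subseteq> A"
          by (auto simp: I_def)
        then have "nrm A' \<bullet> w < nrm A \<bullet> w" "nrm A \<bullet> w < nrm A' \<bullet> w"
          using restr_upper[OF w, of A A'] restr_upper[OF w, of A' A] A S by auto
        then show False by simp
      qed
    qed
  qed
  moreover have "card (I A) = card (restr w A) choose (DIM('a) - j)" if A: "A \<in> S" for A
  proof -
    have Af: "A \<in> facets" using A S by blast
    have finA: "finite A" "card A = DIM('a)" "finite (restr w A)" "restr w A \<subseteq> A"
      using finite_facet[OF Af] card_facet[OF Af] by (auto simp: restr_def)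
    \<comment> \<open>The faces of the interval are counted through their complements in
      \<open>A\<close>, the subsets of \<open>restr w A\<close> of size d - j.\<close>
    have "bij_betw (\<lambda>G. A - G) (I A) {X. X \<subseteq> restr w A \<and> card X = DIM('a) - j}"
    proof (rule bij_betw_byWitness[where f' = "\<lambda>G. A - G"])
      show "\<forall>G\<in>I A. A - (A - G) = G" "\<forall>X\<in>{X. X \<subseteq> restr w A \<and> card X = DIM('a) - j}. A - (A - X) = X"
        using finA(4) by (auto simp: I_def)
      show "(\<lambda>G. A - G) ` I A \<subseteq> {X. X \<subseteq> restr w A \<and> card X = DIM('a) - j}"
        using finA finite_subset by (auto simp: I_def card_Diff_subset)
      show "(\<lambda>G. A - G) ` {X. X \<subseteq> restr w A \<and> card X = DIM('a) - j} \<subseteq> I A"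
      proof safe
        fix X assume X: "X \<subseteq> restr w A" "card X = DIM('a) - j"
        have "X \<subseteq> A" "finite X"
          using X(1) finA finite_subset by blast+
        then show "A - X \<in> I A"
          using X finA(2) j by (auto simp: I_def card_Diff_subset)
      qed
    qed
    then have "card (I A) = card {X. X \<subseteq> restr w A \<and> card X = DIM('a) - j}"
      by (rule bij_betw_same_card)
    then show ?thesis
      by (simp add: n_subsets[OF finA(3)])
  qed
  ultimately show ?thesis
    by simp
qed

section \<open>Facets of negative height\<close>

definition below_count :: "'a \<Rightarrow> nat \<Rightarrow> nat"
  where "below_count w r = card {A \<in> facets. nrm A \<bullet> w < 0 \<and> card (restr w A) = r}"

text \<open>The facets of negative height are the initial segment of the shelling at 0.\<close>

lemma below_count_le:
  assumes "generic w" "s \<le> r" "r \<le> DIM('a)" "DIM('a) \<le> s + r"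
  shows "below_count w r \<le> below_count w s"
proof -
  interpret shelled_complex facets "DIM('a)" "restr w" "\<lambda>A. nrm A \<bullet> w"
    by (rule shelled_complex[OF assms(1)])
  have "infinite (UNIV :: 'a set)"
    using finite_imp_bounded not_bounded_UNIV by blast
  from card_restriction_monotone[OF this assms(2-), of 0] show ?thesis
    by (simp add: below_count_def initial_def conj_ac)
qed

lemma card_restr_le: "A \<in> facets \<Longrightarrow> card (restr w A) \<le> DIM('a)"
  using card_mono[of A "restr w A"] finite_facet card_facet by (auto simp: restr_def)

lemma card_restr_less:
  assumes A: "A \<in> facets" "nrm A \<bullet> w < 0"
  shows "card (restr w A) < DIM('a)"
proof -
  have "restr w A \<noteq> A"
  proof
    assume *: "restr w A = A"
    have "0 < dvec A v \<bullet> w" if "v \<in> A" for v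
      using that * by (auto simp: restr_def)
    from height_pos[OF A(1) this] A(2) show False by simp
  qed
  then have "restr w A \<subset> A"
    by (auto simp: restr_def)
  then show ?thesis
    using psubset_card_mono[of A "restr w A"] finite_facet[OF A(1)] card_facet[OF A(1)] by simp
qed

lemma below_count_DIM: "below_count w DIM('a) = 0"
proof -
  have "{A \<in> facets. nrm A \<bullet> w < 0 \<and> card (restr w A) = DIM('a)} = {}"
  proof (rule ccontr)
    assume "{A \<in> facets. nrm A \<bullet> w < 0 \<and> card (restr w A) = DIM('a)} \<noteq> {}"
    then obtain A where A: "A \<in> facets" "nrm A \<bullet> w < 0" "card (restr w A) = DIM('a)"
      by blast
    then show False
      using card_restr_less[OF A(1,2)] by simp
  qed
  then show ?thesis
    by (simp only: below_count_def card.empty)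
qed

definition below_faces :: "'a \<Rightarrow> nat \<Rightarrow> nat"
  where "below_faces w j = card {G \<in> small_faces j. \<forall>n\<in>face_normals G. n \<bullet> w < 0}"

lemma below_faces_eq:
  assumes "generic w" "j \<le> DIM('a)"
  shows "below_faces w j = (\<Sum>A\<in>{A \<in> facets. nrm A \<bullet> w < 0}. card (restr w A) choose (DIM('a) - j))"
proof -
  have "{G \<in> small_faces j. \<forall>n\<in>face_normals G. n \<bullet> w < 0}
      = {G \<in> small_faces j. \<forall>B\<in>facets. G \<subseteq> B \<longrightarrow> B \<in> {A \<in> facets. nrm A \<bullet> w < 0}}"
    by (auto simp: face_normals_def)
  then show ?thesis
    unfolding below_faces_def using assms by (simp only:) (intro card_small_faces_within, auto)
qed

text \<open>This agrees with the value 0 of the interior angle vector at index -1, so the counting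
  formula also covers the empty face.\<close>

lemma below_faces_0:
  assumes w: "generic w"
  shows "below_faces w 0 = 0"
proof -
  have "card (restr w A) choose DIM('a) = 0" if A: "A \<in> facets" "nrm A \<bullet> w < 0" for A
    using card_restr_less[OF A] by (rule binomial_eq_0)
  then show ?thesis
    unfolding below_faces_eq[OF w le0] by (intro sum.neutral) simp
qed

lemma h_transform_below_faces:
  assumes w: "generic w" and k: "k \<le> DIM('a)"
  shows "h_transform DIM('a) (\<lambda>i. real (below_faces w (nat (i + 1)))) k = real (below_count w (DIM('a) - k))"
proof -
  let ?S = "{A \<in> facets. nrm A \<bullet> w < 0}"
  have "h_transform DIM('a) (\<lambda>i. real (below_faces w (nat (i + 1)))) k
      = (\<Sum>A\<in>?S. if card (restr w A) = DIM('a) - k then 1 else 0)"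
    by (rule h_transform_binomial[OF _ _ _ k])
      (use finite_facets card_restr_le in \<open>simp_all add: below_faces_eq[OF w]\<close>)
  also have "\<dots> = real (card {A \<in> ?S. card (restr w A) = DIM('a) - k})"
    using finite_facets by (subst sum.inter_filter[symmetric]) simp_all
  finally show ?thesis
    by (simp add: below_count_def conj_ac)
qed

text \<open>The classical count of the h-vector by restriction sets, read for the reversed shelling:
  the sets \<open>A - restr w A\<close> have k elements.\<close>

lemma h_vec_eq:
  assumes w: "generic w" and k: "k \<le> DIM('a)"
  shows "h_vec P k = real (card {A \<in> facets. card (restr w A) = DIM('a) - k})"
proof -
  have f: "f_number P (int j - 1) = (\<Sum>A\<in>facets. 1 * real (card (restr w A) choose (DIM('a) - j)))"
    if j: "j \<le> DIM('a)" for j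
  proof -
    have "f_number P (int j - 1) = real (card (small_faces j))"
    proof (cases "j = 0")
      case True
      have "small_faces 0 = {{}}"
      proof -
        have "G = {}" if "card G = 0" "A \<in> facets" "G \<subseteq> A" for G A
          using that finite_subset[OF that(3) finite_facet[OF that(2)]] by simp
        then show ?thesis
          using facets_nonempty unfolding small_faces_def by auto
      qed
      with True show ?thesis
        by (simp add: f_number_def)
    next
      case False
      then show ?thesis
        using j by (simp add: f_number_def faces_of_dim_eq card_image[OF inj_small_faces])
    qed
    also have "small_faces j = {G \<in> small_faces j. \<forall>B\<in>facets. G \<subseteq> B \<longrightarrow> B \<in> facets}"
      by auto
    finally show ?thesis
      using card_small_faces_within[OF w order_refl _ j] by simp
  qed
  have "h_vec P k = (\<Sum>A\<in>facets. if card (restr w A) = DIM('a) - k then 1 else 0)"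
    unfolding h_vec_def by (rule h_transform_binomial[OF finite_facets card_restr_le f k])
  also have "\<dots> = real (card {A \<in> facets. card (restr w A) = DIM('a) - k})"
    using finite_facets by (subst sum.inter_filter[symmetric]) simp_all
  finally show ?thesis .
qed

text \<open>Negating \<open>w\<close> negates heights and complements restriction sets, so every
  facet counted by the h-vector appears on exactly one side.\<close>

lemma below_count_add:
  assumes w: "generic w" and k: "k \<le> DIM('a)"
  shows "real (below_count w (DIM('a) - k)) + real (below_count (- w) k) = h_vec P k"
proof -
  have "card (restr (- w) A) = k \<longleftrightarrow> card (restr w A) = DIM('a) - k" if "A \<in> facets" for A
  proof -
    have "restr w A \<subseteq> A"
      by (auto simp: restr_def)
    then have "card (restr (- w) A) = DIM('a) - card (restr w A)"
      using finite_facet[OF that] card_facet[OF that] finite_subset[of "restr w A" A]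
      by (simp add: restr_uminus[OF w that] card_Diff_subset)
    then show ?thesis
      using card_restr_le[OF that, of w] k by auto
  qed
  then have "{A \<in> facets. card (restr w A) = DIM('a) - k}
      = {A \<in> facets. nrm A \<bullet> w < 0 \<and> card (restr w A) = DIM('a) - k}
        \<union> {A \<in> facets. nrm A \<bullet> (- w) < 0 \<and> card (restr (- w) A) = k}"
    using genericD(1)[OF w] by (auto simp: linorder_neq_iff)
  moreover have "{A \<in> facets. nrm A \<bullet> w < 0 \<and> card (restr w A) = DIM('a) - k}
        \<inter> {A \<in> facets. nrm A \<bullet> (- w) < 0 \<and> card (restr (- w) A) = k} = {}"
    by auto
  ultimately show ?thesis
    unfolding h_vec_eq[OF w k] below_count_def using finite_facets
    by (simp add: card_Un_disjoint)
qed

section \<open>Reflection in the origin\<close>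

lemma uminus_image_eq: "uminus ` {x. \<forall>n\<in>M. n \<bullet> x \<le> 0} = {x :: 'a. \<forall>n\<in>M. 0 \<le> n \<bullet> x}"
proof (intro equalityI subsetI)
  fix x :: 'a assume "x \<in> {x. \<forall>n\<in>M. 0 \<le> n \<bullet> x}"
  then have "- x \<in> {x. \<forall>n\<in>M. n \<bullet> x \<le> 0}" by simp
  then show "x \<in> uminus ` {x. \<forall>n\<in>M. n \<bullet> x \<le> 0}"
    by (intro image_eqI[of _ _ "- x"]) simp_all
qed auto

lemma linear_uminus': "linear (uminus :: 'a \<Rightarrow> 'a)" "inj (uminus :: 'a \<Rightarrow> 'a)" "bounded_linear (uminus :: 'a \<Rightarrow> 'a)"
  by (simp_all add: linear_uminus inj_def bounded_linear_minus[OF bounded_linear_ident])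

lemma faces_of_dim_uminus: "faces_of_dim i (uminus ` P) = (`) uminus ` faces_of_dim i P"
proof (intro equalityI subsetI)
  fix X assume X: "X \<in> faces_of_dim i (uminus ` P)"
  have "X = uminus ` uminus ` X"
    by (simp add: image_image)
  moreover have "uminus ` X face_of P"
    using X face_of_linear_image[OF linear_uminus'(1,2), of X "uminus ` P"]
    by (simp add: faces_of_dim_def image_image)
  moreover have "aff_dim (uminus ` X) = i"
    using X linear_uminus' by (simp add: faces_of_dim_def)
  ultimately show "X \<in> (`) uminus ` faces_of_dim i P"
    unfolding faces_of_dim_def by blast
next
  fix X assume "X \<in> (`) uminus ` faces_of_dim i P"
  then show "X \<in> faces_of_dim i (uminus ` P)"
    using face_of_linear_image[OF linear_uminus'(1,2)] linear_uminus'
    by (auto simp: faces_of_dim_def)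
qed

lemma tangent_cone_uminus: "tangent_cone (uminus ` F) (uminus ` P) = uminus ` tangent_cone F P"
proof -
  have "rel_interior (uminus ` F) = uminus ` rel_interior F"
    by (rule rel_interior_injective_linear_image[OF linear_uminus'(3,2)])
  moreover have "- q + e *\<^sub>R x \<in> uminus ` P \<longleftrightarrow> q + e *\<^sub>R (- x) \<in> P" for q e x
  proof -
    have eq: "- q + e *\<^sub>R x = - (q + e *\<^sub>R (- x))"
      by simp
    have "- y \<in> uminus ` P \<longleftrightarrow> y \<in> P" for y
      by (simp add: image_iff)
    then show ?thesis
      by (simp only: eq)
  qed
  ultimately have "x \<in> tangent_cone (uminus ` F) (uminus ` P) \<longleftrightarrow> - x \<in> tangent_cone F P" for x
    by (auto simp: tangent_cone_def)
  moreover have "x \<in> uminus ` S \<longleftrightarrow> - x \<in> S" for x :: 'a and S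
    by (auto intro: image_eqI[of _ _ "- x"])
  ultimately show ?thesis
    by blast
qed

text \<open>Both vectors are expressed by the normals of \<open>P\<close>, with opposite signs, so
  that one family of chambers serves \<open>P\<close> and its reflection.\<close>

lemma interior_angle_eq:
  assumes "1 \<le> j" "j \<le> DIM('a)"
  shows "interior_angle \<alpha> P (int j - 1) = (\<Sum>G\<in>small_faces j. \<alpha> {x. \<forall>n\<in>face_normals G. n \<bullet> x \<le> 0})"
    and "interior_angle \<alpha> (uminus ` P) (int j - 1) = (\<Sum>G\<in>small_faces j. \<alpha> {x. \<forall>n\<in>face_normals G. 0 \<le> n \<bullet> x})"
proof -
  have "interior_angle \<alpha> P (int j - 1) = (\<Sum>G\<in>small_faces j. \<alpha> (tangent_cone (convex hull G) P))"
    using assms by (simp add: interior_angle_def faces_of_dim_eq sum.reindex[OF inj_small_faces])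
  also have "\<dots> = (\<Sum>G\<in>small_faces j. \<alpha> {x. \<forall>n\<in>face_normals G. n \<bullet> x \<le> 0})"
    using assms(1) by (intro sum.cong refl) (simp add: tangent_cone_face)
  finally show "interior_angle \<alpha> P (int j - 1) = (\<Sum>G\<in>small_faces j. \<alpha> {x. \<forall>n\<in>face_normals G. n \<bullet> x \<le> 0})" .
  have inj: "inj_on ((`) uminus) ((hull) convex ` small_faces j)"
    using linear_uminus'(2) by (auto intro!: inj_onI simp: inj_image_eq_iff)
  have "interior_angle \<alpha> (uminus ` P) (int j - 1)
      = (\<Sum>G\<in>small_faces j. \<alpha> (tangent_cone (uminus ` (convex hull G)) (uminus ` P)))"
    using assms by (simp add: interior_angle_def faces_of_dim_uminus faces_of_dim_eq
        sum.reindex[OF inj] sum.reindex[OF inj_small_faces])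
  also have "\<dots> = (\<Sum>G\<in>small_faces j. \<alpha> {x. \<forall>n\<in>face_normals G. 0 \<le> n \<bullet> x})"
    using assms(1) by (intro sum.cong refl) (simp add: tangent_cone_uminus tangent_cone_face uminus_image_eq)
  finally show "interior_angle \<alpha> (uminus ` P) (int j - 1)
      = (\<Sum>G\<in>small_faces j. \<alpha> {x. \<forall>n\<in>face_normals G. 0 \<le> n \<bullet> x})" .
qed

text \<open>The weights are the angles of the chambers and the points \<open>w T\<close> lie inside
  them. A tangent cone contributes the weight of a chamber exactly when its normals are negative at
  \<open>w T\<close>, and for the reflected polytope at \<open>- w T\<close>.\<close>

theorem gamma_vec_decomposition:
  assumes \<alpha>: "cone_angle \<alpha>" and nonneg: "nonneg_on_cones \<alpha>"
  shows "\<exists>\<T> (c :: 'a set \<Rightarrow> real) w. finite \<T> \<and> (\<forall>T\<in>\<T>. 0 \<le> c T \<and> generic (w T)) \<and> sum c \<T> = 1 \<and>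
    (\<forall>k\<le>DIM('a). gamma_vec \<alpha> P k = (\<Sum>T\<in>\<T>. c T * real (below_count (w T) (DIM('a) - k)))
      \<and> gamma_vec \<alpha> (uminus ` P) k = (\<Sum>T\<in>\<T>. c T * real (below_count (- w T) (DIM('a) - k))))"
proof -
  note N = finite_normals zero_notin_normals
  define c where "c T = \<alpha> (chamber normals T)" for T
  \<comment> \<open>Chambers of angle zero are discarded, since they need not have a point with
    strict signs.\<close>
  define \<T> where "\<T> = {T \<in> Pow normals. c T \<noteq> 0}"
  have fin: "finite \<T>"
    using N(1) by (simp add: \<T>_def)
  have "\<exists>w. \<forall>n\<in>normals. (if n \<in> T then 0 < n \<bullet> w else n \<bullet> w < 0)" if "T \<in> \<T>" for T
    using generic_point_of_chamber[OF \<alpha> N, of T] that by (auto simp: \<T>_def c_def)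
  then obtain w where w: "\<And>T n. T \<in> \<T> \<Longrightarrow> n \<in> normals \<Longrightarrow> (if n \<in> T then 0 < n \<bullet> w T else n \<bullet> w T < 0)"
    by metis
  have gen: "generic (w T)" if "T \<in> \<T>" for T
    unfolding generic_def using w[OF that] by (force split: if_splits)
  have c0: "0 \<le> c T" if "T \<in> \<T>" for T
    using nonneg polyhedral_cone_chamber[OF N(1), of T] that by (auto simp: c_def \<T>_def nonneg_on_cones_def)
  have restrict: "(\<Sum>T\<in>Pow normals. if Q T then c T else 0) = (\<Sum>T\<in>\<T>. c T * (if Q T then 1 else 0))" for Q
    using N(1) by (intro sum.mono_neutral_cong_right) (auto simp: \<T>_def)
  have sum1: "sum c \<T> = 1"
    using cone_angle_sum_chambers[OF \<alpha> N] restrict[of "\<lambda>_. True"] by (simp add: c_def)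
  have disj: "M \<inter> T = {} \<longleftrightarrow> (\<forall>n\<in>M. n \<bullet> w T < 0)" "M \<subseteq> T \<longleftrightarrow> (\<forall>n\<in>M. n \<bullet> (- w T) < 0)"
    if "T \<in> \<T>" "M \<subseteq> normals" for T M
  proof -
    have "n \<in> T \<longleftrightarrow> 0 < n \<bullet> w T" "n \<notin> T \<longleftrightarrow> n \<bullet> w T < 0" if "n \<in> M" for n
      using w[OF \<open>T \<in> \<T>\<close>, of n] that \<open>M \<subseteq> normals\<close> by (auto split: if_splits)
    then show "M \<inter> T = {} \<longleftrightarrow> (\<forall>n\<in>M. n \<bullet> w T < 0)" "M \<subseteq> T \<longleftrightarrow> (\<forall>n\<in>M. n \<bullet> (- w T) < 0)"
      by auto
  qed
  have count: "(\<Sum>G\<in>small_faces j. \<Sum>T\<in>\<T>. c T * (if \<forall>n\<in>face_normals G. n \<bullet> f T < 0 then 1 else 0))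
      = (\<Sum>T\<in>\<T>. c T * real (below_faces (f T) j))" for f j
  proof -
    have "(\<Sum>G\<in>small_faces j. if \<forall>n\<in>face_normals G. n \<bullet> f T < 0 then 1 else 0) = real (below_faces (f T) j)" for T
      unfolding below_faces_def using finite_small_faces
      by (subst sum.inter_filter[symmetric]) simp_all
    then show ?thesis
      by (subst sum.swap) (simp add: sum_distrib_left[symmetric])
  qed
  have angle: "interior_angle \<alpha> P (int j - 1) = (\<Sum>T\<in>\<T>. c T * real (below_faces (w T) j))"
    and angle': "interior_angle \<alpha> (uminus ` P) (int j - 1) = (\<Sum>T\<in>\<T>. c T * real (below_faces (- w T) j))"
    if j: "j \<le> DIM('a)" for j
  proof -
    have "interior_angle \<alpha> P (int j - 1) = (\<Sum>T\<in>\<T>. c T * real (below_faces (w T) j)) \<and>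
      interior_angle \<alpha> (uminus ` P) (int j - 1) = (\<Sum>T\<in>\<T>. c T * real (below_faces (- w T) j))"
    proof (cases "j = 0")
      case True
      then show ?thesis
        using below_faces_0 gen generic_uminus by (simp add: interior_angle_def)
    next
      case False
      then have j1: "1 \<le> j" by simp
      have "\<alpha> {x. \<forall>n\<in>face_normals G. n \<bullet> x \<le> 0}
          = (\<Sum>T\<in>\<T>. c T * (if \<forall>n\<in>face_normals G. n \<bullet> w T < 0 then 1 else 0))" for G
        unfolding cone_angle_eq_chamber_sum(1)[OF \<alpha> N face_normals_subset] c_def[symmetric] restrict
        using disj(1)[OF _ face_normals_subset] by (intro sum.cong refl) simp
      moreover have "\<alpha> {x. \<forall>n\<in>face_normals G. 0 \<le> n \<bullet> x}
          = (\<Sum>T\<in>\<T>. c T * (if \<forall>n\<in>face_normals G. n \<bullet> (- w T) < 0 then 1 else 0))" for G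
        unfolding cone_angle_eq_chamber_sum(2)[OF \<alpha> N face_normals_subset] c_def[symmetric] restrict
        using disj(2)[OF _ face_normals_subset] by (intro sum.cong refl) simp
      ultimately show ?thesis
        unfolding interior_angle_eq[OF j1 j] by (simp only: count)
    qed
    then show "interior_angle \<alpha> P (int j - 1) = (\<Sum>T\<in>\<T>. c T * real (below_faces (w T) j))"
      "interior_angle \<alpha> (uminus ` P) (int j - 1) = (\<Sum>T\<in>\<T>. c T * real (below_faces (- w T) j))"
      by auto
  qed
  have gamma: "h_transform DIM('a) a k = (\<Sum>T\<in>\<T>. c T * real (below_count (f T) (DIM('a) - k)))"
    if k: "k \<le> DIM('a)" and f: "\<And>T. T \<in> \<T> \<Longrightarrow> generic (f T)"
      and a: "\<And>j. j \<le> DIM('a) \<Longrightarrow> a (int j - 1) = (\<Sum>T\<in>\<T>. c T * real (below_faces (f T) j))" for a k f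
  proof -
    have "h_transform DIM('a) a k
        = (\<Sum>T\<in>\<T>. c T * h_transform DIM('a) (\<lambda>i. real (below_faces (f T) (nat (i + 1)))) k)"
      by (rule h_transform_linear) (simp add: a)
    also have "\<dots> = (\<Sum>T\<in>\<T>. c T * real (below_count (f T) (DIM('a) - k)))"
      by (intro sum.cong refl) (simp add: h_transform_below_faces[OF f k])
    finally show ?thesis .
  qed
  have g1: "gamma_vec \<alpha> P k = (\<Sum>T\<in>\<T>. c T * real (below_count (w T) (DIM('a) - k)))"
    if "k \<le> DIM('a)" for k
    unfolding gamma_vec_def by (rule gamma[where f = w, OF that gen angle])
  have g2: "gamma_vec \<alpha> (uminus ` P) k = (\<Sum>T\<in>\<T>. c T * real (below_count (- w T) (DIM('a) - k)))"
    if "k \<le> DIM('a)" for k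
    unfolding gamma_vec_def by (rule gamma[where f = "\<lambda>T. - w T", OF that generic_uminus[OF gen] angle'])
  show ?thesis
    by (intro exI[of _ \<T>] exI[of _ c] exI[of _ w] conjI ballI allI impI)
      (assumption | rule fin c0 gen sum1 g1 g2)+
qed

end

theorem theorem1p3:
  fixes \<alpha> :: "'a::euclidean_space set \<Rightarrow> real" and P :: "'a set"
  assumes "cone_angle \<alpha>"
    and "nonneg_on_cones \<alpha>"
    and "simplicial_polytope P"
  shows "(\<forall>i\<le>DIM('a). gamma_vec \<alpha> P i + gamma_vec \<alpha> (uminus ` P) (DIM('a) - i) = h_vec P i)
    \<and> (\<forall>i\<le>DIM('a). 0 \<le> gamma_vec \<alpha> P i)
    \<and> gamma_vec \<alpha> P 0 = 0
    \<and> (\<forall>i. int i < \<lceil>real DIM('a) / 2\<rceil> \<longrightarrow> gamma_vec \<alpha> P i \<le> gamma_vec \<alpha> P (i + 1))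
    \<and> (\<forall>i. int i \<le> \<lfloor>real DIM('a) / 2\<rfloor> \<longrightarrow> gamma_vec \<alpha> P i \<le> gamma_vec \<alpha> P (DIM('a) - i))"
proof -
  have P: "convex P" "aff_dim P = int DIM('a)"
    using assms(3) by (auto simp: simplicial_polytope_def full_polytope_def polytope_imp_convex)
  then have "affine hull P = UNIV"
    by (simp add: aff_dim_eq_full)
  then have "interior P = rel_interior P"
    by (rule rel_interior_interior[symmetric])
  moreover have "P \<noteq> {}"
    using P(2) by auto
  ultimately have "interior P \<noteq> {}"
    using rel_interior_eq_empty[OF P(1)] by simp
  then obtain z where "z \<in> interior P"
    by blast
  then interpret simplicial_geometry P z
    using assms(3) by unfold_locales
  obtain \<T> :: "'a set set" and c w where fin: "finite \<T>"
    and c: "\<And>T. T \<in> \<T> \<Longrightarrow> 0 \<le> c T" and w: "\<And>T. T \<in> \<T> \<Longrightarrow> generic (w T)" and sum1: "sum c \<T> = (1::real)"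
    and \<gamma>: "\<And>k. k \<le> DIM('a) \<Longrightarrow> gamma_vec \<alpha> P k = (\<Sum>T\<in>\<T>. c T * real (below_count (w T) (DIM('a) - k)))"
    and \<gamma>': "\<And>k. k \<le> DIM('a) \<Longrightarrow> gamma_vec \<alpha> (uminus ` P) k = (\<Sum>T\<in>\<T>. c T * real (below_count (- w T) (DIM('a) - k)))"
    using gamma_vec_decomposition[OF assms(1,2)] by blast
  \<comment> \<open>The inequality for restriction sizes r = d - i and s = d - k, where d \<le> r +
    s becomes i + k \<le> d. Both (3) and (4) are instances.\<close>
  have mono: "gamma_vec \<alpha> P i \<le> gamma_vec \<alpha> P k"
    if "i \<le> k" "k \<le> DIM('a)" "i + k \<le> DIM('a)" for i k
  proof -
    have "below_count (w T) (DIM('a) - i) \<le> below_count (w T) (DIM('a) - k)" if "T \<in> \<T>" for T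
      by (rule below_count_le[OF w[OF that]]) (use \<open>i \<le> k\<close> \<open>k \<le> DIM('a)\<close> \<open>i + k \<le> DIM('a)\<close> in auto)
    then show ?thesis
      using that c by (simp add: \<gamma> sum_mono mult_left_mono)
  qed
  have "gamma_vec \<alpha> P i + gamma_vec \<alpha> (uminus ` P) (DIM('a) - i) = h_vec P i" if i: "i \<le> DIM('a)" for i
  proof -
    have "gamma_vec \<alpha> P i + gamma_vec \<alpha> (uminus ` P) (DIM('a) - i)
        = (\<Sum>T\<in>\<T>. c T * (real (below_count (w T) (DIM('a) - i)) + real (below_count (- w T) i)))"
      using i by (simp add: \<gamma> \<gamma>' sum.distrib distrib_left)
    also have "\<dots> = (\<Sum>T\<in>\<T>. c T * h_vec P i)"
      by (intro sum.cong refl) (simp only: below_count_add[OF w i])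
    also have "\<dots> = h_vec P i"
      by (simp add: sum_distrib_right[symmetric] sum1)
    finally show ?thesis .
  qed
  moreover have "0 \<le> gamma_vec \<alpha> P i" if "i \<le> DIM('a)" for i
    unfolding \<gamma>[OF that] using c by (intro sum_nonneg) simp
  moreover have "gamma_vec \<alpha> P 0 = 0"
    by (simp add: \<gamma> below_count_DIM)
  moreover have "gamma_vec \<alpha> P i \<le> gamma_vec \<alpha> P (i + 1)" if "int i < \<lceil>real DIM('a) / 2\<rceil>" for i
  proof (rule mono)
    \<comment> \<open>Being below the ceiling of d/2 is exactly the condition i + (i + 1) \<le> d
      for consecutive entries.\<close>
    have "2 * i + 1 \<le> DIM('a)"
      using that by linarith
    then show "i \<le> i + 1" "i + 1 \<le> DIM('a)" "i + (i + 1) \<le> DIM('a)"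
      by auto
  qed
  moreover have "gamma_vec \<alpha> P i \<le> gamma_vec \<alpha> P (DIM('a) - i)" if "int i \<le> \<lfloor>real DIM('a) / 2\<rfloor>" for i
  proof (rule mono)
    have "2 * i \<le> DIM('a)"
      using that by linarith
    then show "i \<le> DIM('a) - i" "DIM('a) - i \<le> DIM('a)" "i + (DIM('a) - i) \<le> DIM('a)"
      by auto
  qed
  ultimately show ?thesis
    by blast
qed

end
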